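(* The Hermitian structure of $E^{(\eta,[Y])}$ comes from a ($\tilde G$-invariant) reproducing kernel if and only if $\eta>0$ and $$I+Y_j\Big(\sum_{k=0}^{j-1}\frac{(-1)^{j+k}}{(j-k)!\,(2\eta+j+k-1)_{j-k}}\,Y_{j-1}\cdots Y_{k+1}Y_{k+1}^*\cdots Y_{j-1}^*\Big)Y_j^*>0$$ (positive definite) for $j=1,2,\dots,m$.
   Context: $G=\mathrm{SU}(1,1)$ acts on the unit disc $\mathbb D$ by $g\cdot z=(az+b)(cz+d)^{-1}$ for $g=\begin{pmatrix}a&b\\ c&d\end{pmatrix}\in G$ (so $c=\bar b$, $d=\bar a$). $\tilde G$ is the universal covering group of $G$, acting on $\mathbb D$ through $G$. For $g\in\tilde G$, $c_g$ is the lower left entry of the image of $g$ in $G$, $g'(z)$ is the complex derivative of $z\mapsto g\cdot z$, and for real $\lambda$, $g'(z)^\lambda$ is the real analytic function on $\tilde G\times\mathbb D$, holomorphic in $z$, which is given by the principal branch for $g$ near the identity. Pochhammer symbol: $(x)_n=x(x+1)\cdots(x+n-1)$, $(x)_0=1$. Empty products of matrices are identities. Data: $\eta\in\mathbb R$, $m\ge 0$, $d_0,\dots,d_m\ge1$, $d=d_0+\cdots+d_m$, $\mathbb C^d=\bigoplus_{j=0}^m\mathbb C^{d_j}$; "block" refers to this decomposition. $Y$ is the block matrix whose only nonzero blocks are $Y_j:\mathbb C^{d_{j-1}}\to\mathbb C^{d_j}$ in position $(j,j-1)$, $1\le j\le m$ (arbitrary matrices). $E^{(\eta,Y)}$ is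 the $\tilde G$-homogeneous holomorphic vector bundle over $\mathbb D$ which in its canonical trivialization is $\mathbb D\times\mathbb C^d$ with action $g\cdot(z,\xi)=(g\cdot z,J_g(z)^{-1}\xi)$, where $J_g(z)=J_g^{(\eta,Y)}(z)$ has $(p,\ell)$ block $$\frac{1}{(p-\ell)!}(-c_g)^{p-\ell}\,g'(z)^{\eta+\frac{p+\ell}{2}}\,Y_p\cdots Y_{\ell+1}\quad(p\ge\ell),\qquad 0\quad(p<\ell).$$ A $\tilde G$-invariant Hermitian structure is $\|\xi\|_z^2=\langle H(z)\xi,\xi\rangle$ with $H(g\cdot z)=J_g(z)^*H(z)J_g(z)$, and is determined by the positive definite block diagonal matrix $H=H(0)$; the Hermitian bundle is written $(E^{(\eta,Y)},H)$. $[Y]$ is the class of $Y$ under conjugation by block diagonal unitaries and $E^{(\eta,[Y])}$ is the equivalence class of $(E^{(\eta,Y)},I)$. The Hermitian structure comes from a ($\tilde G$-invariant) reproducing kernel if there is a Hilbert space of holomorphic sections (holomorphic functions $\mathbb D\to\mathbb C^d$ in the trivialization), with continuous and surjective point evaluations, on which $\tilde G$ acts isometrically by $f\mapsto J_g(z)f(g\cdot z)$, and whose reproducing kernel $K(z,w)$ satisfies $H(z)=K(z,z)^{-1}$. Invariance means $J_g(z)K(g\cdot z,g\cdot w)J_g(w)^*=K(z,w)$.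
   Formalization: The Hilbert space of holomorphic sections giving the reproducing kernel is also required to be invariant under multiplication by z; without this "only if" fails, e.g. for η=0, m=0 (constant functions), or η>0, m=1, d_0=d_1=1, |Y_1|²=2η. *)

theory Defs
  imports "HOL-Analysis.Analysis"
begin

abbreviation unit_disc :: "complex set" where
  "unit_disc \<equiv> ball 0 1"

definition SU11 :: "(complex^2^2) set" where
  "SU11 = {A. A $ 2 $ 1 = cnj (A $ 1 $ 2) \<and> A $ 2 $ 2 = cnj (A $ 1 $ 1) \<and> det A = 1}"

definition moebius :: "complex^2^2 \<Rightarrow> complex \<Rightarrow> complex" where
  "moebius A z = (A $ 1 $ 1 * z + A $ 1 $ 2) / (A $ 2 $ 1 * z + A $ 2 $ 2)"

text \<open>
  The universal covering group of \<^const>\<open>SU11\<close> is realised as the set of pairs consisting of a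
  matrix with last row \<open>(c, d)\<close> and a logarithm of \<open>d\<close>; the covering projection is \<^const>\<open>fst\<close>, and
  the identity is \<open>(mat 1, 0)\<close>, which determines the group structure. See \<open>covering_space_SU11_cover\<close> and
  \<open>simply_connected_SU11_cover\<close> below.
\<close>

definition SU11_cover :: "((complex^2^2) \<times> complex) set" where
  "SU11_cover = {(A, \<omega>). A \<in> SU11 \<and> exp \<omega> = A $ 2 $ 2}"

text \<open>
  \<open>log_denom (A, \<omega>)\<close> is the holomorphic branch on the disc of the logarithm of \<open>c z + d\<close> that
  equals \<open>\<omega>\<close> at \<open>0\<close>; here \<open>\<bar>c\<bar> < \<bar>d\<bar>\<close>, so the argument of \<^const>\<open>Ln\<close> has positive real part.
  As \<open>g'(z) = (c z + d)\<^sup>-\<^sup>2\<close>, the power of \<open>g'(z)\<close> with exponent \<open>s\<close> is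
  \<open>exp (- 2 s log_denom g z)\<close>.
\<close>

definition log_denom :: "(complex^2^2) \<times> complex \<Rightarrow> complex \<Rightarrow> complex" where
  "log_denom g z = snd g + Ln (1 + fst g $ 2 $ 1 / fst g $ 2 $ 2 * z)"

definition deriv_power :: "(complex^2^2) \<times> complex \<Rightarrow> real \<Rightarrow> complex \<Rightarrow> complex" where
  "deriv_power g s z = exp (- 2 * of_real s * log_denom g z)"

lemma covering_space_pullback:
  assumes q: "covering_space C q B" and f: "continuous_on S f" "f ` S \<subseteq> B"
  shows "covering_space {(x, c). x \<in> S \<and> c \<in> C \<and> q c = f x} fst S"
    (is "covering_space ?P fst S")
proof
  show "continuous_on ?P fst" by (intro continuous_intros)
  show "fst ` ?P = S"
    using covering_space_imp_surjective[OF q] f(2) by (force simp: image_iff)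
next
  fix x assume x: "x \<in> S"
  then have "f x \<in> B" using f(2) by blast
  then obtain T \<V> where T: "f x \<in> T" "openin (top_of_set B) T"
    and \<V>: "\<Union>\<V> = C \<inter> q -` T" "\<And>u. u \<in> \<V> \<Longrightarrow> openin (top_of_set C) u"
      "pairwise disjnt \<V>" "\<And>u. u \<in> \<V> \<Longrightarrow> \<exists>r. homeomorphism u T q r"
    using q unfolding covering_space_def by meson
  define T' where "T' = S \<inter> f -` T"
  define lift where "lift = (\<lambda>u. ?P \<inter> (T' \<times> u))"
  have opT': "openin (top_of_set S) T'"
    unfolding T'_def
    using f T(2) by (metis continuous_openin_preimage image_subset_iff_funcset)
  show "\<exists>T. x \<in> T \<and> openin (top_of_set S) T \<and>
          (\<exists>v. \<Union>v = ?P \<inter> fst -` T \<and> (\<forall>u \<in> v. openin (top_of_set ?P) u) \<and>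
            pairwise disjnt v \<and> (\<forall>u \<in> v. \<exists>q. homeomorphism u T fst q))"
  proof (intro exI[of _ T'] conjI exI[of _ "lift ` \<V>"] ballI)
    show "x \<in> T'" using x T by (simp add: T'_def)
    show "openin (top_of_set S) T'" by (fact opT')
    have "c \<in> \<Union>\<V>" if "(y, c) \<in> ?P" "y \<in> T'" for y c
      using that \<V>(1) by (auto simp: T'_def)
    then show "\<Union>(lift ` \<V>) = ?P \<inter> fst -` T'"
      unfolding lift_def by fastforce
    show "pairwise disjnt (lift ` \<V>)"
    proof (rule pairwise_imageI)
      fix u v assume "u \<in> \<V>" "v \<in> \<V>" "u \<noteq> v" "lift u \<noteq> lift v"
      then have "disjnt u v" using \<V>(3) by (auto simp: pairwise_def)
      then show "disjnt (lift u) (lift v)"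
        by (auto simp: lift_def disjnt_def)
    qed
  next
    fix w assume "w \<in> lift ` \<V>"
    then obtain u where u: "u \<in> \<V>" "w = lift u" by blast
    obtain O1 where O1: "open O1" "T' = S \<inter> O1" using opT' by (auto simp: openin_open)
    obtain O2 where O2: "open O2" "u = C \<inter> O2" using \<V>(2)[OF u(1)] by (auto simp: openin_open)
    have "w = ?P \<inter> (O1 \<times> O2)"
      using O1(2) O2(2) u(2) by (auto simp: lift_def)
    then show "openin (top_of_set ?P) w"
      using O1(1) O2(1) by (auto simp: openin_open intro: open_Times)
    obtain r where r: "homeomorphism u T q r" using \<V>(4) u(1) by blast
    have uC: "u \<subseteq> C" using O2 by blast
    have "homeomorphism w T' fst (\<lambda>y. (y, r (f y)))"
    proof (rule homeomorphismI)
      show "continuous_on w fst" by (intro continuous_intros)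
      have "continuous_on T' (\<lambda>y. r (f y))"
      proof (rule continuous_on_compose2[of T r])
        show "continuous_on T r" using r by (simp add: homeomorphism_def)
        show "continuous_on T' f" using f(1) by (rule continuous_on_subset) (simp add: T'_def)
        show "f ` T' \<subseteq> T" by (auto simp: T'_def)
      qed
      then show "continuous_on T' (\<lambda>y. (y, r (f y)))" by (intro continuous_intros)
      show "fst ` w \<subseteq> T'" by (auto simp: u lift_def)
      have *: "r (f y) \<in> u \<and> q (r (f y)) = f y" if "y \<in> T'" for y
        using that r by (auto simp: homeomorphism_def T'_def)
      show "(\<lambda>y. (y, r (f y))) ` T' \<subseteq> w"
        using * uC by (auto simp: u lift_def T'_def)
      show "\<And>y. y \<in> w \<Longrightarrow> (fst y, r (f (fst y))) = y"
        using r by (auto simp: u lift_def homeomorphism_def T'_def)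
      show "\<And>y. y \<in> T' \<Longrightarrow> fst (y, r (f y)) = y" by simp
    qed
    then show "\<exists>q. homeomorphism w T' fst q" by blast
  qed
qed

lemma SU11_norm:
  assumes "A \<in> SU11"
  shows "(norm (A $ 2 $ 2))\<^sup>2 = 1 + (norm (A $ 2 $ 1))\<^sup>2"
proof -
  have "A $ 1 $ 1 = cnj (A $ 2 $ 2)" "A $ 1 $ 2 = cnj (A $ 2 $ 1)"
    and "A $ 1 $ 1 * A $ 2 $ 2 - A $ 1 $ 2 * A $ 2 $ 1 = 1"
    using assms by (auto simp: SU11_def det_2)
  then have "complex_of_real ((norm (A $ 2 $ 2))\<^sup>2) = of_real (1 + (norm (A $ 2 $ 1))\<^sup>2)"
    by (simp add: complex_norm_square algebra_simps del: of_real_power)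
  then show ?thesis by (simp only: of_real_eq_iff)
qed

lemma SU11_less:
  assumes "A \<in> SU11"
  shows "norm (A $ 2 $ 1) < norm (A $ 2 $ 2)"
  by (rule power2_less_imp_less) (use SU11_norm[OF assms] in auto)

theorem covering_space_SU11_cover: "covering_space SU11_cover fst SU11"
proof -
  have "covering_space {(A, \<omega>). A \<in> SU11 \<and> \<omega> \<in> UNIV \<and> exp \<omega> = A $ 2 $ 2} fst SU11"
  proof (rule covering_space_pullback[OF covering_space_exp_punctured_plane])
    show "continuous_on SU11 (\<lambda>A. A $ 2 $ 2)" by (intro continuous_intros)
    show "(\<lambda>A. A $ 2 $ 2) ` SU11 \<subseteq> - {0}" using SU11_less by force
  qed
  then show ?thesis by (simp add: SU11_cover_def)
qed

theorem simply_connected_SU11_cover: "simply_connected SU11_cover"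
proof -
  define F :: "(complex^2^2) \<times> complex \<Rightarrow> complex \<times> real"
    where "F = (\<lambda>g. (fst g $ 2 $ 1, Im (snd g)))"
  define W :: "complex \<times> real \<Rightarrow> complex"
    where "W = (\<lambda>(c, t). Complex (ln (1 + (norm c)\<^sup>2) / 2) t)"
  define G :: "complex \<times> real \<Rightarrow> (complex^2^2) \<times> complex"
    where "G = (\<lambda>x. (\<chi> i j. if i = 1 then if j = 1 then cnj (exp (W x)) else cnj (fst x)
               else if j = 1 then fst x else exp (W x), W x))"
  have pos: "1 + (norm c)\<^sup>2 > 0" for c :: complex
    by (smt (verit) zero_le_power2)
  have normW: "(norm (exp (W x)))\<^sup>2 = 1 + (norm (fst x))\<^sup>2" for x
    using pos[of "fst x"] by (cases x) (simp add: W_def exp_half_le2 flip: exp_double)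
  have W_F: "W (F g) = snd g" if "g \<in> SU11_cover" for g
  proof -
    have "(norm (exp (snd g)))\<^sup>2 = 1 + (norm (fst g $ 2 $ 1))\<^sup>2"
      using SU11_norm[of "fst g"] that by (simp add: SU11_cover_def case_prod_beta)
    then have "exp (2 * Re (snd g)) = 1 + (norm (fst g $ 2 $ 1))\<^sup>2"
      by (simp add: exp_double)
    then have "2 * Re (snd g) = ln (1 + (norm (fst g $ 2 $ 1))\<^sup>2)"
      by (metis ln_exp)
    then show ?thesis by (simp add: W_def F_def complex_eq_iff)
  qed
  have contW: "continuous_on UNIV W"
    unfolding W_def case_prod_unfold Complex_eq
    by (intro continuous_intros ballI) (simp_all add: less_imp_neq[OF pos, symmetric])
  have "homeomorphism SU11_cover UNIV F G"
  proof (rule homeomorphismI)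
    show "continuous_on SU11_cover F" unfolding F_def by (intro continuous_intros)
    show "continuous_on UNIV G"
    proof -
      have "continuous_on UNIV (\<lambda>x. if i = 1 then if j = 1 then cnj (exp (W x)) else cnj (fst x)
               else if j = 1 then fst x else exp (W x))" for i j :: 2
        by (cases "i = 1"; cases "j = 1") (auto intro!: continuous_intros contW)
      then show ?thesis
        unfolding G_def by (intro continuous_on_Pair continuous_on_vec_lambda contW)
    qed
    show "F ` SU11_cover \<subseteq> UNIV" by simp
    have "det (fst (G x)) = 1" for x
    proof -
      have "of_real ((norm (exp (W x)))\<^sup>2) = (1 + of_real ((norm (fst x))\<^sup>2) :: complex)"
        by (simp only: normW of_real_add of_real_1)
      then show ?thesis
        by (simp add: G_def det_2 complex_norm_square mult.commute algebra_simps
            del: of_real_power norm_exp_eq_Re)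
    qed
    then have "G x \<in> SU11_cover" for x
      by (auto simp: SU11_cover_def SU11_def G_def)
    then show "G ` UNIV \<subseteq> SU11_cover" by blast
    show "G (F g) = g" if g: "g \<in> SU11_cover" for g
    proof -
      have "fst g $ 2 $ 1 = cnj (fst g $ 1 $ 2)" "fst g $ 2 $ 2 = cnj (fst g $ 1 $ 1)"
        "exp (snd g) = fst g $ 2 $ 2"
        using g by (auto simp: SU11_cover_def SU11_def)
      then show ?thesis
        unfolding G_def W_F[OF g] by (simp add: prod_eq_iff vec_eq_iff forall_2 F_def)
    qed
    show "F (G x) = x" for x
      by (cases x) (simp add: F_def G_def W_def)
  qed
  then have "SU11_cover homeomorphic (UNIV :: (complex \<times> real) set)"
    by (auto simp: homeomorphic_def)
  then show ?thesis
    by (simp add: homeomorphic_simply_connected_eq convex_imp_simply_connected)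
qed

lemma exp_log_denom:
  assumes g: "g \<in> SU11_cover" and z: "z \<in> unit_disc"
  shows "exp (log_denom g z) = fst g $ 2 $ 1 * z + fst g $ 2 $ 2"
    and "fst g $ 2 $ 1 * z + fst g $ 2 $ 2 \<noteq> 0"
    and "0 < Re (1 + fst g $ 2 $ 1 / fst g $ 2 $ 2 * z)"
proof -
  let ?c = "fst g $ 2 $ 1" and ?d = "fst g $ 2 $ 2"
  have less: "norm ?c < norm ?d" and e: "exp (snd g) = ?d"
    using g SU11_less by (auto simp: SU11_cover_def)
  have d: "?d \<noteq> 0" using less by force
  have "norm (?c / ?d) \<le> 1"
    using less d by (simp add: norm_divide)
  then have "norm (?c / ?d * z) \<le> norm z"
    by (simp only: norm_mult mult_left_le_one_le norm_ge_zero)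
  then have "norm (?c / ?d * z) < 1" using z by simp
  then show re: "0 < Re (1 + ?c / ?d * z)"
    using abs_Re_le_cmod[of "?c / ?d * z"] by simp
  then have ne: "1 + ?c / ?d * z \<noteq> 0" by (metis less_irrefl zero_complex.sel(1))
  then show "exp (log_denom g z) = ?c * z + ?d"
    using d by (simp add: log_denom_def exp_add e field_simps)
  then show "?c * z + ?d \<noteq> 0" by (metis exp_not_eq_zero)
qed

theorem deriv_power_1:
  assumes g: "g \<in> SU11_cover" and z: "z \<in> unit_disc"
  shows "(moebius (fst g) has_field_derivative deriv_power g 1 z) (at z)"
proof -
  let ?A = "fst g"
  have det: "?A $ 1 $ 1 * ?A $ 2 $ 2 - ?A $ 1 $ 2 * ?A $ 2 $ 1 = 1"
    using g by (auto simp: SU11_cover_def SU11_def det_2)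
  have "deriv_power g 1 z = 1 / (exp (log_denom g z))\<^sup>2"
    by (simp add: deriv_power_def exp_minus exp_double inverse_eq_divide)
  also have "\<dots> = 1 / (?A $ 2 $ 1 * z + ?A $ 2 $ 2)\<^sup>2"
    by (simp add: exp_log_denom[OF g z])
  also have "\<dots> = (?A $ 1 $ 1 * (?A $ 2 $ 1 * z + ?A $ 2 $ 2)
      - (?A $ 1 $ 1 * z + ?A $ 1 $ 2) * ?A $ 2 $ 1)
        / ((?A $ 2 $ 1 * z + ?A $ 2 $ 2) * (?A $ 2 $ 1 * z + ?A $ 2 $ 2))"
    using det by (simp add: power2_eq_square algebra_simps)
  finally show ?thesis
    unfolding moebius_def[abs_def]
    using exp_log_denom(2)[OF g z]
    by (auto intro!: derivative_eq_intros)
qed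

theorem continuous_on_deriv_power:
  "continuous_on (SU11_cover \<times> unit_disc) (\<lambda>(g, z). deriv_power g s z)"
proof -
  have d: "fst (fst x) $ 2 $ 2 \<noteq> 0" if "x \<in> SU11_cover \<times> unit_disc" for x
    using that by (auto simp: SU11_cover_def dest!: SU11_less)
  have n: "1 + fst (fst x) $ 2 $ 1 / fst (fst x) $ 2 $ 2 * snd x \<notin> \<real>\<^sub>\<le>\<^sub>0"
    if "x \<in> SU11_cover \<times> unit_disc" for x
    using that exp_log_denom(3)[of "fst x" "snd x"] by (auto simp: complex_nonpos_Reals_iff)
  show ?thesis
    unfolding deriv_power_def log_denom_def case_prod_unfold
    by (intro continuous_intros) (use d n in auto)
qed

theorem deriv_power_principal:
  assumes "g \<in> SU11_cover" "z \<in> unit_disc" "\<bar>Im (log_denom g z)\<bar> < pi / 2"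
  shows "deriv_power g s z = deriv (moebius (fst g)) z powr of_real s"
proof -
  have "Ln (exp (- 2 * log_denom g z)) = - 2 * log_denom g z"
    using assms(3) by (intro Ln_exp) auto
  moreover have "deriv (moebius (fst g)) z = exp (- 2 * log_denom g z)"
    using deriv_power_1[OF assms(1,2)] by (simp add: DERIV_imp_deriv deriv_power_def)
  ultimately show ?thesis
    by (simp add: powr_def deriv_power_def mult_ac)
qed

text \<open>
  By these facts, \<^const>\<open>deriv_power\<close> is the continuous branch on \<open>SU11_cover \<times> unit_disc\<close> that is
  principal near the identity.
\<close>

definition cinner :: "complex^'n \<Rightarrow> complex^'n \<Rightarrow> complex" where
  "cinner x y = (\<Sum>i\<in>UNIV. x $ i * cnj (y $ i))"

definition ctranspose :: "complex^'n^'m \<Rightarrow> complex^'m^'n" where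
  "ctranspose A = (\<chi> i j. cnj (A $ j $ i))"

definition positive_definite :: "complex^'n^'n \<Rightarrow> bool" where
  "positive_definite A \<longleftrightarrow>
     ctranspose A = A \<and> (\<forall>x. x \<noteq> 0 \<longrightarrow> 0 < Re (cinner (A *v x) x))"

text \<open>
  A decomposition of \<open>\<complex>\<^sup>d\<close> (with \<open>d = CARD('n)\<close>) into blocks \<open>0, \<dots>, m\<close> is given by the function
  \<open>\<beta> :: 'n \<Rightarrow> nat\<close> that sends a coordinate to the number of its block: the block \<open>j\<close> has dimension
  \<open>d\<^sub>j = card {i. \<beta> i = j}\<close>, and all \<open>d\<^sub>j\<close> are positive iff \<open>range \<beta> = {0..m}\<close>.
  Matrices between blocks are extended by zero to matrices on all of \<open>\<complex>\<^sup>d\<close>.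
\<close>

definition subdiagonal :: "('n \<Rightarrow> nat) \<Rightarrow> complex^'n^'n \<Rightarrow> bool" where
  "subdiagonal \<beta> Y \<longleftrightarrow> (\<forall>i k. Y $ i $ k \<noteq> 0 \<longrightarrow> \<beta> i = \<beta> k + 1)"

definition Yblock :: "('n \<Rightarrow> nat) \<Rightarrow> complex^'n^'n \<Rightarrow> nat \<Rightarrow> complex^'n^'n" where
  "Yblock \<beta> Y j = (\<chi> i k. if \<beta> i = j \<and> \<beta> k + 1 = j then Y $ i $ k else 0)"

text \<open>
  \<open>Yprod \<beta> Y p l\<close> is \<open>Y\<^sub>p \<cdots> Y\<^sub>l\<^sub>+\<^sub>1\<close> for \<open>l \<le> p\<close>. The empty product is the identity on all of \<open>\<complex>\<^sup>d\<close>,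
  but below it is only used where it acts on the block \<open>l\<close>.
\<close>

fun Yprod :: "('n::finite \<Rightarrow> nat) \<Rightarrow> complex^'n^'n \<Rightarrow> nat \<Rightarrow> nat \<Rightarrow> complex^'n^'n" where
  "Yprod \<beta> Y 0 l = mat 1"
| "Yprod \<beta> Y (Suc p) l = (if l \<le> p then Yblock \<beta> Y (Suc p) ** Yprod \<beta> Y p l else mat 1)"

definition multiplier ::
    "('n::finite \<Rightarrow> nat) \<Rightarrow> real \<Rightarrow> complex^'n^'n \<Rightarrow> (complex^2^2) \<times> complex \<Rightarrow> complex
       \<Rightarrow> complex^'n^'n" where
  "multiplier \<beta> \<eta> Y g z =
     (\<chi> i k. let p = \<beta> i; l = \<beta> k in
        if l \<le> p then
          1 / fact (p - l) * (- (fst g $ 2 $ 1)) ^ (p - l)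
            * deriv_power g (\<eta> + (real p + real l) / 2) z * Yprod \<beta> Y p l $ i $ k
        else 0)"

text \<open>An invariant Hermitian structure \<open>h\<close> is determined by its value \<open>H\<close> at the origin.\<close>

definition invariant_hermitian ::
    "('n::finite \<Rightarrow> nat) \<Rightarrow> real \<Rightarrow> complex^'n^'n \<Rightarrow> complex^'n^'n
       \<Rightarrow> (complex \<Rightarrow> complex^'n^'n) \<Rightarrow> bool" where
  "invariant_hermitian \<beta> \<eta> Y H h \<longleftrightarrow>
     h 0 = H \<and>
     (\<forall>z\<in>unit_disc. positive_definite (h z)) \<and>
     (\<forall>g\<in>SU11_cover. \<forall>z\<in>unit_disc.
        h (moebius (fst g) z)
          = ctranspose (multiplier \<beta> \<eta> Y g z) ** h z ** multiplier \<beta> \<eta> Y g z)"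

text \<open>
  A function on the disc is represented by its extension by zero to the complex plane, so that equality
  of functions on the disc is equality.
\<close>

definition on_disc :: "(complex \<Rightarrow> complex^'n) \<Rightarrow> complex \<Rightarrow> complex^'n" where
  "on_disc f = (\<lambda>z. if z \<in> unit_disc then f z else 0)"

definition holomorphic_sections :: "(complex \<Rightarrow> complex^'n) set" where
  "holomorphic_sections =
     {f. (\<forall>i. (\<lambda>z. f z $ i) holomorphic_on unit_disc) \<and> on_disc f = f}"

definition ip_norm :: "('f \<Rightarrow> 'f \<Rightarrow> complex) \<Rightarrow> 'f \<Rightarrow> real" where
  "ip_norm ip f = sqrt (Re (ip f f))"

definition hilbert_space_of_sections ::
    "(complex \<Rightarrow> complex^'n) set
       \<Rightarrow> ((complex \<Rightarrow> complex^'n) \<Rightarrow> (complex \<Rightarrow> complex^'n) \<Rightarrow> complex) \<Rightarrow> bool" where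
  "hilbert_space_of_sections S ip \<longleftrightarrow>
     S \<subseteq> holomorphic_sections \<and>
     (\<lambda>z. 0) \<in> S \<and>
     (\<forall>f\<in>S. \<forall>g\<in>S. (\<lambda>z. f z + g z) \<in> S) \<and>
     (\<forall>a. \<forall>f\<in>S. (\<lambda>z. a *s f z) \<in> S) \<and>
     (\<forall>f\<in>S. \<forall>g\<in>S. \<forall>h\<in>S. ip (\<lambda>z. f z + g z) h = ip f h + ip g h) \<and>
     (\<forall>a. \<forall>f\<in>S. \<forall>g\<in>S. ip (\<lambda>z. a *s f z) g = a * ip f g) \<and>
     (\<forall>f\<in>S. \<forall>g\<in>S. ip g f = cnj (ip f g)) \<and>
     (\<forall>f\<in>S. f \<noteq> (\<lambda>z. 0) \<longrightarrow> 0 < Re (ip f f)) \<and>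
     Metric_space.mcomplete S (\<lambda>f g. ip_norm ip (\<lambda>z. f z - g z))"

definition evaluations_continuous ::
    "(complex \<Rightarrow> complex^'n) set
       \<Rightarrow> ((complex \<Rightarrow> complex^'n) \<Rightarrow> (complex \<Rightarrow> complex^'n) \<Rightarrow> complex) \<Rightarrow> bool" where
  "evaluations_continuous S ip \<longleftrightarrow>
     (\<forall>z\<in>unit_disc. \<exists>C. \<forall>f\<in>S. norm (f z) \<le> C * ip_norm ip f)"

definition evaluations_surjective :: "(complex \<Rightarrow> complex^'n) set \<Rightarrow> bool" where
  "evaluations_surjective S \<longleftrightarrow> (\<forall>z\<in>unit_disc. (\<lambda>f. f z) ` S = UNIV)"

definition reproducing_kernel ::
    "(complex \<Rightarrow> complex^'n) set
       \<Rightarrow> ((complex \<Rightarrow> complex^'n) \<Rightarrow> (complex \<Rightarrow> complex^'n) \<Rightarrow> complex)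
       \<Rightarrow> (complex \<Rightarrow> complex \<Rightarrow> complex^'n^'n) \<Rightarrow> bool" where
  "reproducing_kernel S ip K \<longleftrightarrow>
     (\<forall>w\<in>unit_disc. \<forall>\<xi>.
        on_disc (\<lambda>z. K z w *v \<xi>) \<in> S \<and>
        (\<forall>f\<in>S. ip f (on_disc (\<lambda>z. K z w *v \<xi>)) = cinner (f w) \<xi>))"

definition acts_isometrically ::
    "('n::finite \<Rightarrow> nat) \<Rightarrow> real \<Rightarrow> complex^'n^'n \<Rightarrow> (complex \<Rightarrow> complex^'n) set
       \<Rightarrow> ((complex \<Rightarrow> complex^'n) \<Rightarrow> (complex \<Rightarrow> complex^'n) \<Rightarrow> complex) \<Rightarrow> bool" where
  "acts_isometrically \<beta> \<eta> Y S ip \<longleftrightarrow>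
     (\<forall>g\<in>SU11_cover. \<forall>f\<in>S.
        let Uf = on_disc (\<lambda>z. multiplier \<beta> \<eta> Y g z *v f (moebius (fst g) z))
        in Uf \<in> S \<and> ip_norm ip Uf = ip_norm ip f)"

definition comes_from_kernel_of ::
    "('n::finite \<Rightarrow> nat) \<Rightarrow> real \<Rightarrow> complex^'n^'n \<Rightarrow> complex^'n^'n
       \<Rightarrow> (complex \<Rightarrow> complex^'n) set \<Rightarrow> bool" where
  "comes_from_kernel_of \<beta> \<eta> Y H S \<longleftrightarrow>
     (\<exists>h ip K.
        invariant_hermitian \<beta> \<eta> Y H h \<and>
        hilbert_space_of_sections S ip \<and>
        evaluations_continuous S ip \<and>
        evaluations_surjective S \<and>
        acts_isometrically \<beta> \<eta> Y S ip \<and>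
        reproducing_kernel S ip K \<and>
        (\<forall>z\<in>unit_disc. h z = matrix_inv (K z z)))"

text \<open>
  The Hilbert spaces attached to operators in the Cowen-Douglas class are invariant under
  multiplication by the coordinate function. Without this requirement the Hermitian structure can
  come from a kernel at the boundary of the positivity conditions: for \<open>\<eta> = 0\<close> and
  \<open>Y = 0\<close> with a single block, take the constant functions; for \<open>\<eta> > 0\<close>,
  two blocks of dimension \<open>1\<close> and \<open>Y\<^sub>1 = y\<close> with \<open>y\<^sup>2 = 2 \<eta>\<close>, take
  the pairs \<open>(f, f' / y)\<close> with \<open>f\<close> in the Hilbert space of scalar functions with kernel
  \<open>(1 - z cnj w) powr (- 2 \<eta>)\<close>.
\<close>

definition shift_invariant :: "(complex \<Rightarrow> complex^'n) set \<Rightarrow> bool" where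
  "shift_invariant S \<longleftrightarrow> (\<forall>f\<in>S. (\<lambda>z. z *s f z) \<in> S)"

text \<open>
  For \<open>1 \<le> j \<le> m\<close> this is the positive definiteness of
  \<open>I + Y\<^sub>j (\<Sum>k<j. \<dots>) Y\<^sub>j\<^sup>*\<close> on the block \<open>j\<close>: the matrix below is block diagonal and equals the
  identity on the other blocks.
\<close>

definition block_condition :: "('n::finite \<Rightarrow> nat) \<Rightarrow> real \<Rightarrow> complex^'n^'n \<Rightarrow> nat \<Rightarrow> bool" where
  "block_condition \<beta> \<eta> Y j \<longleftrightarrow>
     positive_definite
       (mat 1 + Yblock \<beta> Y j
          ** (\<Sum>k<j. ((-1) ^ (j + k)
                        / (fact (j - k) * pochhammer (2 * \<eta> + real j + real k - 1) (j - k)))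
                *\<^sub>R (Yprod \<beta> Y (j - 1) k ** ctranspose (Yprod \<beta> Y (j - 1) k)))
          ** ctranspose (Yblock \<beta> Y j))"

end

theory Submission
  imports Defs "HOL-Complex_Analysis.Cauchy_Integral_Formula"
begin

text \<open>
  Let \<open>B\<close> be the diagonal matrix with the number of the block on the diagonal. As \<open>Y\<close> raises this number by
  one, \<open>J\<^sub>g(z) = (c z + d)\<^bsup>- (\<eta> + B)\<^esup> exp (- c Y) (c z + d)\<^bsup>- (\<eta> + B)\<^esup>\<close>, and the commutation rules between powers
  of scalars with exponent \<open>B\<close> and the exponentials of \<open>Y\<close> and \<open>Y\<^sup>*\<close> show that, for all real \<open>\<eta>\<close>,
  \<open>K(z, w) = (1 - z cnj w)\<^bsup>- (\<eta> + B)\<^esup> exp (cnj w Y) exp (z Y\<^sup>*) (1 - z cnj w)\<^bsup>- (\<eta> + B)\<^esup>\<close>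
  is invariant (\<open>kern_invariant\<close>). It is the only invariant kernel which is holomorphic in \<open>z\<close>, Hermitian and
  normalized at \<open>0\<close> (\<open>kern_unique\<close>). The question is thus when \<open>K\<close> is the kernel of a Hilbert space of the
  required kind.

  Group the Taylor coefficients of \<open>K\<close> by their weight under rotations, in matrices \<open>A\<^sub>k\<close> that act on the blocks
  \<open>0, \<dots>, k\<close> (\<open>coeff_mat\<close>). For \<open>\<eta> > 0\<close> there is a congruence by an explicit triangular matrix that takes \<open>A\<^sub>k\<close> to a
  block diagonal matrix; its block \<open>j\<close> is a positive number times the matrix \<open>N\<^sub>j\<close> whose positivity is the condition
  (\<open>coeff_mat_congruence\<close>). This rests on two evaluations of alternating binomial sums. Hence, for \<open>\<eta> > 0\<close>, all
  \<open>A\<^sub>k\<close> are positive definite if and only if all \<open>N\<^sub>j\<close> are.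

  For necessity, suppose that \<open>K\<close> is the kernel of a space as required. Averaging evaluations over roots of unity
  shows that \<open>\<langle>A\<^sub>k y, y\<rangle>\<close> bounds the squared norm of the functional which pairs the Taylor coefficients of weight
  \<open>k\<close> of a section with \<open>y\<close> (\<open>kernel_bounded_taylor\<close>). If it were zero for some \<open>y \<noteq> 0\<close>, all members of the space
  would satisfy a linear relation between their Taylor coefficients. Multiplying sections by powers of \<open>z\<close> reduces such a relation to one between the values at \<open>0\<close>,
  and these are arbitrary (\<open>kernel_positive\<close>). So all \<open>A\<^sub>k\<close> are positive definite; \<open>A\<^sub>1\<close> yields \<open>\<eta> > 0\<close>, and
  \<open>A\<^sub>j\<close> yields \<open>N\<^sub>j > 0\<close>.

  For sufficiency, suppose that all \<open>A\<^sub>k\<close> are positive definite. The holomorphic sections whose Taylor coefficients \<open>x\<^sub>k\<close> satisfy \<open>\<Sum>k. \<langle>A\<^sub>k\<^sup>-\<^sup>1 x\<^sub>k, x\<^sub>k\<rangle> < \<infinity>\<close> form a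
  Hilbert space with kernel \<open>K\<close>. Members \<open>f\<close> of norm at most \<open>\<surd>C\<close> are recognized by the inequalities
  \<open>\<bar>\<Sum>a. \<langle>f(w\<^sub>a), \<xi>\<^sub>a\<rangle>\<bar>\<^sup>2 \<le> C \<Sum>a b. \<langle>K(w\<^sub>b, w\<^sub>a) \<xi>\<^sub>a, \<xi>\<^sub>b\<rangle>\<close>, which the invariance of \<open>K\<close> carries over to translates of
  \<open>f\<close>; therefore the group acts isometrically (\<open>act_contraction\<close>). Multiplication by \<open>z\<close> preserves the space
  because \<open>A\<^sub>k \<le> C A\<^sub>k\<^sub>+\<^sub>1\<close> (\<open>coeff_mat_dominated\<close>): the condition is open in \<open>\<eta>\<close>, and the kernel for \<open>\<eta>\<close> is the one for \<open>\<eta> - \<epsilon>\<close>,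
  which is still positive, times \<open>(1 - z cnj w)\<^bsup>- 2 \<epsilon>\<^esup>\<close>.
\<close>

section \<open>Alternating binomial sums\<close>

definition alternating_sum :: "nat \<Rightarrow> (nat \<Rightarrow> real) \<Rightarrow> real" where
  "alternating_sum n f = (\<Sum>t\<le>n. (-1) ^ t * real (n choose t) * f t)"

lemma alternating_sum_Suc:
  "alternating_sum (Suc n) f = alternating_sum n (\<lambda>t. f t - f (Suc t))"
proof -
  let ?g = "\<lambda>t. (-1) ^ t * real (n choose t) * f t"
  have "alternating_sum (Suc n) f
      = f 0 + (\<Sum>t\<le>n. (-1) ^ Suc t * real (Suc n choose Suc t) * f (Suc t))"
    unfolding alternating_sum_def by (subst sum.atMost_Suc_shift) simp
  also have "\<dots> = (f 0 + (\<Sum>t\<le>n. ?g (Suc t))) - (\<Sum>t\<le>n. (-1) ^ t * real (n choose t) * f (Suc t))"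
    by (simp add: algebra_simps sum.distrib sum_subtractf sum_negf)
  also have "f 0 + (\<Sum>t\<le>n. ?g (Suc t)) = (\<Sum>t\<le>Suc n. ?g t)"
    by (simp add: sum.atMost_Suc_shift del: sum.atMost_Suc)
  also have "\<dots> = (\<Sum>t\<le>n. ?g t)" by simp
  finally show ?thesis
    by (simp add: alternating_sum_def sum_subtractf algebra_simps)
qed

text \<open>
  Each step of the recursion \<open>alternating_sum_Suc\<close> takes a difference, which lowers the degree.
\<close>

lemma alternating_sum_poly_eq_0:
  "degree p < n \<Longrightarrow> alternating_sum n (\<lambda>t. poly p (real t)) = 0"
proof (induction n arbitrary: p)
  case (Suc n)
  define q where "q = p - pcompose p [:1, 1:]"
  have q: "poly q (real t) = poly p (real t) - poly p (real (Suc t))" for t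
    by (simp add: q_def poly_pcompose add.commute)
  show ?case
  proof (cases "degree p = 0")
    case True
    then obtain c where "p = [:c:]" by (rule degree_eq_zeroE)
    then show ?thesis
      by (simp add: alternating_sum_Suc) (simp add: alternating_sum_def)
  next
    case False
    have deg: "degree (pcompose p [:1, 1:]) = degree p" by (simp add: degree_pcompose)
    have "lead_coeff (pcompose p [:1, 1:]) = lead_coeff p"
      by (subst lead_coeff_comp) auto
    then have c: "coeff q (degree p) = 0" unfolding q_def using deg by simp
    have "degree q \<le> degree p" unfolding q_def by (rule degree_diff_le) (auto simp: deg)
    then have "degree q < degree p"
      using c False by (metis degree_0 leading_coeff_0_iff le_less gr0I)
    then have "alternating_sum n (\<lambda>t. poly q (real t)) = 0"
      using Suc by (intro Suc.IH) simp
    then show ?thesis by (simp add: alternating_sum_Suc q)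
  qed
qed simp

text \<open>
  The partial fraction expansion of \<open>n! / (x (x + 1) \<cdots> (x + n))\<close>.
\<close>

lemma alternating_sum_inverse:
  "x > 0 \<Longrightarrow> alternating_sum n (\<lambda>t. 1 / (x + real t)) = fact n / pochhammer x (Suc n)"
proof (induction n arbitrary: x)
  case 0
  then show ?case by (simp add: alternating_sum_def)
next
  case (Suc n)
  have "alternating_sum (Suc n) (\<lambda>t. 1 / (x + real t))
      = alternating_sum n (\<lambda>t. 1 / (x + real t)) - alternating_sum n (\<lambda>t. 1 / (x + 1 + real t))"
    by (simp add: alternating_sum_Suc) (simp add: alternating_sum_def sum_subtractf algebra_simps)
  also have "\<dots> = fact n / pochhammer x (Suc n) - fact n / pochhammer (x + 1) (Suc n)"
    using Suc by simp
  also have "\<dots> = fact (Suc n) / pochhammer x (Suc (Suc n))"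
  proof -
    let ?P = "pochhammer (x + 1) n"
    have P: "?P > 0" using Suc.prems by (intro pochhammer_pos) simp
    have 1: "pochhammer x (Suc n) = x * ?P" by (simp add: pochhammer_rec)
    have 2: "pochhammer (x + 1) (Suc n) = ?P * (x + 1 + real n)" by (simp add: pochhammer_Suc)
    have 3: "pochhammer x (Suc (Suc n)) = x * ?P * (x + 1 + real n)"
      by (simp only: pochhammer_rec[of x "Suc n"] 2 mult.assoc)
    have "x \<noteq> 0" "x + 1 + real n \<noteq> 0" using Suc.prems by auto
    then show ?thesis unfolding 1 2 3 using P by (simp add: divide_simps) (simp add: algebra_simps)
  qed
  finally show ?case .
qed

text \<open>
  Dividing \<open>p\<close> by \<open>x + t\<close> leaves the remainder \<open>p (- x)\<close>, and a quotient of degree below \<open>n\<close>, whose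
  alternating sum vanishes.
\<close>

lemma alternating_sum_poly_div:
  assumes "degree p \<le> n" "x > 0"
  shows "alternating_sum n (\<lambda>t. poly p (real t) / (x + real t))
       = poly p (- x) * fact n / pochhammer x (Suc n)"
proof -
  define q where "q = synthetic_div p (- x)"
  have p: "poly p y = (x + y) * poly q y + poly p (- x)" for y
    using arg_cong[OF synthetic_div_correct'[of "- x" p], of "\<lambda>p. poly p y"]
    by (simp add: q_def algebra_simps)
  have "x + real t \<noteq> 0" for t using assms(2) by linarith
  then have *: "poly p (real t) / (x + real t) = poly q (real t) + poly p (- x) * (1 / (x + real t))"
    for t by (subst p) (simp add: add_divide_distrib)
  have "alternating_sum n (\<lambda>t. poly q (real t)) = 0"
  proof (cases "degree p = 0")
    case True
    then have "q = 0" unfolding q_def by (auto elim: degree_eq_zeroE)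
    then show ?thesis by (simp add: alternating_sum_def)
  next
    case False
    then show ?thesis
      using assms(1) by (intro alternating_sum_poly_eq_0) (simp add: q_def degree_synthetic_div)
  qed
  moreover have "alternating_sum n (\<lambda>t. poly p (real t) / (x + real t)) =
     alternating_sum n (\<lambda>t. poly q (real t)) + poly p (- x) * alternating_sum n (\<lambda>t. 1 / (x + real t))"
    unfolding * by (simp add: alternating_sum_def algebra_simps sum.distrib sum_distrib_left)
  ultimately show ?thesis using assms(2) by (simp add: alternating_sum_inverse)
qed

text \<open>
  The coefficient of \<open>z\<^bsup>k - p\<^esup> (cnj w)\<^bsup>k - q\<^esup>\<close> in
  \<open>(1 - z cnj w)\<^bsup>- (2\<eta> + p + q)\<^esup> (cnj w)\<^bsup>p - i\<^esup> z\<^bsup>q - i\<^esup> / ((p - i)! (q - i)!)\<close>. This function is what block \<open>i\<close>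
  contributes to the block \<open>(p, q)\<close> of the invariant kernel.
\<close>

definition kernel_coeff :: "real \<Rightarrow> nat \<Rightarrow> nat \<Rightarrow> nat \<Rightarrow> nat \<Rightarrow> real" where
  "kernel_coeff \<eta> k p q i =
     (if p + q \<le> k + i
      then pochhammer (2 * \<eta> + real p + real q) (k + i - p - q)
             / (fact (k + i - p - q) * fact (p - i) * fact (q - i)) else 0)"

text \<open>
  Besides being the coefficients of the positivity condition, these are the coefficients \<open>c\<^sub>j\<^sub>p\<close> for which
  the differential expression \<open>\<Sum>\<^sub>p c\<^sub>j\<^sub>p Y\<^sub>j \<cdots> Y\<^sub>p\<^sub>+\<^sub>1 f\<^sub>p\<^bsup>(j - p)\<^esup>\<close> in a section \<open>f\<close> transforms by the scalar
  factor \<open>g'(z)\<^bsup>\<eta> + j\<^esup>\<close>.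
\<close>

definition inversion_coeff :: "real \<Rightarrow> nat \<Rightarrow> nat \<Rightarrow> real" where
  "inversion_coeff \<eta> j k =
     (-1) ^ (j + k) / (fact (j - k) * pochhammer (2 * \<eta> + real j + real k - 1) (j - k))"

lemma pochhammer_Gamma_pos:
  "(z::real) > 0 \<Longrightarrow> pochhammer z n = Gamma (z + real n) / Gamma z"
  by (rule pochhammer_Gamma) (auto elim!: nonpos_Ints_cases)

text \<open>
  As a polynomial in \<open>t\<close>, the falling factorial of length \<open>n\<close> that starts at \<open>M - t\<close>. In the sums below it
  stands for a quotient of factorials, and its zeros are the places where \<^const>\<open>kernel_coeff\<close> is zero by
  definition.
\<close>

definition falling_poly :: "nat \<Rightarrow> nat \<Rightarrow> real poly" where
  "falling_poly M n = (\<Prod>l<n. [:real M - real l, -1:])"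

lemma degree_falling_poly: "degree (falling_poly M n) \<le> n"
proof -
  have "degree (falling_poly M n) \<le> (\<Sum>l<n. degree [:real M - real l, -1:])"
    unfolding falling_poly_def using degree_prod_sum_le by (metis finite_lessThan o_def sum.cong)
  then show ?thesis by simp
qed

lemma poly_falling_poly:
  assumes "t \<le> M"
  shows "poly (falling_poly M n) (real t)
       = (if n + t \<le> M then fact (M - t) / fact (M - t - n) else 0)"
proof -
  have "poly (falling_poly M n) (real t) = (\<Prod>l<n. real (M - t) - real l)"
    using assms by (simp add: falling_poly_def poly_prod of_nat_diff algebra_simps)
  also have "\<dots> = (if n + t \<le> M then fact (M - t) / fact (M - t - n) else 0)"
  proof (cases "n + t \<le> M")
    case True
    then have "n \<le> M - t" by simp
    have "(\<Prod>l<n. real (M - t) - real l) * fact (M - t - n) = fact (M - t)"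
      using \<open>n \<le> M - t\<close>
    proof (induction n)
      case (Suc n)
      have "fact (M - t - n) = (real (M - t) - real n) * fact (M - t - Suc n)"
        using Suc.prems by (simp add: fact_reduce of_nat_diff)
      then show ?case using Suc by (simp add: mult.assoc)
    qed simp
    then show ?thesis using True by (simp add: field_simps)
  next
    case False
    then have "M - t < n" using assms by simp
    then have "(\<Prod>l<n. real (M - t) - real l) = 0" by (intro prod_zero) auto
    then show ?thesis using False by simp
  qed
  finally show ?thesis .
qed

lemma poly_falling_poly_uminus:
  "poly (falling_poly M n) (- x) = (\<Prod>l<n. real M + x - real l)"
  by (simp add: falling_poly_def poly_prod algebra_simps)

text \<open>
  The quotient of two Gamma values on the right decides what happens next: for \<open>p < j\<close> it is a polynomial
  in \<open>t\<close> of degree \<open>j - 1 - p\<close>, and for \<open>p = j\<close> it has a single pole.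
\<close>

lemma kernel_coeff_inversion_coeff:
  assumes \<eta>: "\<eta> > 0" and i: "i \<le> p" "p \<le> j" "j \<le> k" "i < j" and t: "t \<le> j - i"
  defines "q \<equiv> i + t"
  shows "fact (k - q) * inversion_coeff \<eta> j q * kernel_coeff \<eta> k p q i =
      ((-1) ^ (j - i) * Gamma (2 * \<eta> + real k + real i) / (Gamma (2 * \<eta> + 2 * real j - 1) * fact (p - i) * fact (j - i)))
      * ((-1) ^ t * real ((j - i) choose t) * (poly (falling_poly (k - i) (p - i)) (real t)
         * (Gamma (2 * \<eta> + real j + real q - 1) / Gamma (2 * \<eta> + real p + real q))))"
proof -
  have q: "q \<le> j" "i \<le> q" "q \<le> k" using assms by auto
  have F: "poly (falling_poly (k - i) (p - i)) (real t)
     = (if p + q \<le> k + i then fact (k - q) / fact (k + i - p - q) else 0)"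
  proof -
    have "k - i - t = k - q" "p - i + t \<le> k - i \<longleftrightarrow> p + q \<le> k + i"
      "k - i - t - (p - i) = k + i - p - q" "t \<le> k - i"
      using i t by (auto simp: q_def)
    then show ?thesis by (simp only: poly_falling_poly)
  qed
  have sgn: "(-1::real) ^ (j + q) = (-1) ^ (j - i) * (-1) ^ t"
  proof -
    have "j + q = (j - i) + t + 2 * i" using i t by (simp add: q_def)
    then show ?thesis by (simp add: power_add)
  qed
  have ch: "real ((j - i) choose t) = fact (j - i) / (fact (q - i) * fact (j - q))"
    using binomial_fact[of t "j - i", where ?'a = real] t i by (simp add: q_def)
  have G1: "pochhammer (2 * \<eta> + real j + real q - 1) (j - q)
      = Gamma (2 * \<eta> + 2 * real j - 1) / Gamma (2 * \<eta> + real j + real q - 1)"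
    using \<eta> i q by (subst pochhammer_Gamma_pos) (auto simp: of_nat_diff algebra_simps)
  have pos: "Gamma (2 * \<eta> + 2 * real j - 1) > 0" "Gamma (2 * \<eta> + real j + real q - 1) > 0"
    "Gamma (2 * \<eta> + real p + real q) > 0"
    using \<eta> i q by (auto intro!: Gamma_real_pos)
  show ?thesis
  proof (cases "p + q \<le> k + i")
    case True
    have G2: "pochhammer (2 * \<eta> + real p + real q) (k + i - p - q)
        = Gamma (2 * \<eta> + real k + real i) / Gamma (2 * \<eta> + real p + real q)"
      using \<eta> i q True by (subst pochhammer_Gamma_pos) (auto simp: of_nat_diff algebra_simps)
    have K: "kernel_coeff \<eta> k p q i = Gamma (2 * \<eta> + real k + real i) / Gamma (2 * \<eta> + real p + real q)
        / (fact (k + i - p - q) * fact (p - i) * fact (q - i))"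
      using True by (simp only: kernel_coeff_def G2 if_True)
    show ?thesis
      unfolding inversion_coeff_def K F sgn ch G1
      using True pos by (simp add: divide_simps)
  next
    case False
    then show ?thesis by (simp add: kernel_coeff_def F)
  qed
qed

lemma sum_shift_atLeastAtMost:
  fixes f :: "nat \<Rightarrow> real"
  assumes "i \<le> j"
  shows "(\<Sum>q=i..j. f q) = (\<Sum>t\<le>j - i. f (i + t))"
  using assms sum.shift_bounds_cl_nat_ivl[of f 0 i "j - i"]
  by (simp add: atLeast0AtMost add.commute)

text \<open>
  The polynomial under the alternating sum has degree \<open>(p - i) + (j - 1 - p) < j - i\<close>.
\<close>

lemma sum_inversion_kernel_eq_0:
  assumes \<eta>: "\<eta> > 0" and i: "i \<le> p" "p < j" "j \<le> k"
  shows "(\<Sum>q=i..j. fact (k - q) * inversion_coeff \<eta> j q * kernel_coeff \<eta> k p q i) = 0"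
proof -
  define f where "f = (\<Prod>l<j - 1 - p. [:2 * \<eta> + real p + real i + real l, 1:])"
  define C where "C = (-1) ^ (j - i) * Gamma (2 * \<eta> + real k + real i)
      / (Gamma (2 * \<eta> + 2 * real j - 1) * fact (p - i) * fact (j - i))"
  let ?F = "falling_poly (k - i) (p - i)"
  have G: "Gamma (2 * \<eta> + real j + real (i + t) - 1) / Gamma (2 * \<eta> + real p + real (i + t)) = poly f (real t)" for t
  proof -
    have "poly f (real t) = pochhammer (2 * \<eta> + real p + real (i + t)) (j - 1 - p)"
      by (simp add: f_def poly_prod pochhammer_prod atLeast0LessThan algebra_simps)
    then show ?thesis
      using \<eta> i by (subst (asm) pochhammer_Gamma_pos) (auto simp: of_nat_diff algebra_simps)
  qed
  have "degree f \<le> (\<Sum>l<j - 1 - p. degree [:2 * \<eta> + real p + real i + real l, 1:])"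
    unfolding f_def using degree_prod_sum_le by (metis finite_lessThan o_def sum.cong)
  then have "degree f \<le> j - 1 - p" by simp
  then have "degree (?F * f) < j - i"
    using degree_mult_le[of ?F f] degree_falling_poly[of "k - i" "p - i"] i by linarith
  then have 0: "alternating_sum (j - i) (\<lambda>t. poly (?F * f) (real t)) = 0"
    by (rule alternating_sum_poly_eq_0)
  have "(\<Sum>q=i..j. fact (k - q) * inversion_coeff \<eta> j q * kernel_coeff \<eta> k p q i)
     = (\<Sum>t\<le>j - i. C * ((-1) ^ t * real ((j - i) choose t) * poly (?F * f) (real t)))"
    using i by (subst sum_shift_atLeastAtMost)
      (auto intro!: sum.cong simp: kernel_coeff_inversion_coeff[OF \<eta>] G[unfolded of_nat_add] C_def)
  also have "\<dots> = C * alternating_sum (j - i) (\<lambda>t. poly (?F * f) (real t))"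
    by (simp add: alternating_sum_def sum_distrib_left)
  finally show ?thesis using 0 by simp
qed

text \<open>
  Here a polynomial of degree \<open>j - i\<close> in \<open>t\<close> is divided by \<open>x + t\<close>, and up to a factor the sum is the value of
  this polynomial at the pole \<open>- x\<close>.
\<close>

lemma sum_inversion_kernel_diagonal:
  assumes \<eta>: "\<eta> > 0" and i: "i \<le> j" "j \<le> k"
  shows "(\<Sum>q=i..j. fact (k - q) * inversion_coeff \<eta> j q * kernel_coeff \<eta> k j q i)
       = pochhammer (2 * \<eta> + 2 * real j) (k - j) * inversion_coeff \<eta> j i"
proof (cases "i = j")
  case True
  then show ?thesis using i by (simp add: inversion_coeff_def kernel_coeff_def algebra_simps)
next
  case False
  then have ij: "i < j" using i by simp
  define J where "J = j - i"
  define x where "x = 2 * \<eta> + real j + real i - 1"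
  have x: "x > 0" using \<eta> ij by (simp add: x_def)
  define C where "C = (-1) ^ J * Gamma (2 * \<eta> + real k + real i)
      / (Gamma (2 * \<eta> + 2 * real j - 1) * fact J * fact J)"
  let ?F = "falling_poly (k - i) J"
  have G: "Gamma (2 * \<eta> + real j + real (i + t) - 1) / Gamma (2 * \<eta> + real j + real (i + t)) = 1 / (x + real t)" for t
  proof -
    have "x + real t > 0" using x by simp
    then have "Gamma (x + real t + 1) = (x + real t) * Gamma (x + real t)"
      by (intro Gamma_plus1) (auto elim!: nonpos_Ints_cases)
    moreover have "Gamma (x + real t) > 0" using \<open>x + real t > 0\<close> by (rule Gamma_real_pos)
    ultimately have "Gamma (x + real t) / Gamma (x + real t + 1) = 1 / (x + real t)" by simp
    moreover have "2 * \<eta> + real j + real (i + t) - 1 = x + real t"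
      "2 * \<eta> + real j + real (i + t) = x + real t + 1" by (simp_all add: x_def)
    ultimately show ?thesis by (simp only:)
  qed
  have "(\<Sum>q=i..j. fact (k - q) * inversion_coeff \<eta> j q * kernel_coeff \<eta> k j q i)
     = (\<Sum>t\<le>J. C * ((-1) ^ t * real (J choose t) * (poly ?F (real t) / (x + real t))))"
    using i ij by (subst sum_shift_atLeastAtMost)
      (auto intro!: sum.cong simp: kernel_coeff_inversion_coeff[OF \<eta>] G[unfolded of_nat_add] C_def J_def)
  also have "\<dots> = C * alternating_sum J (\<lambda>t. poly ?F (real t) / (x + real t))"
    by (simp add: alternating_sum_def sum_distrib_left)
  also have "\<dots> = C * (poly ?F (- x) * fact J / pochhammer x (Suc J))"
    by (simp add: alternating_sum_poly_div[OF degree_falling_poly x])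
  also have "poly ?F (- x) = pochhammer (2 * \<eta> + real k + real i) J"
  proof -
    have "poly ?F (- x) = (\<Prod>l<J. 2 * \<eta> + real k + real i + real (J - Suc l))"
      unfolding poly_falling_poly_uminus using i
      by (intro prod.cong) (auto simp: x_def J_def of_nat_diff)
    also have "\<dots> = pochhammer (2 * \<eta> + real k + real i) J"
      unfolding pochhammer_prod atLeast0LessThan by (rule prod.nat_diff_reindex)
    finally show ?thesis .
  qed
  also have "\<dots> = Gamma (2 * \<eta> + real k + real j) / Gamma (2 * \<eta> + real k + real i)"
    using \<eta> i by (subst pochhammer_Gamma_pos) (auto simp: J_def of_nat_diff algebra_simps)
  also have "pochhammer x (Suc J) = pochhammer x J * (2 * \<eta> + 2 * real j - 1)"
    using i by (simp add: pochhammer_Suc x_def J_def of_nat_diff algebra_simps)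
  finally have main: "(\<Sum>q=i..j. fact (k - q) * inversion_coeff \<eta> j q * kernel_coeff \<eta> k j q i)
     = C * (Gamma (2 * \<eta> + real k + real j) / Gamma (2 * \<eta> + real k + real i) * fact J
         / (pochhammer x J * (2 * \<eta> + 2 * real j - 1)))" .
  have "Gamma (2 * \<eta> + 2 * real j - 1 + 1) = (2 * \<eta> + 2 * real j - 1) * Gamma (2 * \<eta> + 2 * real j - 1)"
    using \<eta> ij by (intro Gamma_plus1) (auto elim!: nonpos_Ints_cases)
  then have G3: "Gamma (2 * \<eta> + 2 * real j) = (2 * \<eta> + 2 * real j - 1) * Gamma (2 * \<eta> + 2 * real j - 1)"
    by simp
  have P: "pochhammer (2 * \<eta> + 2 * real j) (k - j) = Gamma (2 * \<eta> + real k + real j) / Gamma (2 * \<eta> + 2 * real j)"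
    using \<eta> i by (subst pochhammer_Gamma_pos) (auto simp: of_nat_diff algebra_simps)
  have "(-1::real) ^ (j + i) = (-1) ^ J"
  proof -
    have "j + i = J + 2 * i" using i by (simp add: J_def)
    then show ?thesis by (simp add: power_add)
  qed
  then have I: "inversion_coeff \<eta> j i = (-1) ^ J / (fact J * pochhammer x J)"
    by (simp add: inversion_coeff_def x_def J_def)
  have cancel: "s * a / (g * f * f) * (b / a * f / (r * y)) = b / (y * g) * (s / (f * r))"
    if "a > 0" "f > 0" for a b f g r s y :: real
    using that by (simp add: divide_simps)
  have "Gamma (2 * \<eta> + real k + real i) > 0" using \<eta> by (intro Gamma_real_pos) simp
  then show ?thesis unfolding main P I G3 C_def by (rule cancel) simp
qed

section \<open>Matrices graded by blocks\<close>

lemma ctranspose_nth [simp]: "ctranspose A $ i $ j = cnj (A $ j $ i)"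
  by (simp add: ctranspose_def)

lemma ctranspose_ctranspose [simp]: "ctranspose (ctranspose A) = A"
  by (simp add: vec_eq_iff)

lemma ctranspose_mat_1 [simp]: "ctranspose (mat 1) = mat 1"
  by (auto simp: vec_eq_iff mat_def)

lemma ctranspose_matrix_mul: "ctranspose (A ** B) = ctranspose B ** ctranspose A"
  by (simp add: vec_eq_iff matrix_matrix_mult_def mult.commute)

primrec matrix_power :: "complex^'n^'n \<Rightarrow> nat \<Rightarrow> complex^'n^'n" where
  "matrix_power A 0 = mat 1"
| "matrix_power A (Suc n) = A ** matrix_power A n"

lemma matrix_power_add: "matrix_power A (a + b) = matrix_power A a ** matrix_power A b"
  by (induction a) (auto simp: matrix_mul_assoc)

locale graded_matrix =
  fixes \<beta> :: "'n::finite \<Rightarrow> nat" and Y :: "complex^'n^'n"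
  assumes subdiag: "subdiagonal \<beta> Y"
begin

lemma matrix_power_graded: "matrix_power Y n $ i $ k \<noteq> 0 \<Longrightarrow> \<beta> i = \<beta> k + n"
proof (induction n arbitrary: i)
  case (Suc n)
  then have "(\<Sum>h\<in>UNIV. Y $ i $ h * matrix_power Y n $ h $ k) \<noteq> 0"
    by (simp add: matrix_matrix_mult_def)
  then obtain h where "Y $ i $ h * matrix_power Y n $ h $ k \<noteq> 0"
    by (meson sum.not_neutral_contains_not_neutral)
  then show ?case using Suc.IH[of h] subdiag by (auto simp: subdiagonal_def)
qed (auto simp: mat_def split: if_splits)

text \<open>
  An entry of the power of \<open>Y\<close> that leads from the block of \<open>h\<close> to the block of \<open>i\<close>. It is the sum, over all
  paths from \<open>h\<close> to \<open>i\<close> with one coordinate in each intermediate block, of the products of entries of \<open>Y\<close>.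
\<close>

definition path_coeff :: "'n \<Rightarrow> 'n \<Rightarrow> complex" where
  "path_coeff i h = (if \<beta> h \<le> \<beta> i then matrix_power Y (\<beta> i - \<beta> h) $ i $ h else 0)"

lemma path_coeff_eq_0: "\<beta> i < \<beta> h \<Longrightarrow> path_coeff i h = 0"
  by (simp add: path_coeff_def)

lemma path_coeff_same_block: "\<beta> i = \<beta> h \<Longrightarrow> path_coeff i h = (if i = h then 1 else 0)"
  by (simp add: path_coeff_def mat_def)

text \<open>
  Each path meets block \<open>b\<close> exactly once.
\<close>

lemma sum_path_coeff_block:
  assumes "\<beta> l \<le> b" "b \<le> \<beta> i"
  shows "(\<Sum>h\<in>{h. \<beta> h = b}. path_coeff i h * path_coeff h l) = path_coeff i l"
proof -
  have "(\<Sum>h\<in>{h. \<beta> h = b}. path_coeff i h * path_coeff h l)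
      = (\<Sum>h\<in>{h. \<beta> h = b}. matrix_power Y (\<beta> i - b) $ i $ h * matrix_power Y (b - \<beta> l) $ h $ l)"
    using assms by (intro sum.cong) (auto simp: path_coeff_def)
  also have "\<dots> = (\<Sum>h\<in>UNIV. matrix_power Y (\<beta> i - b) $ i $ h * matrix_power Y (b - \<beta> l) $ h $ l)"
  proof (intro sum.mono_neutral_left ballI)
    fix h assume "h \<in> UNIV - {h. \<beta> h = b}"
    then have "matrix_power Y (b - \<beta> l) $ h $ l = 0" using matrix_power_graded[of "b - \<beta> l" h l] assms by auto
    then show "matrix_power Y (\<beta> i - b) $ i $ h * matrix_power Y (b - \<beta> l) $ h $ l = 0" by simp
  qed auto
  also have "\<dots> = matrix_power Y ((\<beta> i - b) + (b - \<beta> l)) $ i $ l"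
    by (subst matrix_power_add) (simp add: matrix_matrix_mult_def)
  finally show ?thesis using assms by (simp add: path_coeff_def)
qed

text \<open>
  Consequently, matrices whose entries are a scalar depending on the two blocks times \<^const>\<open>path_coeff\<close>
  multiply like the arrays of these scalars.
\<close>

lemma sum_path_coeff:
  "(\<Sum>h\<in>UNIV. f (\<beta> h) * (path_coeff i h * path_coeff h l)) = (\<Sum>b\<in>{\<beta> l..\<beta> i}. f b) * path_coeff i l"
proof -
  have "(\<Sum>h\<in>UNIV. f (\<beta> h) * (path_coeff i h * path_coeff h l))
      = (\<Sum>h\<in>{h. \<beta> h \<in> {\<beta> l..\<beta> i}}. f (\<beta> h) * (path_coeff i h * path_coeff h l))"
    by (intro sum.mono_neutral_right) (auto simp: path_coeff_def split: if_splits)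
  also have "\<dots> = (\<Sum>b\<in>{\<beta> l..\<beta> i}. \<Sum>h\<in>{h\<in>{h. \<beta> h \<in> {\<beta> l..\<beta> i}}. \<beta> h = b}. f (\<beta> h) * (path_coeff i h * path_coeff h l))"
    by (subst sum.group) auto
  also have "\<dots> = (\<Sum>b\<in>{\<beta> l..\<beta> i}. \<Sum>h\<in>{h. \<beta> h = b}. f (\<beta> h) * (path_coeff i h * path_coeff h l))"
    by (intro sum.cong) auto
  also have "\<dots> = (\<Sum>b\<in>{\<beta> l..\<beta> i}. f b * path_coeff i l)"
    by (intro sum.cong) (auto simp flip: sum_distrib_left simp: sum_path_coeff_block)
  finally show ?thesis by (simp add: sum_distrib_right)
qed

text \<open>
  The matrix exponential of \<open>a Y\<close>, which is a finite sum because \<open>Y\<close> is nilpotent.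
\<close>

definition expY :: "complex \<Rightarrow> complex^'n^'n" where
  "expY a = (\<chi> i h. a ^ (\<beta> i - \<beta> h) / fact (\<beta> i - \<beta> h) * path_coeff i h)"

lemma expY_0 [simp]: "expY 0 = mat 1"
  by (auto simp: expY_def vec_eq_iff mat_def path_coeff_def power_0_left)

lemma expY_add: "expY a ** expY b = expY (a + b)"
proof -
  have "(\<Sum>h\<in>UNIV. expY a $ i $ h * expY b $ h $ l) = expY (a + b) $ i $ l" for i l
  proof -
    let ?f = "\<lambda>c. a ^ (\<beta> i - c) / fact (\<beta> i - c) * (b ^ (c - \<beta> l) / fact (c - \<beta> l))"
    have "(\<Sum>h\<in>UNIV. expY a $ i $ h * expY b $ h $ l) = (\<Sum>h\<in>UNIV. ?f (\<beta> h) * (path_coeff i h * path_coeff h l))"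
      by (simp add: expY_def mult_ac)
    also have "\<dots> = (\<Sum>c\<in>{\<beta> l..\<beta> i}. ?f c) * path_coeff i l" by (rule sum_path_coeff)
    also have "\<dots> = (a + b) ^ (\<beta> i - \<beta> l) / fact (\<beta> i - \<beta> l) * path_coeff i l"
    proof (cases "\<beta> l \<le> \<beta> i")
      case True
      define n where "n = \<beta> i - \<beta> l"
      have n: "\<beta> i = \<beta> l + n" using True by (simp add: n_def)
      have "(\<Sum>c\<in>{\<beta> l..\<beta> i}. ?f c) = (\<Sum>t\<le>n. ?f (\<beta> l + t))"
        unfolding n using sum.shift_bounds_cl_nat_ivl[of ?f 0 "\<beta> l" n]
        by (simp add: n atLeast0AtMost add.commute)
      also have "\<dots> = (\<Sum>t\<le>n. of_nat (n choose t) * b ^ t * a ^ (n - t)) / fact n"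
        unfolding sum_divide_distrib
      proof (intro sum.cong refl)
        fix t assume "t \<in> {..n}"
        then show "?f (\<beta> l + t) = of_nat (n choose t) * b ^ t * a ^ (n - t) / fact n"
          by (simp add: n binomial_fact mult.commute)
      qed
      also have "\<dots> = (a + b) ^ n / fact n" by (simp flip: binomial_ring add: add.commute)
      finally show ?thesis by (simp add: n_def)
    qed (simp add: path_coeff_eq_0)
    finally show ?thesis by (simp add: expY_def)
  qed
  then show ?thesis by (simp add: vec_eq_iff matrix_matrix_mult_def)
qed

text \<open>
  Write \<open>B\<close> for the diagonal matrix with the number of the block on the diagonal. This is the power with
  exponent \<open>\<eta> + B\<close> of the number with logarithm \<open>x\<close>.
\<close>

definition dpow :: "real \<Rightarrow> complex \<Rightarrow> complex^'n^'n" where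
  "dpow \<eta> x = (\<chi> i k. if i = k then exp (x * of_real (\<eta> + real (\<beta> i))) else 0)"

lemma dpow_mult_nth: "(dpow \<eta> x ** A) $ i $ k = exp (x * of_real (\<eta> + real (\<beta> i))) * A $ i $ k"
proof -
  have "(\<Sum>h\<in>UNIV. (if i = h then exp (x * of_real (\<eta> + real (\<beta> i))) else 0) * A $ h $ k)
      = (\<Sum>h\<in>UNIV. if h = i then exp (x * of_real (\<eta> + real (\<beta> i))) * A $ i $ k else 0)"
    by (intro sum.cong) auto
  then show ?thesis by (simp add: dpow_def matrix_matrix_mult_def)
qed

lemma mult_dpow_nth: "(A ** dpow \<eta> x) $ i $ k = A $ i $ k * exp (x * of_real (\<eta> + real (\<beta> k)))"
proof -
  have "(\<Sum>h\<in>UNIV. A $ i $ h * (if h = k then exp (x * of_real (\<eta> + real (\<beta> h))) else 0))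
      = (\<Sum>h\<in>UNIV. if h = k then A $ i $ k * exp (x * of_real (\<eta> + real (\<beta> k))) else 0)"
    by (intro sum.cong) auto
  then show ?thesis by (simp add: dpow_def matrix_matrix_mult_def)
qed

lemma dpow_0 [simp]: "dpow \<eta> 0 = mat 1"
  by (auto simp: dpow_def vec_eq_iff mat_def)

lemma dpow_add: "dpow \<eta> x ** dpow \<eta> y = dpow \<eta> (x + y)"
proof -
  have "(dpow \<eta> x ** dpow \<eta> y) $ i $ k = dpow \<eta> (x + y) $ i $ k" for i k
    unfolding dpow_mult_nth by (simp add: dpow_def exp_add distrib_right)
  then show ?thesis by (simp add: vec_eq_iff)
qed

lemma ctranspose_dpow [simp]: "ctranspose (dpow \<eta> x) = dpow \<eta> (cnj x)"
  by (auto simp: vec_eq_iff dpow_def exp_cnj)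

text \<open>
  The matrix exponential of \<open>a Y\<^sup>*\<close>.
\<close>

definition expYs :: "complex \<Rightarrow> complex^'n^'n" where
  "expYs a = ctranspose (expY (cnj a))"

lemma expYs_0 [simp]: "expYs 0 = mat 1"
  by (simp add: expYs_def)

lemma expYs_add: "expYs a ** expYs b = expYs (a + b)"
  by (simp add: expYs_def expY_add add.commute flip: ctranspose_matrix_mul)

lemma ctranspose_expY: "ctranspose (expY a) = expYs (cnj a)"
  by (simp add: expYs_def)

text \<open>
  As \<open>Y\<close> raises the number of the block by one, \<open>t\<^sup>B Y t\<^sup>-\<^sup>B = t Y\<close>.
\<close>

lemma dpow_expY: "dpow \<eta> x ** expY a = expY (exp x * a) ** dpow \<eta> x"
proof -
  have "exp (x * of_real (\<eta> + real (\<beta> i))) * expY a $ i $ k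
      = expY (exp x * a) $ i $ k * exp (x * of_real (\<eta> + real (\<beta> k)))" for i k
  proof (cases "\<beta> k \<le> \<beta> i")
    case True
    define n where "n = \<beta> i - \<beta> k"
    have n: "\<beta> i = \<beta> k + n" using True by (simp add: n_def)
    have "x * of_real (\<eta> + real (\<beta> i)) = x * of_real (\<eta> + real (\<beta> k)) + of_nat n * x"
      by (simp add: n algebra_simps)
    then have "exp (x * of_real (\<eta> + real (\<beta> i)))
        = exp (x * of_real (\<eta> + real (\<beta> k))) * exp x ^ n"
      by (simp only: exp_add exp_of_nat_mult)
    then show ?thesis by (simp add: expY_def n power_mult_distrib)
  qed (simp add: expY_def path_coeff_eq_0)
  then show ?thesis by (simp add: vec_eq_iff dpow_mult_nth mult_dpow_nth)
qed

lemma expYs_dpow: "expYs a ** dpow \<eta> x = dpow \<eta> x ** expYs (exp x * a)"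
  using arg_cong[OF dpow_expY[of \<eta> "cnj x" "cnj a"], of ctranspose]
  by (simp add: ctranspose_matrix_mul ctranspose_expY exp_cnj)

lemma Yprod_eq_matrix_power:
  "l \<le> p \<Longrightarrow> \<beta> i = p \<Longrightarrow> \<beta> k = l \<Longrightarrow> Yprod \<beta> Y p l $ i $ k = matrix_power Y (p - l) $ i $ k"
proof (induction p arbitrary: i)
  case (Suc p)
  show ?case
  proof (cases "l = Suc p")
    case False
    then have l: "l \<le> p" using Suc.prems by simp
    have "Yblock \<beta> Y (Suc p) $ i $ h * Yprod \<beta> Y p l $ h $ k = Y $ i $ h * matrix_power Y (p - l) $ h $ k" for h
    proof (cases "\<beta> h = p")
      case True
      then show ?thesis using Suc.IH[OF l True Suc.prems(3)] Suc.prems by (simp add: Yblock_def)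
    next
      case False
      then have "Y $ i $ h = 0"
        using subdiag Suc.prems(2) unfolding subdiagonal_def by (metis Suc_eq_plus1 nat.inject)
      then show ?thesis using False by (simp add: Yblock_def)
    qed
    then show ?thesis using l by (simp add: matrix_matrix_mult_def Suc_diff_le)
  qed simp
qed simp

text \<open>
  By this factorization, computations with the multiplier come down to the commutation rules
  \<open>dpow_expY\<close> and \<open>expYs_dpow\<close>.
\<close>

lemma multiplier_eq:
  "multiplier \<beta> \<eta> Y g z =
     dpow \<eta> (- log_denom g z) ** expY (- (fst g $ 2 $ 1)) ** dpow \<eta> (- log_denom g z)"
proof -
  have "multiplier \<beta> \<eta> Y g z $ i $ k =
     exp (- log_denom g z * of_real (\<eta> + real (\<beta> i))) * expY (- (fst g $ 2 $ 1)) $ i $ k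
       * exp (- log_denom g z * of_real (\<eta> + real (\<beta> k)))" for i k
  proof (cases "\<beta> k \<le> \<beta> i")
    case True
    have "deriv_power g (\<eta> + (real (\<beta> i) + real (\<beta> k)) / 2) z
        = exp (- log_denom g z * of_real (\<eta> + real (\<beta> i))) * exp (- log_denom g z * of_real (\<eta> + real (\<beta> k)))"
      unfolding deriv_power_def exp_add[symmetric] by (rule arg_cong[where f=exp]) (simp add: field_simps)
    then show ?thesis
      using True by (simp add: multiplier_def expY_def path_coeff_def Let_def Yprod_eq_matrix_power)
  qed (simp add: multiplier_def expY_def path_coeff_eq_0)
  then show ?thesis by (simp add: vec_eq_iff dpow_mult_nth mult_dpow_nth)
qed

text \<open>
  The invariant kernel
  \<open>(1 - z cnj w)\<^bsup>- (\<eta> + B)\<^esup> exp (cnj w Y) exp (z Y\<^sup>*) (1 - z cnj w)\<^bsup>- (\<eta> + B)\<^esup>\<close>.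
  It is the identity for \<open>z = w = 0\<close>.
\<close>

definition kern :: "real \<Rightarrow> complex \<Rightarrow> complex \<Rightarrow> complex^'n^'n" where
  "kern \<eta> z w = dpow \<eta> (- Ln (1 - z * cnj w)) ** expY (cnj w) ** expYs z ** dpow \<eta> (- Ln (1 - z * cnj w))"

end

section \<open>The covering group on the disc\<close>

lemma SU11_relations:
  assumes "A \<in> SU11"
  shows "A $ 1 $ 1 = cnj (A $ 2 $ 2)" "A $ 1 $ 2 = cnj (A $ 2 $ 1)"
    "A $ 2 $ 2 * cnj (A $ 2 $ 2) - A $ 2 $ 1 * cnj (A $ 2 $ 1) = 1"
proof -
  show *: "A $ 1 $ 1 = cnj (A $ 2 $ 2)" "A $ 1 $ 2 = cnj (A $ 2 $ 1)"
    using assms by (auto simp: SU11_def)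
  then show "A $ 2 $ 2 * cnj (A $ 2 $ 2) - A $ 2 $ 1 * cnj (A $ 2 $ 1) = 1"
    using assms by (simp add: SU11_def det_2 mult.commute)
qed

lemma SU11_coverD: "g \<in> SU11_cover \<Longrightarrow> fst g \<in> SU11" "g \<in> SU11_cover \<Longrightarrow> exp (snd g) = fst g $ 2 $ 2"
  by (auto simp: SU11_cover_def)

lemma norm_mult_less_1: "z \<in> unit_disc \<Longrightarrow> w \<in> unit_disc \<Longrightarrow> norm (z * cnj w) < 1"
  using mult_strict_mono[of "norm z" 1 "norm w" 1] by (cases "w = 0") (auto simp: norm_mult)

lemma Re_one_minus_pos:
  assumes "z \<in> unit_disc" "w \<in> unit_disc"
  shows "Re (1 - z * cnj w) > 0"
  using abs_Re_le_cmod[of "z * cnj w"] norm_mult_less_1[OF assms] by (simp del: times_complex.sel)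

lemma one_minus_neq_0:
  assumes "z \<in> unit_disc" "w \<in> unit_disc"
  shows "1 - z * cnj w \<noteq> 0"
  using norm_mult_less_1[OF assms] by force

lemma one_minus_moebius:
  assumes g: "g \<in> SU11_cover" and z: "z \<in> unit_disc" and w: "w \<in> unit_disc"
  shows "1 - moebius (fst g) z * cnj (moebius (fst g) w)
       = (1 - z * cnj w) / (exp (log_denom g z) * exp (cnj (log_denom g w)))"
proof -
  let ?c = "fst g $ 2 $ 1" and ?d = "fst g $ 2 $ 2"
  note r = SU11_relations[OF SU11_coverD(1)[OF g]]
  have nz: "?c * z + ?d \<noteq> 0" "cnj (?c * w + ?d) \<noteq> 0"
    using exp_log_denom(2)[OF g z] exp_log_denom(2)[OF g w] by (simp_all only: complex_cnj_zero_iff not_False_eq_True)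
  have e: "exp (log_denom g z) = ?c * z + ?d" "exp (cnj (log_denom g w)) = cnj (?c * w + ?d)"
    using exp_log_denom(1)[OF g z] exp_log_denom(1)[OF g w] by (simp_all flip: exp_cnj)
  have "(?c * z + ?d) * cnj (?c * w + ?d)
      - (cnj ?d * z + cnj ?c) * (cnj (cnj ?d * w + cnj ?c)) = (1 - z * cnj w) * (?d * cnj ?d - ?c * cnj ?c)"
    by (simp add: algebra_simps)
  then have "(?c * z + ?d) * cnj (?c * w + ?d) - (cnj ?d * z + cnj ?c) * (cnj (cnj ?d * w + cnj ?c)) = 1 - z * cnj w"
    by (simp add: r(3))
  then show ?thesis
    unfolding e moebius_def r(1,2) using nz by (simp add: divide_simps del: complex_cnj_add complex_cnj_mult)
qed

lemma moebius_in_disc: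
  assumes g: "g \<in> SU11_cover" and z: "z \<in> unit_disc"
  shows "moebius (fst g) z \<in> unit_disc"
proof -
  let ?u = "moebius (fst g) z" and ?e = "exp (log_denom g z)"
  have "of_real (1 - (norm ?u)\<^sup>2) = complex_of_real ((1 - (norm z)\<^sup>2) / (norm ?e)\<^sup>2)"
    using one_minus_moebius[OF g z z]
    by (simp only: of_real_diff of_real_divide of_real_1 complex_norm_square exp_cnj)
  then have "1 - (norm ?u)\<^sup>2 = (1 - (norm z)\<^sup>2) / (norm ?e)\<^sup>2" by (simp only: of_real_eq_iff)
  moreover have "(norm z)\<^sup>2 < 1" using z by (simp add: power_less_one_iff abs_square_less_1)
  ultimately have "(norm ?u)\<^sup>2 < 1"
    by (smt (verit) divide_pos_pos exp_not_eq_zero zero_less_norm_iff zero_less_power)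
  then show ?thesis by (simp add: abs_square_less_1)
qed

text \<open>
  Two branches of a logarithm are identified by this. The logarithms below stay within \<open>\<pi> / 2\<close> of a known
  imaginary part, because the numbers \<open>1 - z cnj w\<close> and \<open>1 + c z / d\<close> have positive real part.
\<close>

lemma exp_eq_imp_eq:
  assumes "exp x = exp y" "\<bar>Im x - Im y\<bar> < 2 * pi"
  shows "x = y"
proof -
  from assms(1) obtain n :: int where n: "x = y + (of_int (2 * n) * pi) * \<i>"
    by (auto simp: exp_eq)
  then have "\<bar>of_int (2 * n) * pi\<bar> < 2 * pi" using assms(2) by simp
  then have "\<bar>real_of_int n\<bar> * (2 * pi) < 1 * (2 * pi)" by (simp add: abs_mult)
  then have "\<bar>real_of_int n\<bar> < 1" by (subst (asm) mult_less_cancel_right) simp_all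
  then have "n = 0" by linarith
  then show ?thesis using n by simp
qed

lemma Im_log_denom:
  assumes g: "g \<in> SU11_cover" and z: "z \<in> unit_disc"
  shows "\<bar>Im (log_denom g z) - Im (snd g)\<bar> < pi / 2"
  using Re_Ln_pos_lt_imp[OF exp_log_denom(3)[OF assms]] by (simp add: log_denom_def)

lemma Ln_one_minus_moebius:
  assumes g: "g \<in> SU11_cover" and z: "z \<in> unit_disc" and w: "w \<in> unit_disc"
  shows "Ln (1 - moebius (fst g) z * cnj (moebius (fst g) w))
       = Ln (1 - z * cnj w) - log_denom g z - cnj (log_denom g w)"
proof (rule exp_eq_imp_eq)
  have gz: "moebius (fst g) z \<in> unit_disc" "moebius (fst g) w \<in> unit_disc"
    using assms moebius_in_disc by auto
  show "exp (Ln (1 - moebius (fst g) z * cnj (moebius (fst g) w)))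
      = exp (Ln (1 - z * cnj w) - log_denom g z - cnj (log_denom g w))"
    using one_minus_moebius[OF assms] one_minus_neq_0[OF z w] one_minus_neq_0[OF gz]
    by (simp add: exp_diff)
  have "\<bar>Im (Ln (1 - moebius (fst g) z * cnj (moebius (fst g) w)))\<bar> < pi / 2"
    "\<bar>Im (Ln (1 - z * cnj w))\<bar> < pi / 2"
    using Re_Ln_pos_lt_imp Re_one_minus_pos[OF gz] Re_one_minus_pos[OF z w] by blast+
  then show "\<bar>Im (Ln (1 - moebius (fst g) z * cnj (moebius (fst g) w)))
      - Im (Ln (1 - z * cnj w) - log_denom g z - cnj (log_denom g w))\<bar> < 2 * pi"
    using Im_log_denom[OF g z] Im_log_denom[OF g w] by (simp add: abs_if split: if_splits)
qed

text \<open>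
  The inverse of \<open>(A, \<omega>)\<close>: the lower right entry of the inverse matrix is \<open>cnj d\<close>, with logarithm \<open>cnj \<omega>\<close>.
\<close>

definition cover_inverse :: "(complex^2^2) \<times> complex \<Rightarrow> (complex^2^2) \<times> complex" where
  "cover_inverse g = (vector [vector [fst g $ 2 $ 2, - fst g $ 1 $ 2], vector [- fst g $ 2 $ 1, fst g $ 1 $ 1]], cnj (snd g))"

lemma cover_inverse_in:
  assumes g: "g \<in> SU11_cover"
  shows "cover_inverse g \<in> SU11_cover"
proof -
  note r = SU11_relations[OF SU11_coverD(1)[OF g]]
  have "fst (cover_inverse g) \<in> SU11" using r by (simp add: cover_inverse_def SU11_def det_2 mult.commute)
  then show ?thesis using r SU11_coverD(2)[OF g]
    by (simp add: cover_inverse_def SU11_cover_def flip: exp_cnj)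
qed

lemma moebius_cover_inverse:
  assumes g: "g \<in> SU11_cover" and z: "z \<in> unit_disc"
  shows "moebius (fst (cover_inverse g)) (moebius (fst g) z) = z"
    and "moebius (fst g) (moebius (fst (cover_inverse g)) z) = z"
    and "log_denom (cover_inverse g) (moebius (fst g) z) = - log_denom g z"
proof -
  let ?c = "fst g $ 2 $ 1" and ?d = "fst g $ 2 $ 2"
  let ?h = "cover_inverse g"
  note r = SU11_relations[OF SU11_coverD(1)[OF g]]
  have h: "?h \<in> SU11_cover" by (rule cover_inverse_in[OF g])
  have nz: "?c * z + ?d \<noteq> 0" "- ?c * z + cnj ?d \<noteq> 0"
    using exp_log_denom(2)[OF g z] exp_log_denom(2)[OF h z] r by (simp_all add: cover_inverse_def)
  have 1: "- ?c * moebius (fst g) z + cnj ?d = 1 / (?c * z + ?d)"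
  proof -
    have "- ?c * (cnj ?d * z + cnj ?c) + cnj ?d * (?c * z + ?d) = ?d * cnj ?d - ?c * cnj ?c"
      by (simp add: algebra_simps)
    then show ?thesis using nz r(3) unfolding moebius_def r(1,2) by (simp add: divide_simps)
  qed
  have 2: "?c * moebius (fst ?h) z + ?d = 1 / (- ?c * z + cnj ?d)"
  proof -
    have "?c * (?d * z - cnj ?c) + ?d * (- ?c * z + cnj ?d) = ?d * cnj ?d - ?c * cnj ?c"
      by (simp add: algebra_simps)
    then show ?thesis using nz(2) r(3) unfolding moebius_def by (simp add: divide_simps cover_inverse_def r)
  qed
  have "?d * (cnj ?d * z + cnj ?c) - cnj ?c * (?c * z + ?d) = z * (?d * cnj ?d - ?c * cnj ?c)"
    by (simp add: algebra_simps)
  then have 3: "?d * moebius (fst g) z - cnj ?c = z / (?c * z + ?d)"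
    using nz r(3) unfolding moebius_def r(1,2) by (simp add: divide_simps)
  show "moebius (fst ?h) (moebius (fst g) z) = z"
    using 1 3 nz unfolding moebius_def[of "fst ?h"] by (simp add: cover_inverse_def r)
  have "cnj ?d * (?d * z - cnj ?c) + cnj ?c * (- ?c * z + cnj ?d) = z * (?d * cnj ?d - ?c * cnj ?c)"
    by (simp add: algebra_simps)
  then have 4: "cnj ?d * moebius (fst ?h) z + cnj ?c = z / (- ?c * z + cnj ?d)"
    using nz(2) r(3) unfolding moebius_def by (simp add: divide_simps cover_inverse_def r)
  show "moebius (fst g) (moebius (fst ?h) z) = z"
    using 2 4 nz unfolding moebius_def[of "fst g"] by (simp add: r)
  show "log_denom ?h (moebius (fst g) z) = - log_denom g z"
  proof (rule exp_eq_imp_eq)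
    have gz: "moebius (fst g) z \<in> unit_disc" using moebius_in_disc[OF g z] .
    show "exp (log_denom ?h (moebius (fst g) z)) = exp (- log_denom g z)"
      using 1 by (simp add: exp_log_denom(1)[OF h gz] exp_minus exp_log_denom(1)[OF g z]) (simp add: cover_inverse_def r inverse_eq_divide)
    show "\<bar>Im (log_denom ?h (moebius (fst g) z)) - Im (- log_denom g z)\<bar> < 2 * pi"
      using Im_log_denom[OF g z] Im_log_denom[OF h gz] by (simp add: cover_inverse_def abs_if split: if_splits)
  qed
qed

section \<open>The invariant kernel\<close>

context graded_matrix
begin

lemma multiplier_inverse:
  assumes g: "g \<in> SU11_cover" and z: "z \<in> unit_disc"
  shows "multiplier \<beta> \<eta> Y g z ** multiplier \<beta> \<eta> Y (cover_inverse g) (moebius (fst g) z) = mat 1"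
proof -
  let ?l = "log_denom g z" and ?c = "fst g $ 2 $ 1"
  have c: "fst (cover_inverse g) $ 2 $ 1 = - ?c" by (simp add: cover_inverse_def)
  have "multiplier \<beta> \<eta> Y g z ** multiplier \<beta> \<eta> Y (cover_inverse g) (moebius (fst g) z)
     = dpow \<eta> (- ?l) ** expY (- ?c) ** (dpow \<eta> (- ?l) ** dpow \<eta> ?l) ** expY ?c ** dpow \<eta> ?l"
    unfolding multiplier_eq moebius_cover_inverse(3)[OF g z] c by (simp add: matrix_mul_assoc)
  also have "\<dots> = dpow \<eta> (- ?l) ** (expY (- ?c) ** expY ?c) ** dpow \<eta> ?l"
    unfolding dpow_add by (simp add: matrix_mul_assoc)
  also have "\<dots> = mat 1" unfolding expY_add by (simp add: dpow_add)
  finally show ?thesis .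
qed

text \<open>
  The normal form with all powers of \<open>1 - z cnj w\<close> in the middle.
\<close>

lemma kern_eq:
  assumes "z \<in> unit_disc" "w \<in> unit_disc"
  defines "s \<equiv> Ln (1 - z * cnj w)"
  shows "kern \<eta> z w = expY (cnj w * exp (- s)) ** dpow \<eta> (- 2 * s) ** expYs (z * exp (- s))"
proof -
  have "kern \<eta> z w = (dpow \<eta> (- s) ** expY (cnj w)) ** (expYs z ** dpow \<eta> (- s))"
    by (simp add: kern_def s_def matrix_mul_assoc)
  also have "\<dots> = expY (exp (- s) * cnj w) ** (dpow \<eta> (- s) ** dpow \<eta> (- s)) ** expYs (exp (- s) * z)"
    unfolding dpow_expY expYs_dpow by (simp add: matrix_mul_assoc)
  finally show ?thesis by (simp add: dpow_add mult.commute)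
qed

text \<open>
  The factors \<open>c z + d\<close> and \<open>cnj (c w + d)\<close> enter through \<open>1 - g z cnj (g w)\<close> and through the two multipliers.
  Once all diagonal powers are moved to the middle, they cancel there, and what is left are two scalar
  identities for the exponents of \<open>exp (Y)\<close> and \<open>exp (Y\<^sup>*)\<close>, which express that \<open>g\<close> has determinant 1.
\<close>

lemma kern_invariant:
  assumes g: "g \<in> SU11_cover" and z: "z \<in> unit_disc" and w: "w \<in> unit_disc"
  shows "multiplier \<beta> \<eta> Y g z ** kern \<eta> (moebius (fst g) z) (moebius (fst g) w)
           ** ctranspose (multiplier \<beta> \<eta> Y g w) = kern \<eta> z w"
proof -
  let ?c = "fst g $ 2 $ 1" and ?d = "fst g $ 2 $ 2"
  define l1 where "l1 = log_denom g z"
  define l2 where "l2 = cnj (log_denom g w)"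
  define s where "s = Ln (1 - z * cnj w)"
  define u where "u = cnj (moebius (fst g) w)"
  define v where "v = moebius (fst g) z"
  note r = SU11_relations[OF SU11_coverD(1)[OF g]]
  have s': "- Ln (1 - v * u) = l1 + l2 - s"
    unfolding u_def v_def Ln_one_minus_moebius[OF assms] by (simp add: s_def l1_def l2_def)
  have nz: "?c * z + ?d \<noteq> 0" "cnj (?c * w + ?d) \<noteq> 0" "1 - z * cnj w \<noteq> 0"
    using exp_log_denom(2)[OF g z] exp_log_denom(2)[OF g w] one_minus_neq_0[OF z w]
    by (simp_all only: complex_cnj_zero_iff not_False_eq_True)
  have e: "exp l1 = ?c * z + ?d" "exp l2 = cnj (?c * w + ?d)" "exp s = 1 - z * cnj w"
    using exp_log_denom(1)[OF g z] exp_log_denom(1)[OF g w] nz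
    by (simp_all add: l1_def l2_def s_def flip: exp_cnj)
  have 1: "- ?c + exp (l2 - s) * u = cnj w * exp (l1 - s)"
  proof -
    have "exp l2 * u = ?d * cnj w + ?c"
      using nz unfolding u_def moebius_def e r(1,2) by simp
    then have "- ?c + exp (l2 - s) * u = - ?c + (?d * cnj w + ?c) / exp s" by (simp add: exp_diff)
    also have "\<dots> = cnj w * exp (l1 - s)"
      using nz unfolding exp_diff e by (simp add: field_simps)
    finally show ?thesis .
  qed
  have 2: "exp (l1 - s) * v + - cnj ?c = z * exp (l2 - s)"
  proof -
    have "exp l1 * v = cnj ?d * z + cnj ?c"
      using nz unfolding v_def moebius_def e r(1,2) by simp
    then have "exp (l1 - s) * v + - cnj ?c = (cnj ?d * z + cnj ?c) / exp s - cnj ?c" by (simp add: exp_diff)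
    also have "\<dots> = z * exp (l2 - s)"
      using nz unfolding exp_diff e by (simp add: field_simps)
    finally show ?thesis .
  qed
  have J1: "multiplier \<beta> \<eta> Y g z = dpow \<eta> (- l1) ** expY (- ?c) ** dpow \<eta> (- l1)"
    by (simp add: multiplier_eq l1_def)
  have J2: "ctranspose (multiplier \<beta> \<eta> Y g w) = dpow \<eta> (- l2) ** expYs (- cnj ?c) ** dpow \<eta> (- l2)"
    by (simp add: multiplier_eq l2_def ctranspose_matrix_mul ctranspose_expY matrix_mul_assoc)
  have K: "kern \<eta> (moebius (fst g) z) (moebius (fst g) w)
      = dpow \<eta> (l1 + l2 - s) ** expY u ** expYs v ** dpow \<eta> (l1 + l2 - s)"
    unfolding kern_def using s' by (simp add: u_def v_def)
  have "multiplier \<beta> \<eta> Y g z ** kern \<eta> (moebius (fst g) z) (moebius (fst g) w)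
           ** ctranspose (multiplier \<beta> \<eta> Y g w)
     = dpow \<eta> (- l1) ** expY (- ?c) ** (dpow \<eta> (- l1) ** dpow \<eta> (l1 + l2 - s)) ** expY u
        ** expYs v ** (dpow \<eta> (l1 + l2 - s) ** dpow \<eta> (- l2)) ** expYs (- cnj ?c) ** dpow \<eta> (- l2)"
    unfolding J1 J2 K by (simp add: matrix_mul_assoc)
  also have "\<dots> = dpow \<eta> (- l1) ** expY (- ?c) ** (dpow \<eta> (l2 - s) ** expY u)
        ** (expYs v ** dpow \<eta> (l1 - s)) ** expYs (- cnj ?c) ** dpow \<eta> (- l2)"
    unfolding dpow_add by (simp add: matrix_mul_assoc)
  also have "\<dots> = dpow \<eta> (- l1) ** (expY (- ?c) ** expY (exp (l2 - s) * u)) ** (dpow \<eta> (l2 - s)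
        ** dpow \<eta> (l1 - s)) ** (expYs (exp (l1 - s) * v) ** expYs (- cnj ?c)) ** dpow \<eta> (- l2)"
    unfolding dpow_expY[of \<eta> "l2 - s" u] expYs_dpow[of v \<eta> "l1 - s"] by (simp add: matrix_mul_assoc)
  also have "\<dots> = (dpow \<eta> (- l1) ** expY (cnj w * exp (l1 - s))) ** dpow \<eta> (l1 + l2 - 2 * s)
        ** (expYs (z * exp (l2 - s)) ** dpow \<eta> (- l2))"
    unfolding expY_add expYs_add dpow_add 1 2 by (simp add: matrix_mul_assoc algebra_simps)
  also have "\<dots> = expY (exp (- l1) * (cnj w * exp (l1 - s))) ** (dpow \<eta> (- l1) ** dpow \<eta> (l1 + l2 - 2 * s)
        ** dpow \<eta> (- l2)) ** expYs (exp (- l2) * (z * exp (l2 - s)))"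
    unfolding dpow_expY expYs_dpow by (simp add: matrix_mul_assoc)
  also have "\<dots> = expY (cnj w * exp (- s)) ** dpow \<eta> (- 2 * s) ** expYs (z * exp (- s))"
  proof -
    have "exp (- l1) * (cnj w * exp (l1 - s)) = cnj w * exp (- s)"
      "exp (- l2) * (z * exp (l2 - s)) = z * exp (- s)"
      by (simp_all add: exp_diff exp_minus field_simps)
    moreover have "- l1 + (l1 + l2 - 2 * s) + - l2 = - 2 * s" by simp
    ultimately show ?thesis unfolding dpow_add by (simp only:)
  qed
  also have "\<dots> = kern \<eta> z w" using kern_eq[OF z w] by (simp add: s_def)
  finally show ?thesis .
qed

end

section \<open>Inner products of vectors\<close>

lemma cinner_mult: "cinner (A *v x) y = (\<Sum>i\<in>UNIV. \<Sum>l\<in>UNIV. A $ i $ l * x $ l * cnj (y $ i))"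
  by (simp add: cinner_def matrix_vector_mult_def sum_distrib_right)

lemma cinner_ctranspose: "cinner (A *v x) y = cinner x (ctranspose A *v y)"
  unfolding cinner_mult
  by (subst sum.swap) (simp add: cinner_def matrix_vector_mult_def sum_distrib_left mult_ac)

lemma cinner_add_left: "cinner (x + y) z = cinner x z + cinner y z"
  by (simp add: cinner_def algebra_simps sum.distrib)

lemma cinner_add_right: "cinner x (y + z) = cinner x y + cinner x z"
  by (simp add: cinner_def algebra_simps sum.distrib)

lemma cinner_diff_left: "cinner (x - y) z = cinner x z - cinner y z"
  by (simp add: cinner_def algebra_simps sum_subtractf)

lemma cinner_diff_right: "cinner x (y - z) = cinner x y - cinner x z"
  by (simp add: cinner_def algebra_simps sum_subtractf)

lemma cinner_scale_left: "cinner (a *s x) y = a * cinner x y"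
  by (simp add: cinner_def sum_distrib_left mult_ac)

lemma cinner_scale_right: "cinner x (a *s y) = cnj a * cinner x y"
  by (simp add: cinner_def sum_distrib_left mult_ac)

lemma cinner_0 [simp]: "cinner 0 y = 0" "cinner x 0 = 0"
  by (simp_all add: cinner_def)

lemma cnj_cinner: "cnj (cinner x y) = cinner y x"
  by (simp add: cinner_def mult.commute)

lemma cinner_self: "cinner x x = of_real ((norm x)\<^sup>2)"
  by (simp add: cinner_def norm_vec_def L2_set_def real_sqrt_pow2 sum_nonneg complex_norm_square
      del: of_real_power)

lemma cinner_axis: "cinner x (axis i 1) = x $ i"
proof -
  have "cinner x (axis i 1) = (\<Sum>j\<in>UNIV. if j = i then x $ i else 0)"
    unfolding cinner_def by (intro sum.cong) (auto simp: axis_def)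
  then show ?thesis by simp
qed

lemma norm_cinner_le: "norm (cinner x y) \<le> (\<Sum>i\<in>UNIV. norm (x $ i) * norm (y $ i))"
  unfolding cinner_def by (rule order_trans[OF norm_sum]) (simp add: norm_mult)

lemma injective_imp_surjective_matrix:
  fixes A :: "complex^'n^'n"
  assumes "\<And>x. A *v x = 0 \<Longrightarrow> x = 0"
  shows "\<exists>x. A *v x = y"
proof -
  have "inj ((*v) A)"
    by (rule injI) (metis assms eq_iff_diff_eq_0 matrix_vector_mult_diff_distrib)
  then have "\<exists>B. B ** A = mat 1" using matrix_left_invertible_injective by blast
  then obtain B where "A ** B = mat 1" using matrix_left_right_inverse by blast
  then have "A *v (B *v y) = y" by (simp add: matrix_vector_mul_assoc)
  then show ?thesis by blast
qed

section \<open>The Taylor coefficients of the kernel\<close>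

context graded_matrix
begin

text \<open>
  The Taylor coefficients of the kernel that have weight \<open>k\<close> under rotations: the entry \<open>(i, l)\<close> belongs to the
  monomial \<open>z\<^bsup>k - \<beta> i\<^esup> (cnj w)\<^bsup>k - \<beta> l\<^esup>\<close>, as \<open>kern_sums\<close> shows.
\<close>

definition coeff_mat :: "real \<Rightarrow> nat \<Rightarrow> complex^'n^'n" where
  "coeff_mat \<eta> k = (\<chi> i l. if \<beta> i \<le> k \<and> \<beta> l \<le> k then
     (\<Sum>h\<in>UNIV. of_real (kernel_coeff \<eta> k (\<beta> i) (\<beta> l) (\<beta> h)) * (path_coeff i h * cnj (path_coeff l h))) else 0)"

definition epow :: "nat \<Rightarrow> complex \<Rightarrow> complex^'n \<Rightarrow> complex^'n" where
  "epow k z x = (\<chi> i. if \<beta> i \<le> k then z ^ (k - \<beta> i) * x $ i else 0)"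

text \<open>
  The vectors that occur as Taylor coefficients of weight \<open>k\<close>.
\<close>

definition level :: "nat \<Rightarrow> (complex^'n) set" where
  "level k = {x. \<forall>i. k < \<beta> i \<longrightarrow> x $ i = 0}"

lemma cinner_epow: "cinner (epow k z x) y = cinner x (epow k (cnj z) y)"
  by (auto simp: cinner_def epow_def intro!: sum.cong)

lemma coeff_mat_hermitian: "ctranspose (coeff_mat \<eta> k) = coeff_mat \<eta> k"
proof -
  have "kernel_coeff \<eta> k p q i = kernel_coeff \<eta> k q p i" for p q i
    by (simp add: kernel_coeff_def add_ac diff_commute mult_ac)
  then show ?thesis by (auto simp: coeff_mat_def vec_eq_iff mult_ac intro!: sum.cong)
qed

lemma coeff_mat_in_level: "coeff_mat \<eta> k *v x \<in> level k"
  by (simp add: level_def coeff_mat_def matrix_vector_mult_def)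

lemma one_minus_powr_sums:
  fixes u :: complex and a :: real
  assumes "norm u < 1"
  shows "(\<lambda>n. of_real (pochhammer a n / fact n) * u ^ n) sums exp (- Ln (1 - u) * of_real a)"
proof -
  have ne: "1 - u \<noteq> 0" using assms by auto
  have "(\<lambda>n. (of_real (- a) gchoose n) * (- u) ^ n) sums (1 + - u) powr of_real (- a)"
    using assms by (intro gen_binomial_complex) simp
  also have "(1 + - u) powr of_real (- a) = exp (- Ln (1 - u) * of_real a)"
    using ne by (simp add: powr_def mult.commute)
  also have "(\<lambda>n. (of_real (- a) gchoose n) * (- u) ^ n) = (\<lambda>n. of_real (pochhammer a n / fact n) * u ^ n)"
  proof
    fix n
    have 1: "(of_real (- a) gchoose n :: complex) = (- 1) ^ n * of_real (pochhammer a n) / fact n"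
      by (simp add: gbinomial_pochhammer pochhammer_of_real)
    have 2: "(- 1) ^ n * (- u) ^ n = u ^ n" by (simp flip: power_mult_distrib)
    have 3: "s * p / f * v = p / f * (s * v)" for s p f v :: complex by simp
    show "(of_real (- a) gchoose n) * (- u) ^ n = of_real (pochhammer a n / fact n) * u ^ n"
      unfolding 1 3 2 by simp
  qed
  finally show ?thesis .
qed

lemma kern_sums:
  assumes z: "z \<in> unit_disc" and w: "w \<in> unit_disc"
  shows "(\<lambda>k. z ^ (k - \<beta> i) * coeff_mat \<eta> k $ i $ l * cnj w ^ (k - \<beta> l)) sums kern \<eta> z w $ i $ l"
proof -
  define E where "E = exp (- Ln (1 - z * cnj w) * of_real (2 * \<eta> + real (\<beta> i) + real (\<beta> l)))"
  have K: "kern \<eta> z w $ i $ l = (\<Sum>h\<in>UNIV. (cnj w ^ (\<beta> i - \<beta> h) * z ^ (\<beta> l - \<beta> h) * E)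
      / (fact (\<beta> i - \<beta> h) * fact (\<beta> l - \<beta> h)) * (path_coeff i h * cnj (path_coeff l h)))"
  proof -
    have E: "E = exp (- Ln (1 - z * cnj w) * of_real (\<eta> + real (\<beta> i)))
        * exp (- Ln (1 - z * cnj w) * of_real (\<eta> + real (\<beta> l)))"
      unfolding E_def exp_add[symmetric] by (rule arg_cong[where f = exp]) (simp add: algebra_simps)
    have "kern \<eta> z w $ i $ l = exp (- Ln (1 - z * cnj w) * of_real (\<eta> + real (\<beta> i)))
        * (expY (cnj w) ** expYs z) $ i $ l * exp (- Ln (1 - z * cnj w) * of_real (\<eta> + real (\<beta> l)))"
      unfolding kern_def mult_dpow_nth by (simp only: matrix_mul_assoc[symmetric] dpow_mult_nth)
    also have "\<dots> = E * (expY (cnj w) ** expYs z) $ i $ l" by (simp add: E)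
    also have "(expY (cnj w) ** expYs z) $ i $ l = (\<Sum>h\<in>UNIV. (cnj w ^ (\<beta> i - \<beta> h) * z ^ (\<beta> l - \<beta> h))
      / (fact (\<beta> i - \<beta> h) * fact (\<beta> l - \<beta> h)) * (path_coeff i h * cnj (path_coeff l h)))"
      by (simp add: matrix_matrix_mult_def expYs_def expY_def mult_ac)
    finally show ?thesis by (simp add: sum_distrib_left mult_ac)
  qed
  have summand: "(\<lambda>k. if \<beta> i \<le> k \<and> \<beta> l \<le> k then z ^ (k - \<beta> i) * cnj w ^ (k - \<beta> l)
        * (of_real (kernel_coeff \<eta> k (\<beta> i) (\<beta> l) (\<beta> h)) * (path_coeff i h * cnj (path_coeff l h))) else 0)
     sums ((cnj w ^ (\<beta> i - \<beta> h) * z ^ (\<beta> l - \<beta> h) * E)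
      / (fact (\<beta> i - \<beta> h) * fact (\<beta> l - \<beta> h)) * (path_coeff i h * cnj (path_coeff l h)))" (is "?f sums _") for h
  proof (cases "\<beta> h \<le> \<beta> i \<and> \<beta> h \<le> \<beta> l")
    case True
    define N where "N = \<beta> i + \<beta> l - \<beta> h"
    define D :: complex where "D = cnj w ^ (\<beta> i - \<beta> h) * z ^ (\<beta> l - \<beta> h)
      / (fact (\<beta> i - \<beta> h) * fact (\<beta> l - \<beta> h)) * (path_coeff i h * cnj (path_coeff l h))"
    have "(\<lambda>n. of_real (pochhammer (2 * \<eta> + real (\<beta> i) + real (\<beta> l)) n / fact n) * (z * cnj w) ^ n) sums E"
      unfolding E_def by (intro one_minus_powr_sums norm_mult_less_1 z w)
    then have 1: "(\<lambda>n. D * (of_real (pochhammer (2 * \<eta> + real (\<beta> i) + real (\<beta> l)) n / fact n) * (z * cnj w) ^ n)) sums (D * E)"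
      by (rule sums_mult)
    have 2: "?f (n + N) = D * (of_real (pochhammer (2 * \<eta> + real (\<beta> i) + real (\<beta> l)) n / fact n) * (z * cnj w) ^ n)" for n
    proof -
      have e: "n + N - \<beta> i = n + (\<beta> l - \<beta> h)" "n + N - \<beta> l = n + (\<beta> i - \<beta> h)"
        "n + N + \<beta> h - \<beta> i - \<beta> l = n" "\<beta> i + \<beta> l \<le> n + N + \<beta> h" "\<beta> i \<le> n + N" "\<beta> l \<le> n + N"
        using True by (auto simp: N_def)
      have pw: "z ^ (n + N - \<beta> i) * cnj w ^ (n + N - \<beta> l)
          = (z * cnj w) ^ n * (cnj w ^ (\<beta> i - \<beta> h) * z ^ (\<beta> l - \<beta> h))"
        unfolding e(1,2) by (simp add: power_add power_mult_distrib)
      have kc: "kernel_coeff \<eta> (n + N) (\<beta> i) (\<beta> l) (\<beta> h) = pochhammer (2 * \<eta> + real (\<beta> i) + real (\<beta> l)) n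
          / (fact n * fact (\<beta> i - \<beta> h) * fact (\<beta> l - \<beta> h))"
        using e(4) by (simp only: kernel_coeff_def e(3) if_True)
      show ?thesis using e(5,6) unfolding pw kc D_def by (simp add: mult_ac)
    qed
    have 3: "?f k = 0" if "k < N" for k
    proof -
      have "\<not> \<beta> i + \<beta> l \<le> k + \<beta> h" using that True by (auto simp: N_def)
      then show ?thesis by (simp add: kernel_coeff_def)
    qed
    have "(\<lambda>n. ?f (n + N)) sums (D * E)" unfolding 2 by (rule 1)
    then have "?f sums (D * E)" using 3 by (subst (asm) sums_zero_iff_shift) auto
    then show ?thesis by (simp add: D_def mult_ac)
  next
    case False
    then have 0: "path_coeff i h * cnj (path_coeff l h) = 0" by (auto simp: path_coeff_eq_0 not_le)
    show ?thesis unfolding 0 by (simp cong: if_cong)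
  qed
  have "(\<lambda>k. \<Sum>h\<in>UNIV. if \<beta> i \<le> k \<and> \<beta> l \<le> k then z ^ (k - \<beta> i) * cnj w ^ (k - \<beta> l)
        * (of_real (kernel_coeff \<eta> k (\<beta> i) (\<beta> l) (\<beta> h)) * (path_coeff i h * cnj (path_coeff l h))) else 0)
     sums kern \<eta> z w $ i $ l"
    unfolding K by (intro sums_sum summand)
  also have "(\<lambda>k. \<Sum>h\<in>UNIV. if \<beta> i \<le> k \<and> \<beta> l \<le> k then z ^ (k - \<beta> i) * cnj w ^ (k - \<beta> l)
        * (of_real (kernel_coeff \<eta> k (\<beta> i) (\<beta> l) (\<beta> h)) * (path_coeff i h * cnj (path_coeff l h))) else 0)
     = (\<lambda>k. z ^ (k - \<beta> i) * coeff_mat \<eta> k $ i $ l * cnj w ^ (k - \<beta> l))"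
    by (auto simp: coeff_mat_def sum_distrib_left sum_distrib_right mult_ac intro!: ext sum.cong)
  finally show ?thesis .
qed

lemma summable_coeff_mat:
  assumes r: "0 \<le> r" "r < 1"
  shows "summable (\<lambda>k. norm (coeff_mat \<eta> k $ i $ l) * r ^ (2 * k))"
proof -
  obtain x where x: "r < x" "x < 1" using dense[OF r(2)] by blast
  let ?x = "of_real x :: complex"
  have x0: "x > 0" using r x by linarith
  have d: "?x \<in> unit_disc" using x x0 by simp
  have "summable (\<lambda>k. ?x ^ (k - \<beta> i) * coeff_mat \<eta> k $ i $ l * cnj ?x ^ (k - \<beta> l))"
    using kern_sums[OF d d] by (rule sums_summable)
  then have s: "summable (\<lambda>k. ?x ^ (k - \<beta> i) * coeff_mat \<eta> k $ i $ l * cnj ?x ^ (k - \<beta> l) * ?x ^ (\<beta> i + \<beta> l))"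
    by (rule summable_mult2)
  have "?x ^ (k - \<beta> i) * coeff_mat \<eta> k $ i $ l * cnj ?x ^ (k - \<beta> l) * ?x ^ (\<beta> i + \<beta> l)
      = coeff_mat \<eta> k $ i $ l * (?x\<^sup>2) ^ k" for k
  proof (cases "\<beta> i \<le> k \<and> \<beta> l \<le> k")
    case True
    then have e: "(k - \<beta> i) + (k - \<beta> l) + (\<beta> i + \<beta> l) = 2 * k" by simp
    have "?x ^ (k - \<beta> i) * ?x ^ (k - \<beta> l) * ?x ^ (\<beta> i + \<beta> l) = ?x ^ (2 * k)"
      by (simp only: e flip: power_add)
    then have "?x ^ (k - \<beta> i) * ?x ^ (k - \<beta> l) * ?x ^ (\<beta> i + \<beta> l) = (?x\<^sup>2) ^ k"
      by (simp only: power_mult)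
    moreover have "a * c * b * d = c * (a * b * d)" for a b c d :: complex by simp
    ultimately show ?thesis by (simp only: complex_cnj_complex_of_real)
  qed (auto simp: coeff_mat_def)
  with s have s': "summable (\<lambda>k. coeff_mat \<eta> k $ i $ l * (?x\<^sup>2) ^ k)" by (simp only:)
  have "norm ((of_real r)\<^sup>2 :: complex) < norm (?x\<^sup>2)"
    using r x by (simp add: norm_power power_strict_mono)
  then have "summable (\<lambda>k. norm (coeff_mat \<eta> k $ i $ l * ((of_real r)\<^sup>2) ^ k))"
    by (rule powser_insidea[OF s'])
  then show ?thesis using r by (simp add: norm_mult norm_power power_mult)
qed

text \<open>
  The block diagonal matrix that has \<open>I + Y\<^sub>j (\<Sum>k<j. \<dots>) Y\<^sub>j\<^sup>*\<close> as block \<open>j\<close>; the identity is the term with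
  \<open>\<beta> h = j\<close>.
\<close>

definition block_mat :: "real \<Rightarrow> complex^'n^'n" where
  "block_mat \<eta> = (\<chi> i l. if \<beta> i = \<beta> l then
     (\<Sum>h\<in>UNIV. of_real (inversion_coeff \<eta> (\<beta> i) (\<beta> h)) * (path_coeff i h * cnj (path_coeff l h))) else 0)"

text \<open>
  The adjoint of the map that the differential expressions belonging to \<^const>\<open>inversion_coeff\<close> induce on
  Taylor coefficients of weight \<open>k\<close>, up to the factor \<open>(k - j)!\<close> in block \<open>j\<close>.
\<close>

definition inversion_mat :: "real \<Rightarrow> nat \<Rightarrow> complex^'n^'n" where
  "inversion_mat \<eta> k = (\<chi> p j. if \<beta> p \<le> k \<and> \<beta> j \<le> k then
     of_real (fact (k - \<beta> p) * inversion_coeff \<eta> (\<beta> j) (\<beta> p)) * cnj (path_coeff j p) else 0)"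

lemma inversion_coeff_same [simp]: "inversion_coeff \<eta> j j = 1"
  by (simp add: inversion_coeff_def)

lemma block_mat_hermitian: "ctranspose (block_mat \<eta>) = block_mat \<eta>"
  by (auto simp: block_mat_def vec_eq_iff mult_ac intro!: sum.cong)

lemma inversion_mat_in_level: "inversion_mat \<eta> k *v x \<in> level k"
  by (simp add: level_def inversion_mat_def matrix_vector_mult_def)

text \<open>
  The matrix is triangular with nonzero diagonal, so the highest block of \<open>u\<close> cannot be annihilated.
\<close>

lemma inversion_mat_injective:
  assumes "u \<in> level k" "inversion_mat \<eta> k *v u = 0"
  shows "u = 0"
proof (rule ccontr)
  assume "u \<noteq> 0"
  then have "\<beta> ` {i. u $ i \<noteq> 0} \<noteq> {}" by (auto simp: vec_eq_iff)
  then have "Max (\<beta> ` {i. u $ i \<noteq> 0}) \<in> \<beta> ` {i. u $ i \<noteq> 0}" by (intro Max_in) auto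
  then obtain j where j1: "u $ j \<noteq> 0" "\<beta> j = Max (\<beta> ` {i. u $ i \<noteq> 0})" by auto
  then have j: "u $ j \<noteq> 0" "\<And>i. u $ i \<noteq> 0 \<Longrightarrow> \<beta> i \<le> \<beta> j" by auto
  have jk: "\<beta> j \<le> k" using assms(1) j(1) by (force simp: level_def not_le)
  have "inversion_mat \<eta> k $ j $ l * u $ l = (if l = j then fact (k - \<beta> j) * u $ j else 0)" for l
  proof (cases "u $ l = 0 \<or> \<beta> l < \<beta> j")
    case True
    then show ?thesis using j(1) by (auto simp: inversion_mat_def path_coeff_eq_0)
  next
    case False
    then have "\<beta> l = \<beta> j" using j(2)[of l] by auto
    then show ?thesis using jk by (auto simp: inversion_mat_def path_coeff_same_block)
  qed
  then have "(inversion_mat \<eta> k *v u) $ j = fact (k - \<beta> j) * u $ j"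
    by (simp add: matrix_vector_mult_def)
  then show False using assms(2) j(1) by simp
qed

text \<open>
  Adding the identity on the coordinates above level \<open>k\<close> makes \<open>A\<close> injective, hence surjective, on the whole
  space.
\<close>

lemma surjective_on_level:
  assumes inj: "\<And>u. u \<in> level k \<Longrightarrow> A *v u = 0 \<Longrightarrow> u = 0"
    and A: "\<And>i l. k < \<beta> i \<or> k < \<beta> l \<Longrightarrow> A $ i $ l = 0"
    and y: "y \<in> level k"
  shows "\<exists>u\<in>level k. A *v u = y"
proof -
  define D :: "complex^'n^'n" where "D = (\<chi> i l. if i = l \<and> k < \<beta> i then 1 else 0)"
  have D: "(D *v x) $ i = (if k < \<beta> i then x $ i else 0)" for x i
  proof -
    have "(\<Sum>l\<in>UNIV. D $ i $ l * x $ l) = (\<Sum>l\<in>UNIV. if l = i then (if k < \<beta> i then x $ i else 0) else 0)"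
      by (intro sum.cong) (auto simp: D_def)
    then show ?thesis by (simp add: matrix_vector_mult_def)
  qed
  have A0: "(A *v x) $ i = 0" if "k < \<beta> i" for x i using A that by (simp add: matrix_vector_mult_def)
  have *: "((A + D) *v x) $ i = x $ i" if "k < \<beta> i" for x i
    using that by (simp add: matrix_vector_mult_add_rdistrib A0 D)
  have **: "A *v x = (A + D) *v x" if "x \<in> level k" for x
    using that by (auto simp: matrix_vector_mult_add_rdistrib vec_eq_iff D level_def)
  have "x = 0" if "(A + D) *v x = 0" for x
  proof -
    have x: "x \<in> level k" using *[of _ x] unfolding that level_def by simp
    show "x = 0" using inj[OF x] **[OF x] that by simp
  qed
  then obtain u where u: "(A + D) *v u = y" using injective_imp_surjective_matrix by blast
  have "u \<in> level k" using *[of _ u] y unfolding u level_def by simp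
  then show ?thesis using ** u by metis
qed

text \<open>
  After summation over the coordinates in the middle, the scalar factors are the sums evaluated in
  \<open>sum_inversion_kernel_eq_0\<close> and \<open>sum_inversion_kernel_diagonal\<close>.
\<close>

lemma coeff_mat_mult_inversion_mat:
  assumes \<eta>: "\<eta> > 0" and p: "\<beta> p \<le> k" and j: "\<beta> j \<le> k"
  shows "\<beta> p < \<beta> j \<Longrightarrow> (coeff_mat \<eta> k ** inversion_mat \<eta> k) $ p $ j = 0"
    and "\<beta> p = \<beta> j \<Longrightarrow> (coeff_mat \<eta> k ** inversion_mat \<eta> k) $ p $ j
          = of_real (pochhammer (2 * \<eta> + 2 * real (\<beta> j)) (k - \<beta> j)) * block_mat \<eta> $ p $ j"
proof -
  define s where "s h = (\<Sum>q\<in>{\<beta> h..\<beta> j}. fact (k - q) * inversion_coeff \<eta> (\<beta> j) q * kernel_coeff \<eta> k (\<beta> p) q (\<beta> h))" for h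
  have "(coeff_mat \<eta> k ** inversion_mat \<eta> k) $ p $ j
      = (\<Sum>q\<in>UNIV. \<Sum>h\<in>UNIV. path_coeff p h * (of_real (fact (k - \<beta> q) * inversion_coeff \<eta> (\<beta> j) (\<beta> q) * kernel_coeff \<eta> k (\<beta> p) (\<beta> q) (\<beta> h))
            * cnj (path_coeff j q * path_coeff q h)))"
    unfolding matrix_matrix_mult_def vec_lambda_beta
  proof (intro sum.cong refl)
    fix q
    show "coeff_mat \<eta> k $ p $ q * inversion_mat \<eta> k $ q $ j
      = (\<Sum>h\<in>UNIV. path_coeff p h * (of_real (fact (k - \<beta> q) * inversion_coeff \<eta> (\<beta> j) (\<beta> q) * kernel_coeff \<eta> k (\<beta> p) (\<beta> q) (\<beta> h))
            * cnj (path_coeff j q * path_coeff q h)))"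
    proof (cases "\<beta> q \<le> \<beta> j")
      case True
      then show ?thesis using p j
        by (simp add: coeff_mat_def inversion_mat_def sum_distrib_right sum_distrib_left mult_ac)
    qed (simp add: inversion_mat_def path_coeff_eq_0)
  qed
  also have "\<dots> = (\<Sum>h\<in>UNIV. path_coeff p h * cnj (\<Sum>q\<in>UNIV. of_real (fact (k - \<beta> q) * inversion_coeff \<eta> (\<beta> j) (\<beta> q) * kernel_coeff \<eta> k (\<beta> p) (\<beta> q) (\<beta> h))
            * (path_coeff j q * path_coeff q h)))"
    by (subst sum.swap) (simp add: sum_distrib_left)
  also have "\<dots> = (\<Sum>h\<in>UNIV. path_coeff p h * cnj ((\<Sum>q\<in>{\<beta> h..\<beta> j}. of_real (fact (k - q) * inversion_coeff \<eta> (\<beta> j) q * kernel_coeff \<eta> k (\<beta> p) q (\<beta> h))) * path_coeff j h))"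
    by (intro sum.cong refl arg_cong2[where f = "(*)"] arg_cong[where f = cnj] sum_path_coeff)
  also have "\<dots> = (\<Sum>h\<in>UNIV. of_real (s h) * (path_coeff p h * cnj (path_coeff j h)))"
    unfolding s_def by (simp add: mult_ac)
  finally have main: "(coeff_mat \<eta> k ** inversion_mat \<eta> k) $ p $ j
     = (\<Sum>h\<in>UNIV. of_real (s h) * (path_coeff p h * cnj (path_coeff j h)))" .
  show "(coeff_mat \<eta> k ** inversion_mat \<eta> k) $ p $ j = 0" if "\<beta> p < \<beta> j"
    unfolding main
  proof (intro sum.neutral ballI)
    fix h
    show "of_real (s h) * (path_coeff p h * cnj (path_coeff j h)) = 0"
    proof (cases "\<beta> h \<le> \<beta> p")
      case True
      then have "s h = 0" unfolding s_def using that j \<eta> by (intro sum_inversion_kernel_eq_0) auto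
      then show ?thesis by simp
    qed (simp add: path_coeff_eq_0)
  qed
  show "(coeff_mat \<eta> k ** inversion_mat \<eta> k) $ p $ j
          = of_real (pochhammer (2 * \<eta> + 2 * real (\<beta> j)) (k - \<beta> j)) * block_mat \<eta> $ p $ j" if eq: "\<beta> p = \<beta> j"
  proof -
    have star: "of_real (s h) * (path_coeff p h * cnj (path_coeff j h)) = of_real (pochhammer (2 * \<eta> + 2 * real (\<beta> j)) (k - \<beta> j))
        * (of_real (inversion_coeff \<eta> (\<beta> p) (\<beta> h)) * (path_coeff p h * cnj (path_coeff j h)))" for h
    proof (cases "\<beta> h \<le> \<beta> p")
      case True
      then have "s h = pochhammer (2 * \<eta> + 2 * real (\<beta> j)) (k - \<beta> j) * inversion_coeff \<eta> (\<beta> p) (\<beta> h)"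
        unfolding s_def eq using eq j \<eta> by (intro sum_inversion_kernel_diagonal) auto
      then show ?thesis by simp
    qed (simp add: path_coeff_eq_0)
    show ?thesis unfolding main star by (simp add: block_mat_def eq sum_distrib_left)
  qed
qed

text \<open>
  This links the kernel to the positivity condition. The product of the two factors on the right is
  block lower triangular by the vanishing sums, and so is the product of all three. As it is Hermitian, it is
  block diagonal.
\<close>

lemma coeff_mat_congruence:
  assumes \<eta>: "\<eta> > 0"
  shows "(ctranspose (inversion_mat \<eta> k) ** (coeff_mat \<eta> k ** inversion_mat \<eta> k)) $ j $ l
    = (if \<beta> j \<le> k then of_real (fact (k - \<beta> j) * pochhammer (2 * \<eta> + 2 * real (\<beta> j)) (k - \<beta> j))
          * block_mat \<eta> $ j $ l else 0)"
proof -
  let ?G = "ctranspose (inversion_mat \<eta> k) ** (coeff_mat \<eta> k ** inversion_mat \<eta> k)"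
  have herm: "?G $ j $ l = cnj (?G $ l $ j)" for j l
  proof -
    have "ctranspose ?G = ?G" by (simp add: ctranspose_matrix_mul coeff_mat_hermitian matrix_mul_assoc)
    then show ?thesis by (metis ctranspose_nth)
  qed
  have G: "?G $ j $ l = (\<Sum>p\<in>UNIV. cnj (inversion_mat \<eta> k $ p $ j) * (coeff_mat \<eta> k ** inversion_mat \<eta> k) $ p $ l)" for j l
    by (simp add: matrix_matrix_mult_def)
  have less: "?G $ j $ l = 0" if "\<beta> j < \<beta> l" for j l
    unfolding G
  proof (intro sum.neutral ballI)
    fix p
    show "cnj (inversion_mat \<eta> k $ p $ j) * (coeff_mat \<eta> k ** inversion_mat \<eta> k) $ p $ l = 0"
    proof (cases "\<beta> p \<le> \<beta> j \<and> \<beta> p \<le> k \<and> \<beta> l \<le> k")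
      case True
      then show ?thesis using coeff_mat_mult_inversion_mat(1)[OF \<eta>, of p k l] that by simp
    next
      case False
      then show ?thesis by (auto simp: inversion_mat_def path_coeff_eq_0 matrix_matrix_mult_def)
    qed
  qed
  show ?thesis
  proof (cases "\<beta> j = \<beta> l")
    case eq: True
    show ?thesis
    proof (cases "\<beta> j \<le> k")
      case True
      have "cnj (inversion_mat \<eta> k $ p $ j) * (coeff_mat \<eta> k ** inversion_mat \<eta> k) $ p $ l
          = (if p = j then of_real (fact (k - \<beta> j)) * (coeff_mat \<eta> k ** inversion_mat \<eta> k) $ j $ l else 0)" for p
      proof (cases "\<beta> p < \<beta> l")
        case True
        then show ?thesis using coeff_mat_mult_inversion_mat(1)[OF \<eta>, of p k l] \<open>\<beta> j \<le> k\<close> eq by auto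
      next
        case False
        then show ?thesis using True eq
          by (cases "\<beta> p = \<beta> l") (auto simp: inversion_mat_def path_coeff_same_block path_coeff_eq_0)
      qed
      then have "?G $ j $ l = of_real (fact (k - \<beta> j)) * (coeff_mat \<eta> k ** inversion_mat \<eta> k) $ j $ l"
        unfolding G by simp
      then show ?thesis using True eq coeff_mat_mult_inversion_mat(2)[OF \<eta>, of j k l] by simp
    next
      case False
      then have "inversion_mat \<eta> k $ p $ j = 0" for p by (simp add: inversion_mat_def)
      then show ?thesis unfolding G using False by simp
    qed
  next
    case False
    then have "block_mat \<eta> $ j $ l = 0" by (simp add: block_mat_def)
    moreover have "?G $ j $ l = 0" using less[of j l] less[of l j] herm[of j l] False by (cases "\<beta> j < \<beta> l") auto
    ultimately show ?thesis by simp
  qed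
qed

lemma cinner_coeff_mat_inversion_mat:
  "cinner (coeff_mat \<eta> k *v (inversion_mat \<eta> k *v u)) (inversion_mat \<eta> k *v u)
     = cinner ((ctranspose (inversion_mat \<eta> k) ** (coeff_mat \<eta> k ** inversion_mat \<eta> k)) *v u) u"
proof -
  have "cinner ((ctranspose (inversion_mat \<eta> k) ** (coeff_mat \<eta> k ** inversion_mat \<eta> k)) *v u) u
     = cinner (ctranspose (inversion_mat \<eta> k) *v (coeff_mat \<eta> k *v (inversion_mat \<eta> k *v u))) u"
    by (simp add: matrix_vector_mul_assoc matrix_mul_assoc)
  then show ?thesis by (simp add: cinner_ctranspose[of "ctranspose (inversion_mat \<eta> k)"])
qed

lemma coeff_mat_positive:
  assumes \<eta>: "\<eta> > 0" and N: "positive_definite (block_mat \<eta>)"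
    and y: "y \<in> level k" "y \<noteq> 0"
  shows "0 < Re (cinner (coeff_mat \<eta> k *v y) y)"
proof -
  have "\<exists>u\<in>level k. inversion_mat \<eta> k *v u = y"
    by (rule surjective_on_level[OF inversion_mat_injective _ y(1)]) (auto simp: inversion_mat_def)
  then obtain u where u: "u \<in> level k" "y = inversion_mat \<eta> k *v u" by blast
  define \<omega> where "\<omega> j = fact (k - j) * pochhammer (2 * \<eta> + 2 * real j) (k - j)" for j
  have \<omega>: "\<omega> j > 0" for j unfolding \<omega>_def using \<eta> by (intro mult_pos_pos pochhammer_pos) auto
  \<comment> \<open>The positive factors are constant on blocks and can be absorbed into the vector.\<close>
  define v :: "complex^'n" where "v = (\<chi> i. of_real (sqrt (\<omega> (\<beta> i))) * u $ i)"
  have "cinner ((ctranspose (inversion_mat \<eta> k) ** (coeff_mat \<eta> k ** inversion_mat \<eta> k)) *v u) u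
      = cinner (block_mat \<eta> *v v) v"
    unfolding cinner_mult
  proof (intro sum.cong refl)
    fix i l
    have "of_real (sqrt (\<omega> (\<beta> i))) * of_real (sqrt (\<omega> (\<beta> i))) = (of_real (\<omega> (\<beta> i)) :: complex)"
      using \<omega>[of "\<beta> i"] by (simp flip: of_real_mult)
    then have "block_mat \<eta> $ i $ l * v $ l * cnj (v $ i) = of_real (\<omega> (\<beta> i)) * block_mat \<eta> $ i $ l * u $ l * cnj (u $ i)"
      by (cases "\<beta> i = \<beta> l") (simp_all add: v_def block_mat_def mult_ac)
    then have eq: "of_real (\<omega> (\<beta> i)) * block_mat \<eta> $ i $ l * u $ l * cnj (u $ i) = block_mat \<eta> $ i $ l * v $ l * cnj (v $ i)" ..
    show "(ctranspose (inversion_mat \<eta> k) ** (coeff_mat \<eta> k ** inversion_mat \<eta> k)) $ i $ l * u $ l * cnj (u $ i)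
       = block_mat \<eta> $ i $ l * v $ l * cnj (v $ i)"
    proof (cases "\<beta> i \<le> k")
      case True
      then show ?thesis using eq by (simp only: coeff_mat_congruence[OF \<eta>] \<omega>_def if_True)
    next
      case False
      then have "u $ i = 0" using u(1) by (simp add: level_def)
      then show ?thesis by (simp add: v_def)
    qed
  qed
  then have "cinner (coeff_mat \<eta> k *v y) y = cinner (block_mat \<eta> *v v) v"
    unfolding u(2) cinner_coeff_mat_inversion_mat .
  moreover have "v \<noteq> 0"
  proof
    assume "v = 0"
    then have "of_real (sqrt (\<omega> (\<beta> i))) * u $ i = 0" for i by (simp add: v_def vec_eq_iff)
    moreover have "\<omega> (\<beta> i) \<noteq> 0" for i using \<omega>[of "\<beta> i"] by simp
    ultimately have "u = 0" by (simp add: vec_eq_iff)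
    then show False using u y by simp
  qed
  ultimately show ?thesis using N by (simp add: positive_definite_def)
qed

definition block_part :: "nat \<Rightarrow> complex^'n \<Rightarrow> complex^'n" where
  "block_part j x = (\<chi> i. if \<beta> i = j then x $ i else 0)"

text \<open>
  For weight \<open>k = j\<close> the scalar factor of block \<open>j\<close> in \<open>coeff_mat_congruence\<close> is 1, so that this block of
  \<^const>\<open>block_mat\<close> can be read off.
\<close>

lemma cinner_block_mat_block_part:
  assumes \<eta>: "\<eta> > 0"
  shows "cinner (coeff_mat \<eta> j *v (inversion_mat \<eta> j *v block_part j x)) (inversion_mat \<eta> j *v block_part j x)
       = cinner (block_mat \<eta> *v block_part j x) (block_part j x)"
proof -
  have "cinner ((ctranspose (inversion_mat \<eta> j) ** (coeff_mat \<eta> j ** inversion_mat \<eta> j)) *v block_part j x) (block_part j x)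
      = cinner (block_mat \<eta> *v block_part j x) (block_part j x)"
    unfolding cinner_mult coeff_mat_congruence[OF \<eta>]
    by (intro sum.cong refl) (auto simp: block_part_def)
  then show ?thesis by (simp only: cinner_coeff_mat_inversion_mat)
qed

lemma Yprod_support:
  "k < j \<Longrightarrow> Yprod \<beta> Y j k $ i $ h \<noteq> 0 \<Longrightarrow> \<beta> i = j \<and> \<beta> h = k"
proof (induction j arbitrary: i)
  case (Suc j)
  then have "(\<Sum>l\<in>UNIV. Yblock \<beta> Y (Suc j) $ i $ l * Yprod \<beta> Y j k $ l $ h) \<noteq> 0"
    by (simp add: matrix_matrix_mult_def)
  then obtain l where l: "Yblock \<beta> Y (Suc j) $ i $ l * Yprod \<beta> Y j k $ l $ h \<noteq> 0"
    by (meson sum.not_neutral_contains_not_neutral)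
  then have 1: "\<beta> i = Suc j" "\<beta> l = j" by (auto simp: Yblock_def split: if_splits)
  show ?case
  proof (cases "k = j")
    case True
    have "Yprod \<beta> Y j j = mat 1" by (cases j) simp_all
    then show ?thesis using l 1 True by (auto simp: mat_def split: if_splits)
  next
    case False
    then show ?thesis using Suc.IH[of l] Suc.prems l 1 by simp
  qed
qed simp

lemma Yprod_nth:
  assumes "k < j"
  shows "Yprod \<beta> Y j k $ i $ h = (if \<beta> i = j \<and> \<beta> h = k then path_coeff i h else 0)"
  using Yprod_support[OF assms, of i h] Yprod_eq_matrix_power[of k j i h] assms by (auto simp: path_coeff_def)

lemma block_condition_iff:
  assumes j: "j \<ge> 1"
  shows "block_condition \<beta> \<eta> Y j \<longleftrightarrow>
    positive_definite (\<chi> i l. if \<beta> i = j \<and> \<beta> l = j then block_mat \<eta> $ i $ l else if i = l then 1 else 0)"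
proof -
  obtain j' where j': "j = Suc j'" using j by (cases j) auto
  let ?c = "\<lambda>k. inversion_coeff \<eta> j k"
  have c: "(-1) ^ (j + k) / (fact (j - k) * pochhammer (2 * \<eta> + real j + real k - 1) (j - k)) = ?c k" for k
    by (simp add: inversion_coeff_def)
  let ?S = "\<Sum>k<j. ?c k *\<^sub>R (Yprod \<beta> Y (j - 1) k ** ctranspose (Yprod \<beta> Y (j - 1) k))"
  have prod: "Yblock \<beta> Y j ** Yprod \<beta> Y (j - 1) k = Yprod \<beta> Y j k" if "k < j" for k
    using that by (simp add: j')
  have scale: "A ** (r *\<^sub>R B) = r *\<^sub>R (A ** B)" "(r *\<^sub>R B) ** A = r *\<^sub>R (B ** A)" for r and A B :: "complex^'n^'n"
    by (simp_all add: vec_eq_iff matrix_matrix_mult_def scaleR_sum_right)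
  have dist: "A ** (\<Sum>k<j. f k) = (\<Sum>k<j. A ** f k)" "(\<Sum>k<j. f k) ** A = (\<Sum>k<j. f k ** A)"
    for A :: "complex^'n^'n" and f :: "nat \<Rightarrow> complex^'n^'n"
    by (auto simp: vec_eq_iff matrix_matrix_mult_def sum_distrib_left sum_distrib_right intro: sum.swap)
  have "Yblock \<beta> Y j ** ?S ** ctranspose (Yblock \<beta> Y j)
      = (\<Sum>k<j. ?c k *\<^sub>R (Yprod \<beta> Y j k ** ctranspose (Yprod \<beta> Y j k)))"
    unfolding dist scale
  proof (intro sum.cong refl arg_cong[where f = "(*\<^sub>R) _"])
    fix k assume "k \<in> {..<j}"
    then have P: "Yprod \<beta> Y j k = Yblock \<beta> Y j ** Yprod \<beta> Y (j - 1) k" using prod by simp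
    show "Yblock \<beta> Y j ** (Yprod \<beta> Y (j - 1) k ** ctranspose (Yprod \<beta> Y (j - 1) k)) ** ctranspose (Yblock \<beta> Y j)
       = Yprod \<beta> Y j k ** ctranspose (Yprod \<beta> Y j k)"
      unfolding P ctranspose_matrix_mul by (simp add: matrix_mul_assoc)
  qed
  moreover have "(mat 1 + (\<Sum>k<j. ?c k *\<^sub>R (Yprod \<beta> Y j k ** ctranspose (Yprod \<beta> Y j k)))) $ i $ l
      = (if \<beta> i = j \<and> \<beta> l = j then block_mat \<eta> $ i $ l else if i = l then 1 else 0)" for i l
  proof -
    have "(\<Sum>k<j. ?c k *\<^sub>R (Yprod \<beta> Y j k ** ctranspose (Yprod \<beta> Y j k))) $ i $ l
        = (\<Sum>k<j. \<Sum>h\<in>UNIV. of_real (?c k) * (Yprod \<beta> Y j k $ i $ h * cnj (Yprod \<beta> Y j k $ l $ h)))"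
      by (simp add: matrix_matrix_mult_def scaleR_conv_of_real[where 'a = complex] sum_distrib_left)
    also have "\<dots> = (\<Sum>h\<in>UNIV. \<Sum>k<j. if k = \<beta> h then
         (if \<beta> i = j \<and> \<beta> l = j then of_real (?c (\<beta> h)) * (path_coeff i h * cnj (path_coeff l h)) else 0) else 0)"
      by (subst sum.swap) (auto simp: Yprod_nth intro!: sum.cong)
    also have "\<dots> = (\<Sum>h\<in>UNIV. if \<beta> h < j \<and> \<beta> i = j \<and> \<beta> l = j then of_real (?c (\<beta> h)) * (path_coeff i h * cnj (path_coeff l h)) else 0)"
      by (intro sum.cong) auto
    finally have S: "(\<Sum>k<j. ?c k *\<^sub>R (Yprod \<beta> Y j k ** ctranspose (Yprod \<beta> Y j k))) $ i $ l = \<dots>" .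
    show ?thesis
    proof (cases "\<beta> i = j \<and> \<beta> l = j")
      case True
      have "block_mat \<eta> $ i $ l = (\<Sum>h\<in>UNIV. (if \<beta> h < j then of_real (?c (\<beta> h)) * (path_coeff i h * cnj (path_coeff l h)) else 0)
          + (if h = i then if i = l then 1 else 0 else 0))"
      proof -
        have "of_real (inversion_coeff \<eta> (\<beta> i) (\<beta> h)) * (path_coeff i h * cnj (path_coeff l h))
          = (if \<beta> h < j then of_real (?c (\<beta> h)) * (path_coeff i h * cnj (path_coeff l h)) else 0)
          + (if h = i then if i = l then 1 else 0 else 0)" for h
          using True path_coeff_same_block[of i h] path_coeff_same_block[of l h] path_coeff_eq_0[of i h]
          by (cases "\<beta> h" j rule: linorder_cases) auto
        then show ?thesis using True by (simp add: block_mat_def)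
      qed
      also have "\<dots> = (\<Sum>h\<in>UNIV. if \<beta> h < j then of_real (?c (\<beta> h)) * (path_coeff i h * cnj (path_coeff l h)) else 0) + (if i = l then 1 else 0)"
        by (simp add: sum.distrib)
      finally show ?thesis using True S by (simp add: mat_def)
    next
      case False
      then have "(\<Sum>h\<in>UNIV. if \<beta> h < j \<and> \<beta> i = j \<and> \<beta> l = j then of_real (?c (\<beta> h)) * (path_coeff i h * cnj (path_coeff l h)) else 0) = 0"
        by (intro sum.neutral) auto
      then show ?thesis using False S by (auto simp: mat_def)
    qed
  qed
  ultimately have "mat 1 + Yblock \<beta> Y j ** ?S ** ctranspose (Yblock \<beta> Y j)
      = (\<chi> i l. if \<beta> i = j \<and> \<beta> l = j then block_mat \<eta> $ i $ l else if i = l then 1 else 0)"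
    by (simp add: vec_eq_iff)
  then show ?thesis unfolding block_condition_def c by simp
qed

text \<open>
  Block 0 of \<^const>\<open>block_mat\<close> is the identity, which accounts for the range of \<open>j\<close> on the left.
\<close>

lemma block_conditions_iff:
  assumes m: "range \<beta> = {0..m}"
  shows "(\<forall>j\<in>{1..m}. block_condition \<beta> \<eta> Y j) \<longleftrightarrow>
    (\<forall>j x. block_part j x \<noteq> 0 \<longrightarrow> 0 < Re (cinner (block_mat \<eta> *v block_part j x) (block_part j x)))"
    (is "?L \<longleftrightarrow> ?R")
proof -
  let ?B = "\<lambda>j. (\<chi> i l. if \<beta> i = j \<and> \<beta> l = j then block_mat \<eta> $ i $ l else if i = l then 1 else 0) :: complex^'n^'n"
  have herm: "ctranspose (?B j) = ?B j" for j
  proof -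
    have "cnj (block_mat \<eta> $ l $ i) = block_mat \<eta> $ i $ l" for i l
      using block_mat_hermitian[of \<eta>] by (metis ctranspose_nth)
    then show ?thesis by (auto simp: vec_eq_iff)
  qed
  have B: "cinner (?B j *v x) x = cinner (block_mat \<eta> *v block_part j x) (block_part j x)
      + of_real ((norm (x - block_part j x))\<^sup>2)" for j x
  proof -
    have "cinner (?B j *v x) x = (\<Sum>i\<in>UNIV. \<Sum>l\<in>UNIV. block_mat \<eta> $ i $ l * block_part j x $ l * cnj (block_part j x $ i)
       + (if l = i then (if \<beta> i = j then 0 else x $ i * cnj (x $ i)) else 0))"
      unfolding cinner_mult by (intro sum.cong refl) (auto simp: block_part_def)
    also have "\<dots> = cinner (block_mat \<eta> *v block_part j x) (block_part j x)
        + (\<Sum>i\<in>UNIV. (if \<beta> i = j then 0 else x $ i * cnj (x $ i)))"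
      by (simp add: cinner_mult sum.distrib)
    also have "(\<Sum>i\<in>UNIV. (if \<beta> i = j then 0 else x $ i * cnj (x $ i))) = cinner (x - block_part j x) (x - block_part j x)"
      unfolding cinner_def by (intro sum.cong) (auto simp: block_part_def)
    finally show ?thesis by (simp only: cinner_self)
  qed
  have idem: "block_part j (block_part j x) = block_part j x" for j x
    by (auto simp: block_part_def vec_eq_iff)
  have zero: "0 < Re (cinner (block_mat \<eta> *v block_part 0 x) (block_part 0 x))" if "block_part 0 x \<noteq> 0" for x
  proof -
    have "block_mat \<eta> $ i $ l = (if i = l then 1 else 0)" if "\<beta> i = 0" "\<beta> l = 0" for i l
    proof -
      have p: "path_coeff i h = (if i = h then 1 else 0)" if "\<beta> i = 0" for i h
        using that by (cases "\<beta> h = 0") (auto simp: path_coeff_same_block path_coeff_eq_0)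
      have "block_mat \<eta> $ i $ l = (\<Sum>h\<in>UNIV. of_real (inversion_coeff \<eta> (\<beta> i) (\<beta> h)) * (path_coeff i h * cnj (path_coeff l h)))"
        using that by (simp add: block_mat_def)
      also have "\<dots> = (\<Sum>h\<in>UNIV. if h = i then if i = l then 1 else 0 else 0)"
        by (intro sum.cong) (auto simp: p that)
      finally have "block_mat \<eta> $ i $ l = (\<Sum>h\<in>UNIV. if h = i then if i = l then 1 else 0 else 0)" .
      then show ?thesis by simp
    qed
    then have "block_mat \<eta> $ i $ l * block_part 0 x $ l = (if l = i then block_part 0 x $ i else 0)" if "\<beta> i = 0" for i l
      using that by (auto simp: block_part_def)
    then have "(block_mat \<eta> *v block_part 0 x) $ i = block_part 0 x $ i" if "\<beta> i = 0" for i
      using that by (simp add: matrix_vector_mult_def)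
    then have "cinner (block_mat \<eta> *v block_part 0 x) (block_part 0 x) = cinner (block_part 0 x) (block_part 0 x)"
      unfolding cinner_def by (intro sum.cong refl) (auto simp: block_part_def)
    then show ?thesis using that by (simp add: cinner_self)
  qed
  show ?thesis
  proof
    assume L: ?L
    show ?R
    proof (intro allI impI)
      fix j x assume nz: "block_part j x \<noteq> 0"
      then obtain i where "\<beta> i = j" by (auto simp: block_part_def vec_eq_iff split: if_splits)
      then have jm: "j \<le> m" using m by auto
      show "0 < Re (cinner (block_mat \<eta> *v block_part j x) (block_part j x))"
      proof (cases "j = 0")
        case False
        then have "j \<in> {1..m}" using jm by simp
        then have "block_condition \<beta> \<eta> Y j" using L by blast
        then have "positive_definite (?B j)" using block_condition_iff[of j \<eta>] False by simp
        then have "0 < Re (cinner (?B j *v block_part j x) (block_part j x))"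
          using nz by (simp add: positive_definite_def)
        then show ?thesis unfolding B idem by simp
      qed (use zero nz in simp)
    qed
  next
    assume R: ?R
    show ?L
    proof
      fix j assume "j \<in> {1..m}"
      then have j: "j \<ge> 1" by simp
      have "0 < Re (cinner (?B j *v x) x)" if "x \<noteq> 0" for x
      proof (cases "block_part j x = 0")
        case True
        then show ?thesis unfolding B using that by simp
      next
        case False
        then have "0 < Re (cinner (block_mat \<eta> *v block_part j x) (block_part j x))" using R by blast
        then show ?thesis unfolding B by (simp add: add_pos_nonneg)
      qed
      then show "block_condition \<beta> \<eta> Y j"
        unfolding block_condition_iff[OF j] positive_definite_def using herm by blast
    qed
  qed
qed

lemma block_mat_positive_definite:
  assumes "\<And>j x. block_part j x \<noteq> 0 \<Longrightarrow> 0 < Re (cinner (block_mat \<eta> *v block_part j x) (block_part j x))"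
  shows "positive_definite (block_mat \<eta>)"
  unfolding positive_definite_def
proof (intro conjI block_mat_hermitian allI impI)
  fix x :: "complex^'n" assume x: "x \<noteq> 0"
  let ?q = "\<lambda>j. cinner (block_mat \<eta> *v block_part j x) (block_part j x)"
  have "(\<Sum>j\<in>range \<beta>. block_mat \<eta> $ i $ l * block_part j x $ l * cnj (block_part j x $ i))
      = block_mat \<eta> $ i $ l * x $ l * cnj (x $ i)" for i l
  proof -
    have "(\<Sum>j\<in>range \<beta>. block_mat \<eta> $ i $ l * block_part j x $ l * cnj (block_part j x $ i))
        = (\<Sum>j\<in>range \<beta>. if j = \<beta> i then block_mat \<eta> $ i $ l * x $ l * cnj (x $ i) else 0)"
      by (intro sum.cong) (auto simp: block_part_def block_mat_def)
    then show ?thesis by simp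
  qed
  then have sum: "(\<Sum>j\<in>range \<beta>. ?q j) = cinner (block_mat \<eta> *v x) x"
    unfolding cinner_mult by (subst sum.swap, intro sum.cong refl, subst sum.swap) simp
  obtain i where i: "x $ i \<noteq> 0" using x by (auto simp: vec_eq_iff)
  then have "block_part (\<beta> i) x \<noteq> 0" by (auto simp: block_part_def vec_eq_iff)
  then have "0 < Re (?q (\<beta> i))" by (rule assms)
  moreover have "0 \<le> Re (?q j)" for j using assms[of j x] by (cases "block_part j x = 0") auto
  ultimately have "0 < (\<Sum>j\<in>range \<beta>. Re (?q j))"
    by (intro sum_pos2[of _ "\<beta> i"]) auto
  then show "0 < Re (cinner (block_mat \<eta> *v x) x)" by (simp flip: sum)
qed

end

section \<open>Taylor coefficients of sections\<close>

definition taylor_coeff :: "(complex \<Rightarrow> complex) \<Rightarrow> nat \<Rightarrow> complex" where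
  "taylor_coeff f n = (deriv ^^ n) f 0 / fact n"

lemma taylor_coeff_sums:
  "f holomorphic_on unit_disc \<Longrightarrow> z \<in> unit_disc \<Longrightarrow> (\<lambda>n. taylor_coeff f n * z ^ n) sums f z"
  using holomorphic_power_series[of f 0 1 z] by (simp add: taylor_coeff_def)

lemma taylor_coeff_eqI:
  assumes a: "\<And>z. z \<in> unit_disc \<Longrightarrow> (\<lambda>n. a n * z ^ n) sums f z"
  shows "taylor_coeff f = a"
proof
  fix n
  have hol: "f holomorphic_on unit_disc"
    by (rule power_series_holomorphic[where a = a]) (simp add: a)
  define b where "b n = taylor_coeff f n - a n" for n
  have b: "(\<lambda>n. b n * z ^ n) sums 0" if "z \<in> unit_disc" for z
    using sums_diff[OF taylor_coeff_sums[OF hol that] a[OF that]]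
    by (simp add: b_def left_diff_distrib)
  have "b n = 0"
  proof (cases "n = 0")
    case True
    have "b 0 = 0" by (rule sums_unique2[OF powser_sums_zero b]) simp
    then show ?thesis using True by simp
  next
    case False
    show ?thesis
    proof (rule ccontr)
      assume bn: "b n \<noteq> 0"
      show False
      proof (rule powser_0_nonzero[of 1 0 b "\<lambda>x. 0 :: complex" n])
        show "(\<lambda>n. b n * (x - 0) ^ n) sums 0" if "norm (x - 0) < 1" for x
          using b[of x] that by simp
        fix s :: real assume s: "0 < s" "\<And>z. z \<in> cball 0 s - {0 :: complex} \<Longrightarrow> (0 :: complex) \<noteq> 0"
        show False using s(1) s(2)[of "of_real s"] by simp
      qed (use bn False in auto)
    qed
  qed
  then show "taylor_coeff f n = a n" by (simp add: b_def)
qed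

lemma roots_of_unity_orthogonal:
  fixes M p q :: nat
  assumes "p < M" "q < M"
  defines "\<omega> \<equiv> cis (2 * pi / real M)"
  shows "(\<Sum>a<M. cnj (\<omega> ^ a) ^ p * (\<omega> ^ a) ^ q) = (if p = q then of_nat M else 0)"
proof -
  define \<rho> where "\<rho> = cnj \<omega> ^ p * \<omega> ^ q"
  have M: "M > 0" using assms by simp
  have \<omega>: "cnj \<omega> * \<omega> = 1" unfolding \<omega>_def by (simp add: cis_cnj cis_mult)
  have "cnj (\<omega> ^ a) ^ p * (\<omega> ^ a) ^ q = \<rho> ^ a" for a
    by (simp add: \<rho>_def power_mult_distrib mult.commute flip: power_mult)
  then have S: "(\<Sum>a<M. cnj (\<omega> ^ a) ^ p * (\<omega> ^ a) ^ q) = (\<Sum>a<M. \<rho> ^ a)" by simp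
  show ?thesis
  proof (cases "p = q")
    case True
    then have "\<rho> = (cnj \<omega> * \<omega>) ^ p" by (simp add: \<rho>_def power_mult_distrib)
    then show ?thesis using True S \<omega> by simp
  next
    case False
    have pw: "\<omega> ^ k = cis (2 * pi * real k / real M)" for k
      unfolding \<omega>_def Complex.DeMoivre by (simp add: mult_ac)
    have "\<omega> ^ p \<noteq> \<omega> ^ q"
      using Complex.bij_betw_roots_unity[OF M] assms(1,2) False unfolding pw bij_betw_def inj_on_def by auto
    moreover have "\<omega> ^ p * \<rho> = (cnj \<omega> * \<omega>) ^ p * \<omega> ^ q" by (simp add: \<rho>_def power_mult_distrib)
    ultimately have \<rho>: "\<rho> \<noteq> 1" using \<omega> by auto
    have "\<omega> ^ M = 1" using M by (simp add: pw)
    moreover have "\<rho> ^ M = cnj (\<omega> ^ M) ^ p * (\<omega> ^ M) ^ q"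
      by (simp add: \<rho>_def power_mult_distrib mult.commute flip: power_mult)
    ultimately have "\<rho> ^ M = 1" by simp
    then show ?thesis using S False \<rho> by (simp add: geometric_sum)
  qed
qed

context graded_matrix
begin

text \<open>
  The Taylor coefficients of weight \<open>k\<close> under rotations.
\<close>

definition taylor_vec :: "(complex \<Rightarrow> complex^'n) \<Rightarrow> nat \<Rightarrow> complex^'n" where
  "taylor_vec f k = (\<chi> i. if \<beta> i \<le> k then taylor_coeff (\<lambda>z. f z $ i) (k - \<beta> i) else 0)"

lemma taylor_vec_in_level: "taylor_vec f k \<in> level k"
  by (simp add: taylor_vec_def level_def)

lemma taylor_vec_sums:
  assumes f: "f \<in> holomorphic_sections" and z: "z \<in> unit_disc"
  shows "(\<lambda>k. epow k z (taylor_vec f k) $ i) sums f z $ i"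
proof -
  have "(\<lambda>n. taylor_coeff (\<lambda>z. f z $ i) n * z ^ n) sums f z $ i"
    using f z by (intro taylor_coeff_sums) (auto simp: holomorphic_sections_def)
  then have "(\<lambda>n. epow (n + \<beta> i) z (taylor_vec f (n + \<beta> i)) $ i) sums f z $ i"
    by (simp add: epow_def taylor_vec_def mult.commute)
  then show ?thesis by (subst (asm) sums_zero_iff_shift) (auto simp: epow_def)
qed

lemma cinner_taylor_vec_sums:
  assumes f: "f \<in> holomorphic_sections" and z: "z \<in> unit_disc"
  shows "(\<lambda>k. cinner (taylor_vec f k) (epow k (cnj z) y)) sums cinner (f z) y"
proof -
  have "(\<lambda>k. cinner (epow k z (taylor_vec f k)) y) sums cinner (f z) y"
    unfolding cinner_def by (intro sums_sum sums_mult2 taylor_vec_sums[OF f z])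
  then show ?thesis by (simp add: cinner_epow)
qed

lemma taylor_vec_eqI:
  assumes f: "\<And>z i. z \<in> unit_disc \<Longrightarrow> (\<lambda>k. epow k z (x k) $ i) sums f z $ i"
    and x: "\<And>k. x k \<in> level k"
  shows "taylor_vec f = x"
proof -
  have "taylor_coeff (\<lambda>z. f z $ i) = (\<lambda>n. x (n + \<beta> i) $ i)" for i
  proof (rule taylor_coeff_eqI)
    fix z :: complex assume "z \<in> unit_disc"
    then have "(\<lambda>n. epow (n + \<beta> i) z (x (n + \<beta> i)) $ i) sums f z $ i"
      using f by (subst sums_zero_iff_shift) (auto simp: epow_def)
    then show "(\<lambda>n. x (n + \<beta> i) $ i * z ^ n) sums f z $ i"
      by (simp add: epow_def mult.commute)
  qed
  then show ?thesis using x by (auto simp: taylor_vec_def fun_eq_iff vec_eq_iff level_def)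
qed

lemma holomorphic_on_epow_series:
  assumes f: "\<And>z i. z \<in> unit_disc \<Longrightarrow> (\<lambda>k. epow k z (x k) $ i) sums f z $ i"
  shows "(\<lambda>z. f z $ i) holomorphic_on unit_disc"
proof (rule power_series_holomorphic)
  fix z :: complex assume "z \<in> unit_disc"
  then have "(\<lambda>n. epow (n + \<beta> i) z (x (n + \<beta> i)) $ i) sums f z $ i"
    using f by (subst sums_zero_iff_shift) (auto simp: epow_def)
  then show "(\<lambda>n. x (n + \<beta> i) $ i * (z - 0) ^ n) sums f z $ i"
    by (simp add: epow_def mult.commute)
qed

lemma summable_taylor_vec:
  assumes f: "f \<in> holomorphic_sections" and r: "0 \<le> r" "r < 1"
  shows "summable (\<lambda>k. norm (taylor_vec f k $ i) * r ^ k)"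
proof -
  obtain x where x: "r < x" "x < 1" using dense[OF r(2)] by blast
  have d: "of_real x \<in> unit_disc" using r x by simp
  have "summable (\<lambda>n. taylor_coeff (\<lambda>z. f z $ i) n * of_real x ^ n)"
    using f d by (intro sums_summable[OF taylor_coeff_sums]) (auto simp: holomorphic_sections_def)
  then have "summable (\<lambda>n. norm (taylor_coeff (\<lambda>z. f z $ i) n * of_real r ^ n))"
    by (rule powser_insidea) (use r x in simp)
  then have "summable (\<lambda>n. norm (taylor_coeff (\<lambda>z. f z $ i) n) * r ^ n * r ^ \<beta> i)"
    using r by (intro summable_mult2) (simp add: norm_mult norm_power)
  then have "summable (\<lambda>n. norm (taylor_vec f (n + \<beta> i) $ i) * r ^ (n + \<beta> i))"
    by (simp add: taylor_vec_def power_add mult.assoc)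
  then show ?thesis by (subst (asm) summable_iff_shift)
qed

lemma cinner_kern_sums:
  assumes z: "z \<in> unit_disc" and w: "w \<in> unit_disc"
  shows "(\<lambda>k. cinner (coeff_mat \<eta> k *v epow k (cnj w) x) (epow k (cnj z) y)) sums cinner (kern \<eta> z w *v x) y"
proof -
  have "(\<lambda>k. \<Sum>i\<in>UNIV. \<Sum>l\<in>UNIV. z ^ (k - \<beta> i) * coeff_mat \<eta> k $ i $ l * cnj w ^ (k - \<beta> l) * x $ l * cnj (y $ i))
      sums cinner (kern \<eta> z w *v x) y"
    unfolding cinner_mult by (intro sums_sum sums_mult2 kern_sums z w)
  moreover have "z ^ (k - \<beta> i) * coeff_mat \<eta> k $ i $ l * cnj w ^ (k - \<beta> l) * x $ l * cnj (y $ i)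
      = coeff_mat \<eta> k $ i $ l * epow k (cnj w) x $ l * cnj (epow k (cnj z) y $ i)" for k i l
    by (auto simp: epow_def coeff_mat_def)
  ultimately show ?thesis by (simp add: cinner_mult)
qed

text \<open>
  In a space with reproducing kernel \<^const>\<open>kern\<close>, this is the Cauchy-Schwarz inequality for \<open>f\<close> and finite
  combinations of kernel sections, with the squared norm of \<open>f\<close> as \<open>C\<close>. It speaks only of values of \<open>f\<close> and of
  the kernel, so that it passes from \<open>f\<close> to its translates under the group.
\<close>

definition kernel_bounded :: "real \<Rightarrow> (complex \<Rightarrow> complex^'n) \<Rightarrow> real \<Rightarrow> bool" where
  "kernel_bounded \<eta> f C \<longleftrightarrow> (\<forall>(M::nat) w \<xi>. (\<forall>a<M. w a \<in> unit_disc) \<longrightarrow>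
     (norm (\<Sum>a<M. cinner (f (w a)) (\<xi> a)))\<^sup>2
       \<le> C * Re (\<Sum>a<M. \<Sum>b<M. cinner (kern \<eta> (w b) (w a) *v \<xi> a) (\<xi> b)))"

text \<open>
  A bound for evaluations gives a bound for Taylor coefficients: averaging the evaluations at the points of a
  circle that are \<open>M\<close>-th roots of unity, with suitable phases, picks out the coefficients whose weights are in
  given classes modulo \<open>M\<close>, and all but the smallest weights disappear as \<open>M\<close> tends to infinity. The same
  average turns the quadratic form of the kernel into that of its coefficient matrices.
\<close>

lemma kernel_bounded_taylor:
  assumes f: "f \<in> holomorphic_sections" and bd: "kernel_bounded \<eta> f C"
    and y: "\<And>k. k < n \<Longrightarrow> y k \<in> level k"
  shows "(norm (\<Sum>k<n. cinner (taylor_vec f k) (y k)))\<^sup>2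
     \<le> C * Re (\<Sum>k<n. cinner (coeff_mat \<eta> k *v y k) (y k))"
proof -
  \<comment> \<open>The points lie on the circle of radius \<open>1/2\<close>, and the weights \<open>\<xi>\<close> cancel phases and radius for the
    chosen coefficients; \<open>V M k\<close> is what the average leaves at weight \<open>k\<close>.\<close>
  define \<omega> where "\<omega> M = cis (2 * pi / real M)" for M :: nat
  define w where "w M a = of_real (1/2) * \<omega> M ^ a" for M a :: nat
  define \<xi> where "\<xi> M a = (1 / of_nat M) *s (\<Sum>k<n. epow k (2 * \<omega> M ^ a) (y k))" for M a :: nat
  define V where "V M k = (\<Sum>a<M. epow k (cnj (w M a)) (\<xi> M a))" for M k :: nat
  define R where "R i = (\<Sum>k<n. 2 ^ k * norm (y k $ i))" for i
  have norm_\<omega>: "norm (\<omega> M) = 1" for M by (simp add: \<omega>_def)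
  have w: "w M a \<in> unit_disc" for M a by (simp add: w_def norm_mult norm_power norm_\<omega>)
  have V: "V M k $ i = (if \<beta> i \<le> k then (\<Sum>l<n. if \<beta> i \<le> l then 2 ^ (l - \<beta> i) * y l $ i / 2 ^ (k - \<beta> i)
       * ((\<Sum>a<M. cnj (\<omega> M ^ a) ^ (k - \<beta> i) * (\<omega> M ^ a) ^ (l - \<beta> i)) / of_nat M) else 0) else 0)" for M k i
  proof -
    have "V M k $ i = (\<Sum>a<M. \<Sum>l<n. if \<beta> i \<le> k \<and> \<beta> i \<le> l then 2 ^ (l - \<beta> i) * y l $ i / 2 ^ (k - \<beta> i)
       * ((cnj (\<omega> M ^ a) ^ (k - \<beta> i) * (\<omega> M ^ a) ^ (l - \<beta> i)) / of_nat M) else 0)"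
      unfolding V_def \<xi>_def w_def
      by (auto simp: epow_def sum_distrib_left power_mult_distrib power_divide intro!: sum.cong)
    also have "\<dots> = (\<Sum>l<n. \<Sum>a<M. if \<beta> i \<le> k \<and> \<beta> i \<le> l then 2 ^ (l - \<beta> i) * y l $ i / 2 ^ (k - \<beta> i)
       * ((cnj (\<omega> M ^ a) ^ (k - \<beta> i) * (\<omega> M ^ a) ^ (l - \<beta> i)) / of_nat M) else 0)"
      by (rule sum.swap)
    finally show ?thesis by (auto simp: sum_distrib_left sum_divide_distrib intro!: sum.cong)
  qed
  have V_less: "V M k = (if k < n then y k else 0)" if "n \<le> M" "k < M" for M k
  proof -
    have "V M k $ i = (if k < n then y k $ i else 0)" for i
    proof (cases "\<beta> i \<le> k")
      case True
      have eq: "(if \<beta> i \<le> l then 2 ^ (l - \<beta> i) * y l $ i / 2 ^ (k - \<beta> i)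
         * ((\<Sum>a<M. cnj (\<omega> M ^ a) ^ (k - \<beta> i) * (\<omega> M ^ a) ^ (l - \<beta> i)) / of_nat M) else 0)
         = (if l = k then y k $ i else 0)" if "l < n" for l
      proof (cases "\<beta> i \<le> l")
        case True
        have lt: "k - \<beta> i < M" "l - \<beta> i < M" using \<open>k < M\<close> \<open>n \<le> M\<close> \<open>l < n\<close> by auto
        have "k - \<beta> i = l - \<beta> i \<longleftrightarrow> l = k" using True \<open>\<beta> i \<le> k\<close> by auto
        then show ?thesis
          using True \<open>k < M\<close> unfolding \<omega>_def roots_of_unity_orthogonal[OF lt] by auto
      next
        case False
        then show ?thesis using \<open>\<beta> i \<le> k\<close> by auto
      qed
      have "V M k $ i = (\<Sum>l<n. if l = k then y k $ i else 0)"
        by (simp only: V True if_True) (intro sum.cong refl eq, simp)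
      then show ?thesis by simp
    next
      case False
      then show ?thesis using y[of k] by (auto simp: V level_def)
    qed
    then show ?thesis by (auto simp: vec_eq_iff)
  qed
  have V_le: "norm (V M k $ i) \<le> R i * (1/2) ^ k" if "M > 0" for M k i
  proof (cases "\<beta> i \<le> k")
    case True
    let ?S = "\<lambda>l. \<Sum>a<M. cnj (\<omega> M ^ a) ^ (k - \<beta> i) * (\<omega> M ^ a) ^ (l - \<beta> i)"
    have "norm (V M k $ i) = norm (\<Sum>l<n. if \<beta> i \<le> l then 2 ^ (l - \<beta> i) * y l $ i / 2 ^ (k - \<beta> i)
       * (?S l / of_nat M) else 0)"
      by (simp only: V True if_True)
    also have "\<dots> \<le> (\<Sum>l<n. 2 ^ l * norm (y l $ i) / 2 ^ k)"
    proof (intro sum_norm_le)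
      fix l
      show "norm (if \<beta> i \<le> l then 2 ^ (l - \<beta> i) * y l $ i / 2 ^ (k - \<beta> i) * (?S l / of_nat M) else 0)
          \<le> 2 ^ l * norm (y l $ i) / 2 ^ k"
      proof (cases "\<beta> i \<le> l")
        case l: True
        have "norm (?S l) \<le> (\<Sum>a<M. 1)"
          by (intro sum_norm_le) (simp add: norm_mult norm_power norm_\<omega>)
        then have S: "norm (?S l) / real M \<le> 1" using \<open>M > 0\<close> by simp
        have "(2::real) ^ (l - \<beta> i) / 2 ^ (k - \<beta> i) = 2 ^ l / 2 ^ k"
          using True l by (simp add: power_diff)
        then have "norm (2 ^ (l - \<beta> i) * y l $ i / 2 ^ (k - \<beta> i) * (?S l / of_nat M))
            = 2 ^ l / 2 ^ k * norm (y l $ i) * (norm (?S l) / real M)"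
          by (simp only: norm_mult norm_divide norm_power norm_numeral norm_of_nat times_divide_eq_left times_divide_eq_right)
            (simp add: divide_simps mult_ac)
        also have "\<dots> \<le> 2 ^ l / 2 ^ k * norm (y l $ i) * 1" by (intro mult_left_mono S) simp
        finally show ?thesis using l by simp
      qed simp
    qed
    also have "\<dots> = R i * (1/2) ^ k" by (simp add: R_def power_divide sum_divide_distrib)
    finally show ?thesis .
  next
    case False
    then show ?thesis by (simp add: V R_def sum_nonneg)
  qed
  define X where "X k = cinner (taylor_vec f k) (if k < n then y k else 0)" for k
  define Q where "Q k = cinner (coeff_mat \<eta> k *v (if k < n then y k else 0)) (if k < n then y k else 0)" for k
  have limit: "(\<lambda>M. V M k) \<longlonglongrightarrow> (if k < n then y k else 0)" for k
    by (rule tendsto_eventually, rule eventually_sequentiallyI[of "max n (Suc k)"]) (simp add: V_less)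
  have nth: "(\<lambda>M. V M k $ i) \<longlonglongrightarrow> (if k < n then y k else 0) $ i" for k i
    by (intro tendsto_vec_nth limit)
  have Xlim: "(\<lambda>M. \<Sum>k. cinner (taylor_vec f k) (V M k)) \<longlonglongrightarrow> suminf X"
  proof (rule tannerys_theorem[THEN conjunct2, THEN conjunct2])
    show "(\<lambda>M. cinner (taylor_vec f k) (V M k)) \<longlonglongrightarrow> X k" for k
      unfolding X_def cinner_def by (intro tendsto_intros nth)
    have "norm (cinner (taylor_vec f k) (V M k)) \<le> (\<Sum>i\<in>UNIV. norm (taylor_vec f k $ i) * (1/2) ^ k * R i)"
      if "M > 0" for k M
      by (rule order_trans[OF norm_cinner_le], intro sum_mono)
        (use mult_left_mono[OF V_le[OF that], of "norm (taylor_vec f k $ _)"] in \<open>simp add: mult_ac\<close>)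
    then show "\<forall>\<^sub>F (k, M) in at_top \<times>\<^sub>F sequentially. norm (cinner (taylor_vec f k) (V M k))
        \<le> (\<Sum>i\<in>UNIV. norm (taylor_vec f k $ i) * (1/2) ^ k * R i)"
      by (subst eventually_prod_filter, intro exI[of _ "\<lambda>_. True"] exI[of _ "\<lambda>M. M > 0"])
        (auto intro: eventually_gt_at_top)
    show "summable (\<lambda>k. \<Sum>i\<in>UNIV. norm (taylor_vec f k $ i) * (1/2) ^ k * R i)"
      by (intro summable_sum summable_mult2 summable_taylor_vec[OF f]) auto
  qed simp
  have Qlim: "(\<lambda>M. \<Sum>k. cinner (coeff_mat \<eta> k *v V M k) (V M k)) \<longlonglongrightarrow> suminf Q"
  proof (rule tannerys_theorem[THEN conjunct2, THEN conjunct2])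
    show "(\<lambda>M. cinner (coeff_mat \<eta> k *v V M k) (V M k)) \<longlonglongrightarrow> Q k" for k
      unfolding Q_def cinner_mult by (intro tendsto_intros nth)
    have "norm (cinner (coeff_mat \<eta> k *v V M k) (V M k))
        \<le> (\<Sum>i\<in>UNIV. \<Sum>l\<in>UNIV. norm (coeff_mat \<eta> k $ i $ l) * (1/2) ^ (2 * k) * (R l * R i))"
      if "M > 0" for k M
      unfolding cinner_mult
    proof (intro sum_norm_le)
      fix i l
      have "norm (V M k $ l) * norm (V M k $ i) \<le> (R l * (1/2) ^ k) * (R i * (1/2) ^ k)"
        by (intro mult_mono V_le[OF that]) (auto simp: R_def intro!: sum_nonneg mult_nonneg_nonneg)
      then have "norm (coeff_mat \<eta> k $ i $ l) * (norm (V M k $ l) * norm (V M k $ i))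
          \<le> norm (coeff_mat \<eta> k $ i $ l) * ((R l * (1/2) ^ k) * (R i * (1/2) ^ k))"
        by (rule mult_left_mono) simp
      also have "\<dots> = norm (coeff_mat \<eta> k $ i $ l) * (1/2) ^ (2 * k) * (R l * R i)"
        by (simp add: mult_2 power_add)
      finally show "norm (coeff_mat \<eta> k $ i $ l * V M k $ l * cnj (V M k $ i))
          \<le> norm (coeff_mat \<eta> k $ i $ l) * (1/2) ^ (2 * k) * (R l * R i)"
        by (simp add: norm_mult mult.assoc)
    qed
    then show "\<forall>\<^sub>F (k, M) in at_top \<times>\<^sub>F sequentially. norm (cinner (coeff_mat \<eta> k *v V M k) (V M k))
        \<le> (\<Sum>i\<in>UNIV. \<Sum>l\<in>UNIV. norm (coeff_mat \<eta> k $ i $ l) * (1/2) ^ (2 * k) * (R l * R i))"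
      by (subst eventually_prod_filter, intro exI[of _ "\<lambda>_. True"] exI[of _ "\<lambda>M. M > 0"])
        (auto intro: eventually_gt_at_top)
    show "summable (\<lambda>k. \<Sum>i\<in>UNIV. \<Sum>l\<in>UNIV. norm (coeff_mat \<eta> k $ i $ l) * (1/2) ^ (2 * k) * (R l * R i))"
      by (intro summable_sum summable_mult2 summable_coeff_mat) auto
  qed simp
  have "(norm (\<Sum>k. cinner (taylor_vec f k) (V M k)))\<^sup>2 \<le> C * Re (\<Sum>k. cinner (coeff_mat \<eta> k *v V M k) (V M k))" for M
  proof -
    have "(\<lambda>k. \<Sum>a<M. cinner (taylor_vec f k) (epow k (cnj (w M a)) (\<xi> M a))) sums (\<Sum>a<M. cinner (f (w M a)) (\<xi> M a))"
      by (intro sums_sum cinner_taylor_vec_sums[OF f] w)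
    moreover have "(\<Sum>a<M. cinner x (v a)) = cinner x (\<Sum>a<M. v a)" for x :: "complex^'n" and v
      by (induction M) (simp_all add: cinner_add_right)
    ultimately have 1: "(\<lambda>k. cinner (taylor_vec f k) (V M k)) sums (\<Sum>a<M. cinner (f (w M a)) (\<xi> M a))"
      by (simp add: V_def)
    have bil: "(\<Sum>a<M. \<Sum>b<M. cinner (A *v v a) (v b)) = cinner (A *v (\<Sum>a<M. v a)) (\<Sum>b<M. v b)"
      for A :: "complex^'n^'n" and v
    proof -
      have r: "(\<Sum>b<M. cinner x (v b)) = cinner x (\<Sum>b<M. v b)" for x :: "complex^'n"
        by (induction M) (simp_all add: cinner_add_right)
      have l: "(\<Sum>a<N. cinner (A *v v a) x) = cinner (A *v (\<Sum>a<N. v a)) x" for x :: "complex^'n" and N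
        by (induction N) (simp_all add: cinner_add_left matrix_vector_right_distrib)
      show ?thesis by (simp only: r l)
    qed
    have "(\<lambda>k. \<Sum>a<M. \<Sum>b<M. cinner (coeff_mat \<eta> k *v epow k (cnj (w M a)) (\<xi> M a)) (epow k (cnj (w M b)) (\<xi> M b)))
        sums (\<Sum>a<M. \<Sum>b<M. cinner (kern \<eta> (w M b) (w M a) *v \<xi> M a) (\<xi> M b))"
      by (intro sums_sum cinner_kern_sums w)
    then have 2: "(\<lambda>k. cinner (coeff_mat \<eta> k *v V M k) (V M k))
        sums (\<Sum>a<M. \<Sum>b<M. cinner (kern \<eta> (w M b) (w M a) *v \<xi> M a) (\<xi> M b))"
      by (simp only: bil V_def)
    show ?thesis
      using bd w unfolding kernel_bounded_def sums_unique[OF 1, symmetric] sums_unique[OF 2, symmetric] by blast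
  qed
  moreover have "(\<lambda>M. (norm (\<Sum>k. cinner (taylor_vec f k) (V M k)))\<^sup>2) \<longlonglongrightarrow> (norm (suminf X))\<^sup>2"
    by (intro tendsto_intros Xlim)
  moreover have "(\<lambda>M. C * Re (\<Sum>k. cinner (coeff_mat \<eta> k *v V M k) (V M k))) \<longlonglongrightarrow> C * Re (suminf Q)"
    by (intro tendsto_intros Qlim)
  ultimately have "(norm (suminf X))\<^sup>2 \<le> C * Re (suminf Q)"
    by (intro LIMSEQ_le) auto
  moreover have "suminf X = (\<Sum>k<n. cinner (taylor_vec f k) (y k))"
    by (subst suminf_finite[of "{..<n}"]) (auto simp: X_def)
  moreover have "suminf Q = (\<Sum>k<n. cinner (coeff_mat \<eta> k *v y k) (y k))"
    by (subst suminf_finite[of "{..<n}"]) (auto simp: Q_def)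
  ultimately show ?thesis by simp
qed

end

section \<open>Spaces with a reproducing kernel\<close>

lemma matrix_eq_by_cinner:
  fixes A B :: "complex^'n^'m"
  assumes "\<And>x y. cinner (A *v x) y = cinner (B *v x) y"
  shows "A = B"
proof -
  have "(A *v x) $ i = (B *v x) $ i" for x i
    using assms[of x "axis i 1"] by (simp add: cinner_axis)
  then have "A *v x = B *v x" for x by (simp add: vec_eq_iff)
  then show ?thesis by (metis matrix_eq)
qed

lemma matrix_inv_eqI:
  fixes A B :: "complex^'n^'n"
  assumes AB: "A ** B = mat 1"
  shows "matrix_inv A = B"
proof -
  have "B ** A = mat 1" using AB matrix_left_right_inverse by blast
  with AB have "A ** matrix_inv A = mat 1 \<and> matrix_inv A ** A = mat 1"
    unfolding matrix_inv_def using someI[of "\<lambda>X. A ** X = mat 1 \<and> X ** A = mat 1" B] by blast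
  then have "matrix_inv A ** (A ** B) = B" by (simp only: matrix_mul_assoc matrix_mul_lid)
  then show ?thesis by (simp only: AB matrix_mul_rid)
qed

lemma mult_axis_nth: "(A *v axis l 1) $ i = (A $ i $ l :: complex)"
proof -
  have "(\<Sum>j\<in>UNIV. A $ i $ j * axis l 1 $ j) = (\<Sum>j\<in>UNIV. if j = l then A $ i $ l else 0)"
    by (intro sum.cong) (auto simp: axis_def)
  then show ?thesis by (simp add: matrix_vector_mult_def)
qed

lemma on_disc_in [simp]: "z \<in> unit_disc \<Longrightarrow> on_disc f z = f z"
  by (simp add: on_disc_def)

lemma on_disc_out [simp]: "z \<notin> unit_disc \<Longrightarrow> on_disc f z = 0"
  by (simp add: on_disc_def)

text \<open>
  The algebraic part of \<^const>\<open>hilbert_space_of_sections\<close>.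
\<close>

locale section_space =
  fixes S :: "(complex \<Rightarrow> complex^'n::finite) set"
    and ip :: "(complex \<Rightarrow> complex^'n) \<Rightarrow> (complex \<Rightarrow> complex^'n) \<Rightarrow> complex"
  assumes hol: "S \<subseteq> holomorphic_sections"
    and zero: "(\<lambda>z. 0) \<in> S"
    and add: "f \<in> S \<Longrightarrow> g \<in> S \<Longrightarrow> (\<lambda>z. f z + g z) \<in> S"
    and scale: "f \<in> S \<Longrightarrow> (\<lambda>z. a *s f z) \<in> S"
    and ip_add: "f \<in> S \<Longrightarrow> g \<in> S \<Longrightarrow> h \<in> S \<Longrightarrow> ip (\<lambda>z. f z + g z) h = ip f h + ip g h"
    and ip_scale: "f \<in> S \<Longrightarrow> g \<in> S \<Longrightarrow> ip (\<lambda>z. a *s f z) g = a * ip f g"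
    and ip_cnj: "f \<in> S \<Longrightarrow> g \<in> S \<Longrightarrow> ip g f = cnj (ip f g)"
    and ip_pos: "f \<in> S \<Longrightarrow> f \<noteq> (\<lambda>z. 0) \<Longrightarrow> 0 < Re (ip f f)"
begin

lemma vanish:
  assumes f: "f \<in> S" and z: "z \<notin> unit_disc"
  shows "f z = 0"
proof -
  have "on_disc f = f" using hol f by (auto simp: holomorphic_sections_def)
  from fun_cong[OF this, of z] show ?thesis by (simp only: on_disc_out[OF z])
qed

lemma ip_add_right:
  assumes "f \<in> S" "g \<in> S" "h \<in> S"
  shows "ip h (\<lambda>z. f z + g z) = ip h f + ip h g"
  using ip_cnj[OF add[OF assms(1,2)] assms(3)] ip_cnj[OF assms(1,3)] ip_cnj[OF assms(2,3)]
    ip_add[OF assms] by simp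

lemma ip_scale_right:
  assumes "f \<in> S" "g \<in> S"
  shows "ip g (\<lambda>z. a *s f z) = cnj a * ip g f"
  using ip_cnj[OF scale[OF assms(1), of a] assms(2)] ip_cnj[OF assms] ip_scale[OF assms, of a] by simp

lemma diff: "f \<in> S \<Longrightarrow> g \<in> S \<Longrightarrow> (\<lambda>z. f z - g z) \<in> S"
  using add[OF _ scale[of g "-1"], of f] by simp

lemma ip_diff:
  assumes "f \<in> S" "g \<in> S" "h \<in> S"
  shows "ip (\<lambda>z. f z - g z) h = ip f h - ip g h"
  using ip_add[OF assms(1) scale[OF assms(2), of "-1"] assms(3)] ip_scale[OF assms(2,3), of "-1"] by simp

lemma ip_diff_right:
  assumes "f \<in> S" "g \<in> S" "h \<in> S"
  shows "ip h (\<lambda>z. f z - g z) = ip h f - ip h g"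
  using ip_add_right[OF assms(1) scale[OF assms(2), of "-1"] assms(3)]
    ip_scale_right[OF assms(2,3), of "-1"] by simp

lemma ip_zero: "g \<in> S \<Longrightarrow> ip (\<lambda>z. 0) g = 0"
  using ip_scale[OF zero, of g 0] by simp

lemma ip_nonneg: "f \<in> S \<Longrightarrow> 0 \<le> Re (ip f f)"
  using ip_pos[of f] ip_zero[OF zero] by (cases "f = (\<lambda>z. 0)") auto

lemma ip_self: "f \<in> S \<Longrightarrow> ip f f = of_real (Re (ip f f))"
  using ip_cnj[of f f] by (simp add: complex_eq_iff)

lemma ip_norm_power2: "f \<in> S \<Longrightarrow> (ip_norm ip f)\<^sup>2 = Re (ip f f)"
  by (simp add: ip_norm_def ip_nonneg)

lemma Cauchy_Schwarz:
  assumes f: "f \<in> S" and g: "g \<in> S"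
  shows "(norm (ip f g))\<^sup>2 \<le> Re (ip f f) * Re (ip g g)"
proof (cases "g = (\<lambda>z. 0)")
  case True
  then show ?thesis using ip_cnj[OF zero f] ip_zero[OF f] ip_zero[OF zero] by simp
next
  case False
  define r where "r = Re (ip g g)"
  have r: "r > 0" unfolding r_def by (rule ip_pos[OF g False])
  \<comment> \<open>\<open>t *s g\<close> is the orthogonal projection of \<open>f\<close> to the line through \<open>g\<close>.\<close>
  define t where "t = ip f g / of_real r"
  have tg: "(\<lambda>z. t *s g z) \<in> S" by (rule scale[OF g])
  have "0 \<le> Re (ip (\<lambda>z. f z - t *s g z) (\<lambda>z. f z - t *s g z))"
    by (rule ip_nonneg[OF diff[OF f tg]])
  also have "ip (\<lambda>z. f z - t *s g z) (\<lambda>z. f z - t *s g z)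
      = ip f f - cnj t * ip f g - (t * cnj (ip f g) - t * (cnj t * of_real r))"
    using ip_diff[OF f tg diff[OF f tg]] ip_diff_right[OF f tg f] ip_diff_right[OF f tg tg]
      ip_scale_right[OF g f, of t] ip_scale[OF g f, of t] ip_scale[OF g tg, of t]
      ip_scale_right[OF g g, of t] ip_cnj[OF f g] ip_self[OF g] by (simp add: r_def)
  also have "\<dots> = ip f f - of_real ((norm (ip f g))\<^sup>2 / r)"
  proof -
    have "t * of_real r = ip f g" using r by (simp add: t_def)
    moreover have "cnj t * ip f g = of_real ((norm (ip f g))\<^sup>2 / r)"
      by (simp add: t_def complex_norm_square mult.commute del: of_real_power)
    moreover have "t * (cnj t * of_real r) = cnj t * (t * of_real r)" by simp
    moreover have "t * cnj (ip f g) = of_real ((norm (ip f g))\<^sup>2 / r)"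
      by (simp add: t_def complex_norm_square mult.commute del: of_real_power)
    ultimately show ?thesis by simp
  qed
  finally have "(norm (ip f g))\<^sup>2 / r \<le> Re (ip f f)" by simp
  then show ?thesis using r by (simp add: r_def pos_divide_le_eq)
qed

lemma sum_mem: "(\<And>a. a < M \<Longrightarrow> F a \<in> S) \<Longrightarrow> (\<lambda>z. \<Sum>a<(M::nat). F a z) \<in> S"
proof (induction M)
  case (Suc M)
  then show ?case using add[of "\<lambda>z. \<Sum>a<M. F a z" "F M"] by simp
qed (simp add: zero)

lemma ip_sum:
  "(\<And>a. a < M \<Longrightarrow> F a \<in> S) \<Longrightarrow> g \<in> S \<Longrightarrow> ip (\<lambda>z. \<Sum>a<(M::nat). F a z) g = (\<Sum>a<M. ip (F a) g)"
proof (induction M)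
  case (Suc M)
  then show ?case using ip_add[OF sum_mem[of M F], of "F M" g] by simp
qed (simp add: ip_zero)

lemma ip_sum_right:
  assumes "\<And>a. a < M \<Longrightarrow> F a \<in> S" "g \<in> S"
  shows "ip g (\<lambda>z. \<Sum>a<(M::nat). F a z) = (\<Sum>a<M. ip g (F a))"
proof -
  have "ip g (\<lambda>z. \<Sum>a<M. F a z) = cnj (\<Sum>a<M. ip (F a) g)"
    using ip_cnj[OF sum_mem[OF assms(1)] assms(2)] ip_sum[OF assms] by simp
  also have "\<dots> = (\<Sum>a<M. ip g (F a))" unfolding cnj_sum
    by (intro sum.cong refl ip_cnj[symmetric] assms) auto
  finally show ?thesis .
qed

end

lemma hilbert_space_imp_section_space:
  "hilbert_space_of_sections S ip \<Longrightarrow> section_space S ip"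
  unfolding hilbert_space_of_sections_def section_space_def by (intro conjI) blast+

locale kernel_space = section_space S ip
  for S :: "(complex \<Rightarrow> complex^'n::finite) set" and ip +
  fixes K :: "complex \<Rightarrow> complex \<Rightarrow> complex^'n^'n"
  assumes repr: "reproducing_kernel S ip K"
begin

definition kernel_section :: "complex \<Rightarrow> complex^'n \<Rightarrow> complex \<Rightarrow> complex^'n" where
  "kernel_section w \<xi> = on_disc (\<lambda>z. K z w *v \<xi>)"

lemma kernel_section_mem: "w \<in> unit_disc \<Longrightarrow> kernel_section w \<xi> \<in> S"
  using repr by (simp add: reproducing_kernel_def kernel_section_def)

lemma ip_kernel_section: "w \<in> unit_disc \<Longrightarrow> f \<in> S \<Longrightarrow> ip f (kernel_section w \<xi>) = cinner (f w) \<xi>"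
  using repr by (simp add: reproducing_kernel_def kernel_section_def)

text \<open>
  The Cauchy-Schwarz inequality for \<open>f\<close> and a finite combination of kernel sections.
\<close>

lemma evaluation_bound:
  assumes f: "f \<in> S" and w: "\<And>a. a < M \<Longrightarrow> w a \<in> unit_disc"
  shows "(norm (\<Sum>a<(M::nat). cinner (f (w a)) (\<xi> a)))\<^sup>2
     \<le> Re (ip f f) * Re (\<Sum>a<M. \<Sum>b<M. cinner (K (w b) (w a) *v \<xi> a) (\<xi> b))"
proof -
  define F where "F a = kernel_section (w a) (\<xi> a)" for a
  have F: "F a \<in> S" if "a < M" for a unfolding F_def by (intro kernel_section_mem w that)
  have "ip f (\<lambda>z. \<Sum>a<M. F a z) = (\<Sum>a<M. cinner (f (w a)) (\<xi> a))"
    using ip_sum_right[OF F f] ip_kernel_section[OF w f] by (simp add: F_def)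
  moreover have "ip (\<lambda>z. \<Sum>a<M. F a z) (\<lambda>z. \<Sum>a<M. F a z) = (\<Sum>a<M. \<Sum>b<M. cinner (K (w b) (w a) *v \<xi> a) (\<xi> b))"
  proof -
    have "ip (\<lambda>z. \<Sum>a<M. F a z) (\<lambda>z. \<Sum>a<M. F a z) = (\<Sum>a<M. ip (F a) (\<lambda>z. \<Sum>a<M. F a z))"
      by (rule ip_sum[OF F sum_mem[OF F]])
    also have "\<dots> = (\<Sum>a<M. \<Sum>b<M. ip (F a) (F b))"
      by (intro sum.cong refl ip_sum_right F) auto
    also have "\<dots> = (\<Sum>a<M. \<Sum>b<M. cinner (K (w b) (w a) *v \<xi> a) (\<xi> b))"
    proof (intro sum.cong refl)
      fix a b assume "a \<in> {..<M}" "b \<in> {..<M}"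
      then have "ip (F a) (F b) = cinner (F a (w b)) (\<xi> b)"
        unfolding F_def[of b] by (intro ip_kernel_section w F) auto
      then show "ip (F a) (F b) = cinner (K (w b) (w a) *v \<xi> a) (\<xi> b)"
        using w \<open>b \<in> {..<M}\<close> by (simp add: F_def kernel_section_def)
    qed
    finally show ?thesis .
  qed
  moreover have "(\<lambda>z. \<Sum>a<M. F a z) \<in> S" by (rule sum_mem[OF F])
  ultimately show ?thesis using Cauchy_Schwarz[OF f, of "\<lambda>z. \<Sum>a<M. F a z"] by (simp only:)
qed

lemma kernel_hermitian:
  assumes z: "z \<in> unit_disc" and w: "w \<in> unit_disc"
  shows "ctranspose (K z w) = K w z"
proof (rule matrix_eq_by_cinner)
  fix x y
  have "cinner (K w z *v x) y = ip (kernel_section z x) (kernel_section w y)"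
    using ip_kernel_section[OF w kernel_section_mem[OF z]] w by (simp add: kernel_section_def)
  also have "\<dots> = cnj (ip (kernel_section w y) (kernel_section z x))"
    by (rule ip_cnj[OF kernel_section_mem[OF w] kernel_section_mem[OF z]])
  also have "\<dots> = cnj (cinner (K z w *v y) x)"
    using ip_kernel_section[OF z kernel_section_mem[OF w]] z by (simp add: kernel_section_def)
  also have "\<dots> = cinner x (K z w *v y)" by (rule cnj_cinner)
  also have "\<dots> = cinner (ctranspose (K z w) *v x) y" by (simp add: cinner_ctranspose)
  finally show "cinner (ctranspose (K z w) *v x) y = cinner (K w z *v x) y" ..
qed

lemma kernel_holomorphic:
  assumes w: "w \<in> unit_disc"
  shows "(\<lambda>z. K z w $ i $ l) holomorphic_on unit_disc"
proof -
  have "(\<lambda>z. kernel_section w (axis l 1) z $ i) holomorphic_on unit_disc"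
    using kernel_section_mem[OF w] hol by (auto simp: holomorphic_sections_def)
  moreover have "kernel_section w (axis l 1) z $ i = K z w $ i $ l" if "z \<in> unit_disc" for z
    using that by (simp add: kernel_section_def mult_axis_nth)
  ultimately show ?thesis by (rule holomorphic_transform) auto
qed

text \<open>
  If \<open>K z z \<xi> = 0\<close>, the kernel section at \<open>z\<close> for \<open>\<xi>\<close> has norm zero, so all values at \<open>z\<close> are orthogonal to \<open>\<xi>\<close>.
\<close>

lemma kernel_diagonal_injective:
  assumes surj: "evaluations_surjective S" and z: "z \<in> unit_disc" and 0: "K z z *v \<xi> = 0"
  shows "\<xi> = 0"
proof -
  have "ip (kernel_section z \<xi>) (kernel_section z \<xi>) = 0"
    using ip_kernel_section[OF z kernel_section_mem[OF z]] z 0 by (simp add: kernel_section_def)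
  then have k0: "kernel_section z \<xi> = (\<lambda>z. 0)"
    using ip_pos[OF kernel_section_mem[OF z, of \<xi>]] by fastforce
  have "(\<lambda>f. f z) ` S = UNIV" using surj z unfolding evaluations_surjective_def by blast
  then have "\<xi> \<in> (\<lambda>f. f z) ` S" by simp
  then obtain f where f: "f \<in> S" "f z = \<xi>" by blast
  have "cinner \<xi> \<xi> = ip f (\<lambda>z. 0)" using ip_kernel_section[OF z f(1), of \<xi>] k0 f by simp
  also have "\<dots> = 0" using ip_cnj[OF zero f(1)] ip_zero[OF f(1)] by simp
  finally show ?thesis by (simp add: cinner_self)
qed

end

context graded_matrix
begin

lemma multiplier_action_inverse:
  assumes g: "g \<in> SU11_cover" and f: "\<And>z. z \<notin> unit_disc \<Longrightarrow> f z = 0"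
  shows "on_disc (\<lambda>z. multiplier \<beta> \<eta> Y g z *v
      on_disc (\<lambda>z. multiplier \<beta> \<eta> Y (cover_inverse g) z *v f (moebius (fst (cover_inverse g)) z)) (moebius (fst g) z)) = f"
proof
  fix z
  show "on_disc (\<lambda>z. multiplier \<beta> \<eta> Y g z *v
      on_disc (\<lambda>z. multiplier \<beta> \<eta> Y (cover_inverse g) z *v f (moebius (fst (cover_inverse g)) z)) (moebius (fst g) z)) z = f z"
  proof (cases "z \<in> unit_disc")
    case True
    then show ?thesis
      using moebius_in_disc[OF g True] moebius_cover_inverse(1)[OF g True] multiplier_inverse[OF g True]
      by (simp add: matrix_vector_mul_assoc)
  qed (simp add: f)
qed

text \<open>
  The operator of \<open>g\<close> maps the kernel section at \<open>g w\<close> to the one at \<open>w\<close>, since both represent the same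
  functional on the range of the operator, and the operator of the inverse shows that its range is everything.
\<close>

lemma isometric_imp_kernel_invariant:
  assumes "kernel_space S ip K" and iso: "acts_isometrically \<beta> \<eta> Y S ip"
    and g: "g \<in> SU11_cover" and z: "z \<in> unit_disc" and w: "w \<in> unit_disc"
  shows "multiplier \<beta> \<eta> Y g z ** K (moebius (fst g) z) (moebius (fst g) w)
           ** ctranspose (multiplier \<beta> \<eta> Y g w) = K z w"
proof -
  interpret kernel_space S ip K by fact
  define U where "U g f = on_disc (\<lambda>z. multiplier \<beta> \<eta> Y g z *v f (moebius (fst g) z))"
    for g and f :: "complex \<Rightarrow> complex^'n"
  have U: "U g f \<in> S" "Re (ip (U g f) (U g f)) = Re (ip f f)" if "g \<in> SU11_cover" "f \<in> S" for g f
  proof -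
    show *: "U g f \<in> S" using iso that by (simp add: acts_isometrically_def U_def Let_def)
    have "ip_norm ip (U g f) = ip_norm ip f"
      using iso that by (simp add: acts_isometrically_def U_def Let_def)
    then show "Re (ip (U g f) (U g f)) = Re (ip f f)"
      using ip_norm_power2[OF *] ip_norm_power2[OF that(2)] by simp
  qed
  have U_add: "U g (\<lambda>z. f z + h z) = (\<lambda>z. U g f z + U g h z)" for f h
    by (auto simp: U_def on_disc_def matrix_vector_right_distrib)
  have U_scale: "U g (\<lambda>z. a *s f z) = (\<lambda>z. a *s U g f z)" for f a
    by (auto simp: U_def on_disc_def vector_scalar_commute)
  have Re_ip: "Re (ip (U g f) (U g h)) = Re (ip f h)" if "f \<in> S" "h \<in> S" for f h
  proof -
    have e: "Re (ip (\<lambda>z. a z + b z) (\<lambda>z. a z + b z)) = Re (ip a a) + Re (ip b b) + 2 * Re (ip a b)"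
      if "a \<in> S" "b \<in> S" for a b
      using ip_add[OF that add[OF that]] ip_add_right[OF that that(1)] ip_add_right[OF that that(2)]
        ip_cnj[OF that] by simp
    show ?thesis
      using U(2)[OF g add[OF that]] e[OF that] e[OF U(1)[OF g that(1)] U(1)[OF g that(2)]]
        U(2)[OF g that(1)] U(2)[OF g that(2)] unfolding U_add by simp
  qed
  have ip_U: "ip (U g f) (U g h) = ip f h" if "f \<in> S" "h \<in> S" for f h
  proof -
    have "Re (ip (U g (\<lambda>z. \<i> *s f z)) (U g h)) = Re (ip (\<lambda>z. \<i> *s f z) h)"
      by (rule Re_ip[OF scale[OF that(1)] that(2)])
    then have "Re (\<i> * ip (U g f) (U g h)) = Re (\<i> * ip f h)"
      unfolding U_scale ip_scale[OF that] ip_scale[OF U(1)[OF g that(1)] U(1)[OF g that(2)]] .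
    then show ?thesis using Re_ip[OF that] by (simp add: complex_eq_iff)
  qed
  have gw: "moebius (fst g) w \<in> unit_disc" by (rule moebius_in_disc[OF g w])
  have "multiplier \<beta> \<eta> Y g z *v (K (moebius (fst g) z) (moebius (fst g) w) *v (ctranspose (multiplier \<beta> \<eta> Y g w) *v \<xi>)) = K z w *v \<xi>" for \<xi>
  proof -
    define \<xi>' where "\<xi>' = ctranspose (multiplier \<beta> \<eta> Y g w) *v \<xi>"
    define F where "F = U g (kernel_section (moebius (fst g) w) \<xi>')"
    have F: "F \<in> S" unfolding F_def by (intro U g kernel_section_mem gw)
    have *: "ip f F = ip f (kernel_section w \<xi>)" if "f \<in> S" for f
    proof -
      define f' where "f' = U (cover_inverse g) f"
      have f': "f' \<in> S" unfolding f'_def by (intro U cover_inverse_in g that)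
      have f: "f = U g f'"
        unfolding U_def f'_def by (rule multiplier_action_inverse[OF g vanish[OF that], symmetric])
      have "ip f F = ip f' (kernel_section (moebius (fst g) w) \<xi>')"
        unfolding f F_def by (rule ip_U[OF f' kernel_section_mem[OF gw]])
      also have "\<dots> = cinner (f' (moebius (fst g) w)) \<xi>'" by (rule ip_kernel_section[OF gw f'])
      also have "\<dots> = cinner (multiplier \<beta> \<eta> Y g w *v f' (moebius (fst g) w)) \<xi>"
        unfolding \<xi>'_def cinner_ctranspose ..
      also have "\<dots> = cinner (f w) \<xi>" unfolding f U_def using w by simp
      also have "\<dots> = ip f (kernel_section w \<xi>)" using ip_kernel_section[OF w that] by simp
      finally show ?thesis .
    qed
    have D: "(\<lambda>z. F z - kernel_section w \<xi> z) \<in> S" by (intro diff F kernel_section_mem w)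
    have "ip (\<lambda>z. F z - kernel_section w \<xi> z) (\<lambda>z. F z - kernel_section w \<xi> z) = 0"
      using ip_diff_right[OF F kernel_section_mem[OF w] D] *[OF D] by simp
    then have "(\<lambda>z. F z - kernel_section w \<xi> z) = (\<lambda>z. 0)" using ip_pos[OF D] by fastforce
    from fun_cong[OF this, of z] have "F z = kernel_section w \<xi> z" by simp
    then show ?thesis
      using z moebius_in_disc[OF g z] by (simp add: F_def U_def kernel_section_def \<xi>'_def)
  qed
  then have "(multiplier \<beta> \<eta> Y g z ** K (moebius (fst g) z) (moebius (fst g) w)
           ** ctranspose (multiplier \<beta> \<eta> Y g w)) *v \<xi> = K z w *v \<xi>" for \<xi>
    by (simp add: matrix_vector_mul_assoc matrix_mul_assoc)
  then show ?thesis by (metis matrix_eq)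
qed

end

section \<open>Uniqueness of the invariant kernel\<close>

text \<open>
  For rotation by \<open>\<pi> / n\<close>, invariance says that the \<open>n\<close>-th Taylor coefficient is its own negative.
\<close>

lemma rotation_invariant_imp_constant:
  assumes G: "G holomorphic_on unit_disc"
    and rot: "\<And>s z. z \<in> unit_disc \<Longrightarrow> G (exp (\<i> * of_real s) * z) = G z"
    and z: "z \<in> unit_disc"
  shows "G z = G 0"
proof -
  let ?a = "taylor_coeff G"
  have a0: "?a n = 0" if n: "n > 0" for n
  proof -
    \<comment> \<open>Chosen such that \<open>u ^ n = -1\<close>.\<close>
    define u where "u = exp (\<i> * of_real (pi / real n))"
    have "taylor_coeff G = (\<lambda>n. ?a n * u ^ n)"
    proof (rule taylor_coeff_eqI)
      fix z :: complex assume z: "z \<in> unit_disc"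
      then have "u * z \<in> unit_disc" by (simp add: u_def norm_mult)
      from taylor_coeff_sums[OF G this] have "(\<lambda>n. ?a n * (u * z) ^ n) sums G z"
        by (simp only: rot[OF z] u_def)
      then show "(\<lambda>n. ?a n * u ^ n * z ^ n) sums G z" by (simp add: power_mult_distrib mult_ac)
    qed
    then have eq: "?a n = ?a n * u ^ n" by (rule fun_cong)
    have "u ^ n = exp (of_nat n * (\<i> * of_real (pi / real n)))" by (simp only: u_def exp_of_nat_mult)
    also have "of_nat n * (\<i> * of_real (pi / real n)) = \<i> * of_real pi" using n by simp
    also have "exp (\<i> * of_real pi) = (-1 :: complex)" by (simp add: mult.commute)
    finally show ?thesis using eq by simp
  qed
  have "(\<lambda>n. ?a n * z ^ n) sums G z" by (rule taylor_coeff_sums[OF G z])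
  moreover have "(\<lambda>n. ?a n * 0 ^ n) sums G 0" by (rule taylor_coeff_sums[OF G]) simp
  moreover have "(\<lambda>n. ?a n * z ^ n) = (\<lambda>n. ?a n * 0 ^ n)"
    using a0 by (auto simp: fun_eq_iff power_0_left)
  ultimately show ?thesis by (metis sums_unique2)
qed

text \<open>
  A lift of the rotation by the angle \<open>- 2 t\<close>. Its multiplier is the constant matrix \<open>exp (- 2 \<i> t (\<eta> + B))\<close>.
\<close>

definition rotation_lift :: "real \<Rightarrow> (complex^2^2) \<times> complex" where
  "rotation_lift t = (vector [vector [exp (- \<i> * of_real t), 0], vector [0, exp (\<i> * of_real t)]], \<i> * of_real t)"

lemma rotation_lift:
  shows "rotation_lift t \<in> SU11_cover"
    and "moebius (fst (rotation_lift t)) z = exp (- 2 * \<i> * of_real t) * z"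
    and "log_denom (rotation_lift t) z = \<i> * of_real t"
proof -
  show "rotation_lift t \<in> SU11_cover"
    by (simp add: rotation_lift_def SU11_cover_def SU11_def det_2 exp_cnj flip: exp_add)
  have "exp (- 2 * \<i> * of_real t) = exp (- \<i> * of_real t) / exp (\<i> * of_real t)"
    by (simp add: mult.assoc flip: exp_diff)
  then show "moebius (fst (rotation_lift t)) z = exp (- 2 * \<i> * of_real t) * z"
    by (simp add: rotation_lift_def moebius_def mult.assoc)
  show "log_denom (rotation_lift t) z = \<i> * of_real t"
    by (simp add: rotation_lift_def log_denom_def)
qed

text \<open>
  A lift of the transformation \<open>z \<mapsto> (z - w) / (1 - cnj w z)\<close>, in which \<open>d\<close> is positive and its logarithm real.
\<close>

definition translation_lift :: "complex \<Rightarrow> (complex^2^2) \<times> complex" where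
  "translation_lift w = (let d = 1 / sqrt (1 - (norm w)\<^sup>2) in
     (vector [vector [of_real d, - w * of_real d], vector [- cnj w * of_real d, of_real d]], of_real (ln d)))"

lemma translation_lift:
  assumes w: "w \<in> unit_disc"
  defines "d \<equiv> 1 / sqrt (1 - (norm w)\<^sup>2)"
  shows "d > 0" and "translation_lift w \<in> SU11_cover"
    and "moebius (fst (translation_lift w)) w = 0"
    and "moebius (fst (translation_lift w)) 0 = - w"
    and "fst (translation_lift w) $ 2 $ 1 = - cnj w * of_real d"
    and "log_denom (translation_lift w) 0 = of_real (ln d)"
    and "log_denom (translation_lift w) w = - of_real (ln d)"
proof -
  have w1: "(norm w)\<^sup>2 < 1" using w by (simp add: abs_square_less_1)
  then show d: "d > 0" by (simp add: d_def)
  have d2: "d\<^sup>2 * (1 - (norm w)\<^sup>2) = 1" using w1 by (simp add: d_def power_divide)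
  have eq: "translation_lift w = (vector [vector [of_real d, - w * of_real d], vector [- cnj w * of_real d, of_real d]], of_real (ln d))"
    by (simp add: translation_lift_def d_def Let_def)
  have "of_real d * of_real d - (- w * of_real d) * (- cnj w * of_real d) = of_real d * of_real d * (1 - w * cnj w)"
    by (simp add: algebra_simps)
  also have "\<dots> = of_real (d\<^sup>2 * (1 - (norm w)\<^sup>2))"
    by (simp only: of_real_mult of_real_diff of_real_1 complex_norm_square power2_eq_square[of d])
  also have "\<dots> = 1" by (simp only: d2 of_real_1)
  finally have "of_real d * of_real d - (- w * of_real d) * (- cnj w * of_real d) = (1 :: complex)" .
  moreover have "exp (of_real (ln d)) = (of_real d :: complex)" by (simp only: exp_of_real exp_ln[OF d])
  ultimately show "translation_lift w \<in> SU11_cover"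
    by (simp add: eq SU11_cover_def SU11_def det_2)
  show "moebius (fst (translation_lift w)) w = 0" by (simp add: eq moebius_def)
  show "moebius (fst (translation_lift w)) 0 = - w" using d by (simp add: eq moebius_def)
  show "fst (translation_lift w) $ 2 $ 1 = - cnj w * of_real d" by (simp add: eq)
  show "log_denom (translation_lift w) 0 = of_real (ln d)" by (simp add: eq log_denom_def)
  have "1 - (norm w)\<^sup>2 = 1 / d\<^sup>2" using d2 d by (simp add: field_simps)
  then have "ln (1 - (norm w)\<^sup>2) = - 2 * ln d" using d by (simp add: ln_div ln_realpow)
  moreover have "Ln (of_real (1 - (norm w)\<^sup>2)) = of_real (ln (1 - (norm w)\<^sup>2))"
    by (rule Ln_of_real) (use w1 in simp)
  moreover have arg: "1 + - cnj w * of_real d / of_real d * w = of_real (1 - (norm w)\<^sup>2)"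
    using d by (simp only: of_real_diff complex_norm_square of_real_1) simp
  moreover have "log_denom (translation_lift w) w = of_real (ln d) + Ln (1 + - cnj w * of_real d / of_real d * w)"
    by (simp add: eq log_denom_def)
  ultimately show "log_denom (translation_lift w) w = - of_real (ln d)"
    by (simp only: arg) simp
qed

context graded_matrix
begin

definition upper_unipotent :: "complex^'n^'n \<Rightarrow> bool" where
  "upper_unipotent A \<longleftrightarrow> (\<forall>i l. \<beta> l \<le> \<beta> i \<longrightarrow> A $ i $ l = (if i = l then 1 else 0))"

lemma upper_unipotent_mult:
  assumes A: "upper_unipotent A" and B: "upper_unipotent B"
  shows "upper_unipotent (A ** B)"
  unfolding upper_unipotent_def
proof (intro allI impI)
  fix i l assume il: "\<beta> l \<le> \<beta> i"
  have "A $ i $ h * B $ h $ l = (if h = i then B $ i $ l else 0)" for h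
  proof (cases "\<beta> h \<le> \<beta> i")
    case True
    then have "A $ i $ h = (if i = h then 1 else 0)" using A by (simp add: upper_unipotent_def)
    then show ?thesis by simp
  next
    case False
    then have "\<beta> l \<le> \<beta> h" "h \<noteq> l" "h \<noteq> i" using il by auto
    then have "B $ h $ l = 0" using B by (simp add: upper_unipotent_def)
    then show ?thesis using \<open>h \<noteq> i\<close> by simp
  qed
  then have "(A ** B) $ i $ l = B $ i $ l" by (simp add: matrix_matrix_mult_def)
  then show "(A ** B) $ i $ l = (if i = l then 1 else 0)" using B il by (simp add: upper_unipotent_def)
qed

lemma upper_unipotent_expYs: "upper_unipotent (expYs a)"
  unfolding upper_unipotent_def
proof (intro allI impI)
  fix i l assume "\<beta> l \<le> \<beta> i"
  then consider "\<beta> l = \<beta> i" | "\<beta> l < \<beta> i" by linarith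
  then show "expYs a $ i $ l = (if i = l then 1 else 0)"
    by cases (auto simp: expYs_def expY_def path_coeff_same_block path_coeff_eq_0)
qed

lemma upper_unipotent_dpow:
  assumes "upper_unipotent A"
  shows "upper_unipotent (dpow \<eta> (- x) ** A ** dpow \<eta> x)"
  unfolding upper_unipotent_def mult_dpow_nth dpow_mult_nth
  using assms by (auto simp: upper_unipotent_def simp flip: exp_add)

lemma upper_lower_unipotent:
  assumes A: "upper_unipotent A" and B: "upper_unipotent (ctranspose A)"
  shows "A = mat 1"
proof -
  have "A $ i $ l = (if i = l then 1 else 0)" for i l
  proof (cases "\<beta> l \<le> \<beta> i")
    case False
    then have "ctranspose A $ l $ i = (if l = i then 1 else 0)"
      using B unfolding upper_unipotent_def by (metis nle_le)
    then show ?thesis by (auto split: if_splits)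
  qed (use A in \<open>simp add: upper_unipotent_def\<close>)
  then show ?thesis by (simp add: vec_eq_iff mat_def)
qed

text \<open>
  Invariance under rotations makes \<open>K z 0\<close> block upper triangular with identity blocks on the diagonal.
  The transformation that takes \<open>w\<close> to \<open>0\<close> expresses \<open>K 0 w\<close> by \<open>K (- w) 0\<close>, which shows that
  \<open>exp (- cnj w Y) (K w 0)\<^sup>*\<close> is not only lower but also upper triangular. This matrix is therefore the identity, so that
  \<open>K w 0 = exp (w Y\<^sup>*)\<close>. The group acts transitively on the disc, and the values at \<open>w = 0\<close> determine all others.
\<close>

lemma kern_unique:
  assumes inv: "\<And>g z w. g \<in> SU11_cover \<Longrightarrow> z \<in> unit_disc \<Longrightarrow> w \<in> unit_disc \<Longrightarrow>
      multiplier \<beta> \<eta> Y g z ** K (moebius (fst g) z) (moebius (fst g) w)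
           ** ctranspose (multiplier \<beta> \<eta> Y g w) = K z w"
    and herm: "\<And>z w. z \<in> unit_disc \<Longrightarrow> w \<in> unit_disc \<Longrightarrow> ctranspose (K z w) = K w z"
    and hol: "\<And>i l. (\<lambda>z. K z 0 $ i $ l) holomorphic_on unit_disc"
    and K0: "K 0 0 = mat 1"
    and z: "z \<in> unit_disc" and w: "w \<in> unit_disc"
  shows "K z w = kern \<eta> z w"
proof -
  have upper: "upper_unipotent (K z 0)" if z: "z \<in> unit_disc" for z
    unfolding upper_unipotent_def
  proof (intro allI impI)
    fix i l assume il: "\<beta> l \<le> \<beta> i"
    define n where "n = \<beta> i - \<beta> l"
    have n: "real (\<beta> i) = real (\<beta> l) + real n" using il by (simp add: n_def)
    \<comment> \<open>The factor \<open>z ^ n\<close> makes up for the difference of the weights of the two blocks.\<close>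
    define G where "G z = z ^ n * K z 0 $ i $ l" for z
    have rot: "G (exp (\<i> * of_real s) * z) = G z" if z: "z \<in> unit_disc" for s z
    proof -
      define t where "t = - s / 2"
      define u where "u = exp (\<i> * of_real s)"
      let ?g = "rotation_lift t"
      have u: "exp (- 2 * \<i> * of_real t) = u" by (simp add: t_def u_def)
      have J: "multiplier \<beta> \<eta> Y ?g v = dpow \<eta> (\<i> * of_real s)" for v
      proof -
        have "fst ?g $ 2 $ 1 = 0" by (simp add: rotation_lift_def)
        moreover have "- (\<i> * of_real t) + - (\<i> * of_real t) = \<i> * of_real s" by (simp add: t_def)
        ultimately show ?thesis by (simp add: multiplier_eq rotation_lift(3) dpow_add)
      qed
      have "moebius (fst ?g) z = u * z" "moebius (fst ?g) 0 = 0"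
        using rotation_lift(2)[of t] unfolding u by simp_all
      then have "K z 0 = dpow \<eta> (\<i> * of_real s) ** K (u * z) 0 ** dpow \<eta> (- (\<i> * of_real s))"
        using inv[OF rotation_lift(1)[of t] z, of 0] by (simp add: J)
      then have "K z 0 $ i $ l = exp (\<i> * of_real s * of_real (\<eta> + real (\<beta> i))) * K (u * z) 0 $ i $ l
          * exp (- (\<i> * of_real s) * of_real (\<eta> + real (\<beta> l)))"
        by (simp only: mult_dpow_nth dpow_mult_nth)
      also have "\<dots> = exp (\<i> * of_real s * of_real (\<eta> + real (\<beta> i)) + - (\<i> * of_real s) * of_real (\<eta> + real (\<beta> l))) * K (u * z) 0 $ i $ l"
        unfolding exp_add by (simp only: mult_ac)
      also have "\<i> * of_real s * of_real (\<eta> + real (\<beta> i)) + - (\<i> * of_real s) * of_real (\<eta> + real (\<beta> l))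
          = of_nat n * (\<i> * of_real s)" unfolding n by (simp add: algebra_simps)
      also have "exp (of_nat n * (\<i> * of_real s)) = u ^ n" by (simp only: exp_of_nat_mult u_def)
      finally show ?thesis by (simp add: G_def u_def[symmetric] power_mult_distrib mult_ac)
    qed
    have "G holomorphic_on unit_disc" unfolding G_def by (intro holomorphic_intros hol)
    from rotation_invariant_imp_constant[OF this rot z] have G: "G z = G 0" .
    show "K z 0 $ i $ l = (if i = l then 1 else 0)"
    proof (cases "n = 0 \<or> z = 0")
      case True
      then show ?thesis using G by (auto simp: G_def K0 mat_def)
    next
      case False
      then have "i \<noteq> l" by (auto simp: n_def)
      then show ?thesis using G False by (simp add: G_def power_0_left)
    qed
  qed
  have K0_eq: "K w 0 = expYs w" if w: "w \<in> unit_disc" for w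
  proof -
    define d where "d = 1 / sqrt (1 - (norm w)\<^sup>2)"
    define L :: complex where "L = of_real (ln d)"
    let ?g = "translation_lift w"
    note tr = translation_lift[OF w, folded d_def]
    have eL: "exp L = of_real d" by (simp only: L_def exp_of_real exp_ln[OF tr(1)])
    have cL: "cnj L = L" by (simp add: L_def)
    have J0: "multiplier \<beta> \<eta> Y ?g 0 = expY (cnj w) ** dpow \<eta> (- 2 * L)"
    proof -
      have "multiplier \<beta> \<eta> Y ?g 0 = (dpow \<eta> (- L) ** expY (cnj w * of_real d)) ** dpow \<eta> (- L)"
        by (simp add: multiplier_eq tr L_def)
      also have "\<dots> = expY (exp (- L) * (cnj w * of_real d)) ** (dpow \<eta> (- L) ** dpow \<eta> (- L))"
        by (simp add: dpow_expY matrix_mul_assoc)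
      also have "exp (- L) * (cnj w * of_real d) = cnj w" using tr(1) by (simp add: exp_minus eL)
      finally show ?thesis by (simp add: dpow_add)
    qed
    have Jw: "ctranspose (multiplier \<beta> \<eta> Y ?g w) = dpow \<eta> (2 * L) ** expYs (of_real d * (w * of_real d))"
    proof -
      have "ctranspose (multiplier \<beta> \<eta> Y ?g w) = dpow \<eta> L ** (expYs (w * of_real d) ** dpow \<eta> L)"
        by (simp add: multiplier_eq tr ctranspose_matrix_mul ctranspose_expY cL flip: L_def)
      also have "\<dots> = (dpow \<eta> L ** dpow \<eta> L) ** expYs (of_real d * (w * of_real d))"
        unfolding expYs_dpow eL by (simp add: matrix_mul_assoc)
      finally show ?thesis by (simp add: dpow_add)
    qed
    \<comment> \<open>\<open>V\<close> is upper triangular by its definition and lower triangular by \<open>V_eq\<close>.\<close>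
    define V where "V = (dpow \<eta> (- (2 * L)) ** K (- w) 0 ** dpow \<eta> (2 * L)) ** expYs (of_real d * (w * of_real d))"
    have "- w \<in> unit_disc" using w by simp
    then have V: "upper_unipotent V"
      unfolding V_def by (intro upper_unipotent_mult upper_unipotent_dpow upper_unipotent_expYs upper)
    have "expY (cnj w) ** V = K 0 w"
      using inv[OF tr(2) _ w, of 0] unfolding tr(3,4) J0 Jw V_def by (simp add: matrix_mul_assoc)
    then have K0w: "expY (cnj w) ** V = ctranspose (K w 0)" using herm[OF w, of 0] by simp
    then have "expY (- cnj w) ** (expY (cnj w) ** V) = expY (- cnj w) ** ctranspose (K w 0)" by simp
    then have V_eq: "V = expY (- cnj w) ** ctranspose (K w 0)"
      unfolding matrix_mul_assoc expY_add by simp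
    have "ctranspose V = K w 0 ** expYs (- w)"
      unfolding V_eq by (simp add: ctranspose_matrix_mul ctranspose_expY)
    moreover have "upper_unipotent (K w 0 ** expYs (- w))"
      by (intro upper_unipotent_mult upper_unipotent_expYs upper w)
    ultimately have "upper_unipotent (ctranspose V)" by (simp only:)
    then have "V = mat 1" using V by (rule upper_lower_unipotent[rotated])
    then have "ctranspose (ctranspose (K w 0)) = ctranspose (expY (cnj w))" using K0w by simp
    then show ?thesis by (simp add: ctranspose_expY)
  qed
  let ?g = "translation_lift w"
  note tr = translation_lift[OF w]
  have "K (moebius (fst ?g) z) (moebius (fst ?g) w) = kern \<eta> (moebius (fst ?g) z) (moebius (fst ?g) w)"
    unfolding tr(3) using K0_eq[OF moebius_in_disc[OF tr(2) z]] by (simp add: kern_def)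
  then show ?thesis using inv[OF tr(2) z w] kern_invariant[OF tr(2) z w] by simp
qed

lemma taylor_vec_shift:
  assumes f: "f \<in> holomorphic_sections"
  shows "taylor_vec (\<lambda>z. z *s f z) (Suc k) = taylor_vec f k"
proof -
  define x where "x k = (case k of 0 \<Rightarrow> 0 | Suc k' \<Rightarrow> taylor_vec f k')" for k
  have "taylor_vec (\<lambda>z. z *s f z) = x"
  proof (rule taylor_vec_eqI)
    fix z :: complex and i assume z: "z \<in> unit_disc"
    have "epow (k + 1) z (x (k + 1)) $ i = z * epow k z (taylor_vec f k) $ i" for k
      using taylor_vec_in_level[of f k] by (auto simp: epow_def x_def Suc_diff_le level_def not_le)
    then have "(\<lambda>k. epow (k + 1) z (x (k + 1)) $ i) sums (z * f z $ i)"
      using sums_mult[OF taylor_vec_sums[OF f z, of i], of z] by simp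
    then show "(\<lambda>k. epow k z (x k) $ i) sums (z *s f z) $ i"
      by (subst (asm) sums_zero_iff_shift) (auto simp: x_def epow_def)
  next
    fix k show "x k \<in> level k"
      using taylor_vec_in_level[of f "k - 1"] by (auto simp: x_def level_def split: nat.splits)
  qed
  then show ?thesis by (simp add: x_def)
qed

text \<open>
  If the form vanishes at \<open>y\<close>, then by \<open>kernel_bounded_taylor\<close> all Taylor coefficients of weight \<open>k\<close> of all
  members of the space are orthogonal to \<open>y\<close>. Multiplication by a power of the coordinate function raises the
  weight, and it can be chosen such that only the values at \<open>0\<close> in the lowest block that occurs in \<open>y\<close> enter
  the relation. As the values at \<open>0\<close> are arbitrary, this is impossible.
\<close>

lemma kernel_positive:
  assumes "kernel_space S ip K"
    and K: "\<And>z w. z \<in> unit_disc \<Longrightarrow> w \<in> unit_disc \<Longrightarrow> K z w = kern \<eta> z w"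
    and shift: "shift_invariant S" and surj: "evaluations_surjective S"
    and y: "y \<in> level k" "y \<noteq> 0"
  shows "0 < Re (cinner (coeff_mat \<eta> k *v y) y)"
proof (rule ccontr)
  interpret kernel_space S ip K by fact
  assume "\<not> 0 < Re (cinner (coeff_mat \<eta> k *v y) y)"
  then have neg: "Re (cinner (coeff_mat \<eta> k *v y) y) \<le> 0" by simp
  have zero: "cinner (taylor_vec f k) y = 0" if f: "f \<in> S" for f
  proof -
    have "kernel_bounded \<eta> f (Re (ip f f))"
      unfolding kernel_bounded_def
    proof (intro allI impI)
      fix M :: nat and w \<xi> assume w: "\<forall>a<M. w a \<in> unit_disc"
      have "(\<Sum>a<M. \<Sum>b<M. cinner (K (w b) (w a) *v \<xi> a) (\<xi> b)) = (\<Sum>a<M. \<Sum>b<M. cinner (kern \<eta> (w b) (w a) *v \<xi> a) (\<xi> b))"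
        using w K by (intro sum.cong refl) simp
      then show "(norm (\<Sum>a<M. cinner (f (w a)) (\<xi> a)))\<^sup>2
         \<le> Re (ip f f) * Re (\<Sum>a<M. \<Sum>b<M. cinner (kern \<eta> (w b) (w a) *v \<xi> a) (\<xi> b))"
        using evaluation_bound[OF f, of M w \<xi>] w by simp
    qed
    then have "(norm (\<Sum>j<Suc k. cinner (taylor_vec f j) (if j = k then y else 0)))\<^sup>2
       \<le> Re (ip f f) * Re (\<Sum>j<Suc k. cinner (coeff_mat \<eta> j *v (if j = k then y else 0)) (if j = k then y else 0))"
      using f hol y(1) by (intro kernel_bounded_taylor) (auto simp: level_def)
    then have "(norm (cinner (taylor_vec f k) y))\<^sup>2 \<le> Re (ip f f) * Re (cinner (coeff_mat \<eta> k *v y) y)"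
      by simp
    also have "\<dots> \<le> 0" by (rule mult_nonneg_nonpos[OF ip_nonneg[OF f] neg])
    finally show ?thesis by simp
  qed
  have "\<beta> ` {i. y $ i \<noteq> 0} \<noteq> {}" using y(2) by (auto simp: vec_eq_iff)
  then have "Min (\<beta> ` {i. y $ i \<noteq> 0}) \<in> \<beta> ` {i. y $ i \<noteq> 0}" by (intro Min_in) auto
  then obtain j where j1: "y $ j \<noteq> 0" "\<beta> j = Min (\<beta> ` {i. y $ i \<noteq> 0})" by auto
  then have j: "y $ j \<noteq> 0" "\<And>i. y $ i \<noteq> 0 \<Longrightarrow> \<beta> j \<le> \<beta> i" by auto
  have jk: "\<beta> j \<le> k" using y(1) j(1) by (auto simp: level_def not_less intro: ccontr)
  have power_mem: "(\<lambda>z. z ^ n *s f z) \<in> S \<and> taylor_vec (\<lambda>z. z ^ n *s f z) (p + n) = taylor_vec f p"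
    if f: "f \<in> S" for f n p
  proof (induction n)
    case (Suc n)
    let ?F = "\<lambda>z. z ^ n *s f z"
    have eq: "(\<lambda>z. z *s ?F z) = (\<lambda>z. z ^ Suc n *s f z)" by (simp add: vector_smult_assoc)
    have "?F \<in> S" using Suc by simp
    then have "(\<lambda>z. z *s ?F z) \<in> S" by (rule bspec[OF shift[unfolded shift_invariant_def]])
    moreover have "taylor_vec (\<lambda>z. z *s ?F z) (Suc (p + n)) = taylor_vec ?F (p + n)"
      using Suc hol by (intro taylor_vec_shift) auto
    ultimately show ?case using Suc unfolding eq by simp
  qed (use f in \<open>simp add: vector_smult_lid\<close>)
  have "(\<lambda>f. f 0) ` S = UNIV" using surj unfolding evaluations_surjective_def by simp
  then have "y \<in> (\<lambda>f. f 0) ` S" by simp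
  then obtain f where f: "f \<in> S" "f 0 = y" by blast
  have "cinner (taylor_vec f (\<beta> j)) y = 0"
    using zero[of "\<lambda>z. z ^ (k - \<beta> j) *s f z"] power_mem[OF f(1), of "k - \<beta> j" "\<beta> j"] jk by simp
  moreover have "cinner (taylor_vec f (\<beta> j)) y = (\<Sum>i\<in>UNIV. if \<beta> i = \<beta> j then of_real ((norm (y $ i))\<^sup>2) else 0)"
    unfolding cinner_def
  proof (intro sum.cong refl)
    fix i
    consider "y $ i = 0" | "y $ i \<noteq> 0" "\<beta> i = \<beta> j" | "y $ i \<noteq> 0" "\<beta> j < \<beta> i"
      using j(2)[of i] by linarith
    then show "taylor_vec f (\<beta> j) $ i * cnj (y $ i) = (if \<beta> i = \<beta> j then of_real ((norm (y $ i))\<^sup>2) else 0)"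
    proof cases
      case 2
      then have "taylor_vec f (\<beta> j) $ i = y $ i" using f(2) by (simp add: taylor_vec_def taylor_coeff_def)
      then show ?thesis using 2 by (simp add: complex_norm_square del: of_real_power)
    qed (auto simp: taylor_vec_def)
  qed
  ultimately have "(\<Sum>i\<in>UNIV. if \<beta> i = \<beta> j then of_real ((norm (y $ i))\<^sup>2) else (0::complex)) = 0" by simp
  then have "of_real (\<Sum>i\<in>UNIV. if \<beta> i = \<beta> j then (norm (y $ i))\<^sup>2 else 0) = (0::complex)"
    by (simp add: if_distrib cong: if_cong)
  then have "(\<Sum>i\<in>UNIV. if \<beta> i = \<beta> j then (norm (y $ i))\<^sup>2 else 0) = 0" by (simp only: of_real_eq_0_iff)
  then have "\<forall>i\<in>UNIV. (if \<beta> i = \<beta> j then (norm (y $ i))\<^sup>2 else 0) = 0"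
    by (subst (asm) sum_nonneg_eq_0_iff) auto
  from bspec[OF this, of j] show False using j(1) by simp
qed

text \<open>
  Weight 1 and a vector in block 0 give \<open>2 \<eta> > 0\<close>. After that, weight \<open>j\<close> and vectors which correspond to block \<open>j\<close>
  under \<open>coeff_mat_congruence\<close> give the condition for \<open>j\<close>.
\<close>

theorem kernel_imp_conditions:
  assumes m: "range \<beta> = {0..m}"
    and S: "comes_from_kernel_of \<beta> \<eta> Y (mat 1) S" "shift_invariant S"
  shows "0 < \<eta> \<and> (\<forall>j\<in>{1..m}. block_condition \<beta> \<eta> Y j)"
proof -
  obtain h ip K where h: "invariant_hermitian \<beta> \<eta> Y (mat 1) h"
    and hs: "hilbert_space_of_sections S ip" and surj: "evaluations_surjective S"
    and iso: "acts_isometrically \<beta> \<eta> Y S ip" and repr: "reproducing_kernel S ip K"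
    and hK: "\<forall>z\<in>unit_disc. h z = matrix_inv (K z z)"
    using S(1) unfolding comes_from_kernel_of_def by blast
  have ks: "kernel_space S ip K"
    by (intro kernel_space.intro hilbert_space_imp_section_space hs kernel_space_axioms.intro repr)
  interpret kernel_space S ip K by (rule ks)
  have K0: "K 0 0 = mat 1"
  proof -
    have "inj ((*v) (K 0 0))"
    proof (rule injI)
      fix x y assume "K 0 0 *v x = K 0 0 *v y"
      then have "K 0 0 *v (x - y) = 0" by (simp add: matrix_vector_mult_diff_distrib)
      then show "x = y" using kernel_diagonal_injective[OF surj, of 0 "x - y"] by simp
    qed
    then obtain B where "B ** K 0 0 = mat 1" using matrix_left_invertible_injective by blast
    then have B: "K 0 0 ** B = mat 1" using matrix_left_right_inverse by blast
    then have "matrix_inv (K 0 0) = B" by (rule matrix_inv_eqI)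
    moreover have "matrix_inv (K 0 0) = mat 1" using h hK by (simp add: invariant_hermitian_def)
    ultimately have "K 0 0 ** mat 1 = mat 1" using B by simp
    then show ?thesis by (simp only: matrix_mul_rid)
  qed
  have K: "K z w = kern \<eta> z w" if "z \<in> unit_disc" "w \<in> unit_disc" for z w
    by (rule kern_unique[OF isometric_imp_kernel_invariant[OF ks iso] kernel_hermitian kernel_holomorphic K0 that]) auto
  have pos: "0 < Re (cinner (coeff_mat \<eta> k *v y) y)" if "y \<in> level k" "y \<noteq> 0" for k y
    by (rule kernel_positive[OF ks _ S(2) surj that]) (rule K)
  have \<eta>: "\<eta> > 0"
  proof -
    have "0 \<in> range \<beta>" using m by simp
    then obtain i where i: "\<beta> i = 0" by auto
    have "axis i 1 \<in> level 1" using i by (auto simp: level_def axis_def)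
    moreover have "axis i 1 \<noteq> (0 :: complex^'n)" by (auto simp: vec_eq_iff axis_def)
    ultimately have "0 < Re (cinner (coeff_mat \<eta> 1 *v axis i 1) (axis i 1))" by (rule pos)
    also have "cinner (coeff_mat \<eta> 1 *v axis i 1) (axis i 1) = coeff_mat \<eta> 1 $ i $ i"
      by (simp add: cinner_axis mult_axis_nth)
    also have "\<dots> = (\<Sum>h\<in>UNIV. if h = i then of_real (2 * \<eta>) else 0)"
    proof -
      have "of_real (kernel_coeff \<eta> 1 (\<beta> i) (\<beta> i) (\<beta> h)) * (path_coeff i h * cnj (path_coeff i h)) = (if h = i then of_real (2 * \<eta>) else 0)" for h
        using i by (cases "\<beta> h = 0") (auto simp: path_coeff_same_block path_coeff_eq_0 kernel_coeff_def)
      then show ?thesis using i by (simp add: coeff_mat_def)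
    qed
    finally show ?thesis by simp
  qed
  have "0 < Re (cinner (block_mat \<eta> *v block_part j x) (block_part j x))" if "block_part j x \<noteq> 0" for j x
  proof -
    have "block_part j x \<in> level j" by (auto simp: level_def block_part_def)
    then have "inversion_mat \<eta> j *v block_part j x \<noteq> 0" using inversion_mat_injective that by blast
    then have "0 < Re (cinner (coeff_mat \<eta> j *v (inversion_mat \<eta> j *v block_part j x)) (inversion_mat \<eta> j *v block_part j x))"
      by (intro pos inversion_mat_in_level)
    then show ?thesis by (simp only: cinner_block_mat_block_part[OF \<eta>])
  qed
  then show ?thesis using \<eta> block_conditions_iff[OF m] by blast
qed

end

section \<open>Dependence on the parameter\<close>

context graded_matrix
begin

lemma level_subspace:
  "0 \<in> level k" "x \<in> level k \<Longrightarrow> y \<in> level k \<Longrightarrow> x + y \<in> level k"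
  "x \<in> level k \<Longrightarrow> y \<in> level k \<Longrightarrow> x - y \<in> level k"
  "x \<in> level k \<Longrightarrow> a *s x \<in> level k"
  by (auto simp: level_def)

lemma closed_level: "closed (level k)"
proof -
  have "level k = (\<Inter>i\<in>{i. k < \<beta> i}. {x. x $ i = 0})" by (auto simp: level_def)
  moreover have "closed {x :: complex^'n. x $ i = 0}" for i
    by (intro closed_Collect_eq continuous_intros)
  ultimately show ?thesis by auto
qed

lemma level_mono: "x \<in> level k \<Longrightarrow> k \<le> j \<Longrightarrow> x \<in> level j"
  by (auto simp: level_def)

lemma level_UNIV: "level (Max (range \<beta>)) = UNIV"
  by (auto simp: level_def not_less)

text \<open>
  The unit sphere of the level is compact.
\<close>

lemma positive_lower_bound:
  fixes A :: "complex^'n^'n"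
  assumes pos: "\<And>x. x \<in> level k \<Longrightarrow> x \<noteq> 0 \<Longrightarrow> 0 < Re (cinner (A *v x) x)"
  shows "\<exists>c>0. \<forall>x\<in>level k. c * (norm x)\<^sup>2 \<le> Re (cinner (A *v x) x)"
proof -
  define D where "D = {x \<in> level k. norm x = 1}"
  have "compact D"
  proof -
    have "D = level k \<inter> sphere 0 1" by (auto simp: D_def)
    then show ?thesis using closed_level compact_sphere closed_Int_compact by metis
  qed
  have hom: "Re (cinner (A *v (of_real t *s x)) (of_real t *s x)) = t\<^sup>2 * Re (cinner (A *v x) x)" for t x
    by (simp add: vector_scalar_commute cinner_scale_left cinner_scale_right power2_eq_square mult.assoc)
  have unit: "of_real (1 / norm x) *s x \<in> D" if "x \<in> level k" "x \<noteq> 0" for x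
  proof -
    have "of_real t *s x = t *\<^sub>R x" for t :: real
      by (simp add: vec_eq_iff scaleR_conv_of_real[where 'a = complex])
    then have "norm (of_real (1 / norm x) *s x) = 1" using that(2) by (simp only:) simp
    then show ?thesis using level_subspace(4)[OF that(1)] unfolding D_def by blast
  qed
  show ?thesis
  proof (cases "D = {}")
    case True
    then have "x = 0" if "x \<in> level k" for x using unit that by blast
    then show ?thesis by (intro exI[of _ 1]) force
  next
    case False
    have "continuous_on D (\<lambda>x. Re (cinner (A *v x) x))"
      unfolding cinner_mult by (intro continuous_intros)
    then obtain x0 where x0: "x0 \<in> D" "\<And>x. x \<in> D \<Longrightarrow> Re (cinner (A *v x0) x0) \<le> Re (cinner (A *v x) x)"
      using continuous_attains_inf[OF \<open>compact D\<close> False] by blast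
    let ?c = "Re (cinner (A *v x0) x0)"
    have "x0 \<in> level k" "x0 \<noteq> 0" using x0(1) by (auto simp: D_def)
    then have c: "?c > 0" by (rule pos)
    have "?c * (norm x)\<^sup>2 \<le> Re (cinner (A *v x) x)" if "x \<in> level k" for x
    proof (cases "x = 0")
      case False
      have "?c \<le> Re (cinner (A *v (of_real (1 / norm x) *s x)) (of_real (1 / norm x) *s x))"
        by (rule x0(2)[OF unit[OF that False]])
      also have "\<dots> = (1 / norm x)\<^sup>2 * Re (cinner (A *v x) x)" by (rule hom)
      finally show ?thesis using False by (simp add: power_divide field_simps)
    qed simp
    then show ?thesis using c by blast
  qed
qed

lemma tendsto_inversion_coeff:
  assumes \<eta>: "\<eta> > 0"
  shows "((\<lambda>e. inversion_coeff (\<eta> - e) j k) \<longlongrightarrow> inversion_coeff \<eta> j k) (at_right 0)"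
proof (cases "k < j")
  case True
  have lim: "((\<lambda>e. pochhammer (2 * (\<eta> - e) + real j + real k - 1) (j - k)) \<longlongrightarrow>
      pochhammer (2 * (\<eta> - 0) + real j + real k - 1) (j - k)) (at_right 0)"
    unfolding pochhammer_prod by (intro tendsto_intros)
  have "pochhammer (2 * \<eta> + real j + real k - 1) (j - k) > 0"
    using \<eta> True by (intro pochhammer_pos) simp
  then have nz: "fact (j - k) * pochhammer (2 * (\<eta> - 0) + real j + real k - 1) (j - k) \<noteq> 0" by simp
  have "((\<lambda>e. inversion_coeff (\<eta> - e) j k) \<longlongrightarrow> inversion_coeff (\<eta> - 0) j k) (at_right 0)"
    unfolding inversion_coeff_def by (intro tendsto_intros lim nz)
  then show ?thesis by simp
qed (simp add: inversion_coeff_def)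

text \<open>
  The entries depend continuously on the parameter, since the Pochhammer symbols in the denominators stay
  positive.
\<close>

lemma block_mat_positive_definite_open:
  assumes \<eta>: "\<eta> > 0" and N: "positive_definite (block_mat \<eta>)"
  shows "\<exists>\<epsilon>. 0 < \<epsilon> \<and> \<epsilon> < \<eta> \<and> positive_definite (block_mat (\<eta> - \<epsilon>))"
proof -
  have pos: "0 < Re (cinner (block_mat \<eta> *v x) x)" if "x \<in> level (Max (range \<beta>))" "x \<noteq> 0" for x
    using N that by (simp add: positive_definite_def)
  have "\<exists>c>0. \<forall>x\<in>level (Max (range \<beta>)). c * (norm x)\<^sup>2 \<le> Re (cinner (block_mat \<eta> *v x) x)"
    by (rule positive_lower_bound) (rule pos)
  then obtain c where c: "c > 0" "\<And>x. c * (norm x)\<^sup>2 \<le> Re (cinner (block_mat \<eta> *v x) x)"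
    unfolding level_UNIV by auto
  define g where "g e = (\<Sum>i\<in>UNIV. \<Sum>l\<in>UNIV. norm (block_mat (\<eta> - e) $ i $ l - block_mat \<eta> $ i $ l))" for e
  have lim: "((\<lambda>e. block_mat (\<eta> - e) $ i $ l) \<longlongrightarrow> block_mat \<eta> $ i $ l) (at_right 0)" for i l
    unfolding block_mat_def by (cases "\<beta> i = \<beta> l") (auto intro!: tendsto_intros tendsto_inversion_coeff[OF \<eta>])
  have "((\<lambda>e. block_mat (\<eta> - e) $ i $ l - block_mat \<eta> $ i $ l) \<longlongrightarrow> block_mat \<eta> $ i $ l - block_mat \<eta> $ i $ l) (at_right 0)" for i l
    by (rule tendsto_diff[OF lim tendsto_const])
  then have "(g \<longlongrightarrow> (\<Sum>i\<in>UNIV. \<Sum>l\<in>UNIV. norm (block_mat \<eta> $ i $ l - block_mat \<eta> $ i $ l))) (at_right 0)"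
    unfolding g_def by (intro tendsto_sum tendsto_norm)
  then have "(g \<longlongrightarrow> 0) (at_right 0)" by simp
  then have "eventually (\<lambda>e. g e < c) (at_right 0)" using c(1) by (rule order_tendstoD)
  moreover have "eventually (\<lambda>e. e \<in> {0<..<\<eta>}) (at_right 0)" by (rule eventually_at_right_real[OF \<eta>])
  ultimately have "eventually (\<lambda>e. g e < c \<and> e \<in> {0<..<\<eta>}) (at_right 0)" by (rule eventually_conj)
  then obtain e where e: "g e < c" "0 < e" "e < \<eta>"
    using eventually_happens'[of "at_right (0::real)"] trivial_limit_at_right_real by auto
  have "0 < Re (cinner (block_mat (\<eta> - e) *v x) x)" if x: "x \<noteq> 0" for x
  proof -
    define D where "D = block_mat (\<eta> - e) - block_mat \<eta>"
    have "norm (cinner (D *v x) x) \<le> (\<Sum>i\<in>UNIV. \<Sum>l\<in>UNIV. norm (D $ i $ l) * (norm x)\<^sup>2)"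
      unfolding cinner_mult
    proof (intro sum_norm_le)
      fix i l
      have "norm (x $ l) * norm (x $ i) \<le> norm x * norm x"
        by (intro mult_mono Finite_Cartesian_Product.norm_nth_le) auto
      then have "norm (D $ i $ l) * (norm (x $ l) * norm (x $ i)) \<le> norm (D $ i $ l) * (norm x)\<^sup>2"
        unfolding power2_eq_square by (rule mult_left_mono) simp
      then show "norm (D $ i $ l * x $ l * cnj (x $ i)) \<le> norm (D $ i $ l) * (norm x)\<^sup>2"
        by (simp add: norm_mult mult.assoc)
    qed
    also have "\<dots> = g e * (norm x)\<^sup>2" by (simp add: g_def D_def sum_distrib_right)
    also have "\<dots> < c * (norm x)\<^sup>2" using e x by (intro mult_strict_right_mono) auto
    finally have "norm (cinner (D *v x) x) < c * (norm x)\<^sup>2" .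
    moreover have "\<bar>Re (cinner (D *v x) x)\<bar> \<le> norm (cinner (D *v x) x)" by (rule abs_Re_le_cmod)
    moreover have "cinner (block_mat (\<eta> - e) *v x) x = cinner (block_mat \<eta> *v x) x + cinner (D *v x) x"
      by (simp add: D_def matrix_vector_mult_diff_rdistrib cinner_diff_left)
    ultimately show ?thesis using c(2)[of x] by simp
  qed
  then have "positive_definite (block_mat (\<eta> - e))"
    by (simp add: positive_definite_def block_mat_hermitian)
  then show ?thesis using e by blast
qed

text \<open>
  Vandermonde's identity for the coefficients of
  \<open>(1 - u)\<^bsup>- (a + b)\<^esup> = (1 - u)\<^sup>-\<^sup>a (1 - u)\<^sup>-\<^sup>b\<close>.
\<close>

lemma kernel_coeff_Vandermonde:
  assumes i: "i \<le> p" "i \<le> q"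
  shows "kernel_coeff \<eta> k p q i
       = (\<Sum>n\<le>k. pochhammer (2 * \<epsilon>) n / fact n * kernel_coeff (\<eta> - \<epsilon>) (k - n) p q i)"
proof (cases "p + q \<le> k + i")
  case True
  define N where "N = k + i - p - q"
  define a where "a = 2 * (\<eta> - \<epsilon>) + real p + real q"
  have Nk: "N \<le> k" using i by (simp add: N_def)
  have "(\<Sum>n\<le>k. pochhammer (2 * \<epsilon>) n / fact n * kernel_coeff (\<eta> - \<epsilon>) (k - n) p q i)
      = (\<Sum>n\<le>N. pochhammer (2 * \<epsilon>) n / fact n * kernel_coeff (\<eta> - \<epsilon>) (k - n) p q i)"
  proof (intro sum.mono_neutral_right ballI)
    fix n assume "n \<in> {..k} - {..N}"
    then have "\<not> p + q \<le> k - n + i" using True by (auto simp: N_def)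
    then show "pochhammer (2 * \<epsilon>) n / fact n * kernel_coeff (\<eta> - \<epsilon>) (k - n) p q i = 0"
      by (simp add: kernel_coeff_def)
  qed (use Nk in auto)
  also have "\<dots> = (\<Sum>n\<le>N. real (N choose n) * pochhammer (2 * \<epsilon>) n * pochhammer a (N - n)) / (fact N * fact (p - i) * fact (q - i))"
    unfolding sum_divide_distrib
  proof (intro sum.cong refl)
    fix n assume n: "n \<in> {..N}"
    then have "p + q \<le> k - n + i" "k - n + i - p - q = N - n" using True Nk by (auto simp: N_def)
    then have "kernel_coeff (\<eta> - \<epsilon>) (k - n) p q i = pochhammer a (N - n) / (fact (N - n) * fact (p - i) * fact (q - i))"
      by (simp add: kernel_coeff_def a_def)
    then show "pochhammer (2 * \<epsilon>) n / fact n * kernel_coeff (\<eta> - \<epsilon>) (k - n) p q i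
        = real (N choose n) * pochhammer (2 * \<epsilon>) n * pochhammer a (N - n) / (fact N * fact (p - i) * fact (q - i))"
      using n by (simp add: binomial_fact)
  qed
  also have "(\<Sum>n\<le>N. real (N choose n) * pochhammer (2 * \<epsilon>) n * pochhammer a (N - n)) = pochhammer (2 * \<epsilon> + a) N"
    by (simp add: pochhammer_binomial_sum)
  also have "2 * \<epsilon> + a = 2 * \<eta> + real p + real q" by (simp add: a_def)
  also have "pochhammer (2 * \<eta> + real p + real q) N / (fact N * fact (p - i) * fact (q - i)) = kernel_coeff \<eta> k p q i"
    unfolding N_def kernel_coeff_def using True by (simp only: if_True)
  finally show ?thesis ..
next
  case False
  then have "kernel_coeff (\<eta> - \<epsilon>) (k - n) p q i = 0" if "n \<le> k" for n
    using that by (auto simp: kernel_coeff_def)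
  then show ?thesis using False by (simp add: kernel_coeff_def)
qed

text \<open>
  The kernel for \<open>\<eta>\<close> is the kernel for \<open>\<eta> - \<epsilon>\<close> times the scalar function \<open>(1 - z cnj w)\<^bsup>- 2 \<epsilon>\<^esup>\<close>.
\<close>

lemma coeff_mat_decompose:
  "coeff_mat \<eta> k = (\<Sum>n\<le>k. (pochhammer (2 * \<epsilon>) n / fact n) *\<^sub>R coeff_mat (\<eta> - \<epsilon>) (k - n))"
proof -
  have entry: "coeff_mat \<eta> k $ i $ l = (\<Sum>h\<in>UNIV. of_real (kernel_coeff \<eta> k (\<beta> i) (\<beta> l) (\<beta> h)) * (path_coeff i h * cnj (path_coeff l h)))"
    for \<eta> k i l
  proof (cases "\<beta> i \<le> k \<and> \<beta> l \<le> k")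
    case False
    have z: "of_real (kernel_coeff \<eta> k (\<beta> i) (\<beta> l) (\<beta> h)) * (path_coeff i h * cnj (path_coeff l h)) = 0" for h
    proof (cases "\<beta> h \<le> \<beta> i \<and> \<beta> h \<le> \<beta> l")
      case True
      then have "\<not> \<beta> i + \<beta> l \<le> k + \<beta> h" using False by linarith
      then show ?thesis by (simp add: kernel_coeff_def)
    qed (auto simp: path_coeff_eq_0 not_le)
    then have "(\<Sum>h\<in>UNIV. of_real (kernel_coeff \<eta> k (\<beta> i) (\<beta> l) (\<beta> h)) * (path_coeff i h * cnj (path_coeff l h))) = 0"
      by (intro sum.neutral ballI z)
    then show ?thesis using False by (simp add: coeff_mat_def del: of_real_mult mult_eq_0_iff)
  qed (simp add: coeff_mat_def)
  have "coeff_mat \<eta> k $ i $ l = (\<Sum>n\<le>k. (pochhammer (2 * \<epsilon>) n / fact n) *\<^sub>R coeff_mat (\<eta> - \<epsilon>) (k - n) $ i $ l)" for i l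
  proof -
    have "coeff_mat \<eta> k $ i $ l = (\<Sum>h\<in>UNIV. \<Sum>n\<le>k. of_real (pochhammer (2 * \<epsilon>) n / fact n)
        * (of_real (kernel_coeff (\<eta> - \<epsilon>) (k - n) (\<beta> i) (\<beta> l) (\<beta> h)) * (path_coeff i h * cnj (path_coeff l h))))"
      unfolding entry
    proof (intro sum.cong refl)
      fix h
      show "of_real (kernel_coeff \<eta> k (\<beta> i) (\<beta> l) (\<beta> h)) * (path_coeff i h * cnj (path_coeff l h))
        = (\<Sum>n\<le>k. of_real (pochhammer (2 * \<epsilon>) n / fact n)
        * (of_real (kernel_coeff (\<eta> - \<epsilon>) (k - n) (\<beta> i) (\<beta> l) (\<beta> h)) * (path_coeff i h * cnj (path_coeff l h))))"
      proof (cases "\<beta> h \<le> \<beta> i \<and> \<beta> h \<le> \<beta> l")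
        case True
        then show ?thesis
          by (subst kernel_coeff_Vandermonde[of "\<beta> h" "\<beta> i" "\<beta> l" \<eta> k \<epsilon>]) (auto simp: sum_distrib_right sum_distrib_left mult_ac)
      qed (auto simp: path_coeff_eq_0 not_le)
    qed
    also have "\<dots> = (\<Sum>n\<le>k. of_real (pochhammer (2 * \<epsilon>) n / fact n) * coeff_mat (\<eta> - \<epsilon>) (k - n) $ i $ l)"
      unfolding entry by (subst sum.swap) (simp add: sum_distrib_left)
    finally show ?thesis by (simp add: scaleR_conv_of_real[where 'a = complex])
  qed
  then show ?thesis by (simp add: vec_eq_iff)
qed

definition level_part :: "nat \<Rightarrow> complex^'n \<Rightarrow> complex^'n" where
  "level_part k x = (\<chi> i. if \<beta> i \<le> k then x $ i else 0)"

lemma cinner_coeff_mat_level_part: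
  "cinner (coeff_mat \<eta> k *v level_part k x) (level_part k y) = cinner (coeff_mat \<eta> k *v x) y"
  unfolding cinner_mult by (intro sum.cong refl) (auto simp: level_part_def coeff_mat_def)

lemma coeff_mat_nonneg:
  assumes "\<And>x. x \<in> level k \<Longrightarrow> x \<noteq> 0 \<Longrightarrow> 0 < Re (cinner (coeff_mat \<eta> k *v x) x)"
  shows "0 \<le> Re (cinner (coeff_mat \<eta> k *v x) x)"
proof -
  have "level_part k x \<in> level k" by (simp add: level_part_def level_def)
  then have "0 \<le> Re (cinner (coeff_mat \<eta> k *v level_part k x) (level_part k x))"
    using assms[of "level_part k x"] by (cases "level_part k x = 0") auto
  then show ?thesis by (simp only: cinner_coeff_mat_level_part)
qed

text \<open>
  This will give invariance under multiplication by the coordinate function. Choose \<open>\<epsilon>\<close> such that the condition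
  still holds for \<open>\<eta> - \<epsilon>\<close>, so that the matrices for \<open>\<eta> - \<epsilon>\<close> are positive. From one weight to the next, the scalar
  coefficients in \<open>coeff_mat_decompose\<close> shrink at most by the factor \<open>min 1 (2 \<epsilon>)\<close>.
\<close>

lemma coeff_mat_dominated:
  assumes \<eta>: "\<eta> > 0" and N: "positive_definite (block_mat \<eta>)"
  shows "\<exists>C\<ge>0. \<forall>k x. Re (cinner (coeff_mat \<eta> k *v x) x) \<le> C * Re (cinner (coeff_mat \<eta> (Suc k) *v x) x)"
proof -
  obtain \<epsilon> where \<epsilon>: "0 < \<epsilon>" "\<epsilon> < \<eta>" "positive_definite (block_mat (\<eta> - \<epsilon>))"
    using block_mat_positive_definite_open[OF assms] by blast
  define r where "r n = pochhammer (2 * \<epsilon>) n / fact n" for n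
  define \<delta> where "\<delta> = min 1 (2 * \<epsilon>)"
  define Q where "Q k x = Re (cinner (coeff_mat (\<eta> - \<epsilon>) k *v x) x)" for k x
  have \<delta>: "\<delta> > 0" using \<epsilon> by (simp add: \<delta>_def)
  have r0: "r n > 0" for n unfolding r_def using \<epsilon> by (intro divide_pos_pos pochhammer_pos) auto
  have Q0: "Q k x \<ge> 0" for k x
    unfolding Q_def using \<epsilon> by (intro coeff_mat_nonneg coeff_mat_positive) auto
  have rS: "\<delta> * r n \<le> r (Suc n)" for n
  proof -
    have "\<delta> * real (Suc n) \<le> 2 * \<epsilon> + real n"
    proof -
      have "\<delta> * real n \<le> 1 * real n" "\<delta> \<le> 2 * \<epsilon>" by (intro mult_right_mono) (auto simp: \<delta>_def)
      then show ?thesis by (simp add: algebra_simps)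
    qed
    then have "r n * (\<delta> * real (Suc n)) \<le> r n * (2 * \<epsilon> + real n)"
      using r0[of n] by (intro mult_left_mono) auto
    also have "\<dots> = r (Suc n) * real (Suc n)" by (simp add: r_def pochhammer_Suc fact_Suc divide_simps del: of_nat_Suc)
    finally have "(\<delta> * r n) * real (Suc n) \<le> r (Suc n) * real (Suc n)" by (simp only: mult_ac)
    then show ?thesis by (rule mult_right_le_imp_le) simp
  qed
  have A: "Re (cinner (coeff_mat \<eta> k *v x) x) = (\<Sum>n\<le>k. r n * Q (k - n) x)" for k x
  proof -
    have lin: "cinner ((\<Sum>n\<in>I. s n *\<^sub>R B n) *v x) x = (\<Sum>n\<in>I. of_real (s n) * cinner (B n *v x) x)"
      if "finite I" for I :: "nat set" and s and B :: "nat \<Rightarrow> complex^'n^'n"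
      using that by (induction I rule: finite_induct)
        (simp_all add: matrix_vector_mult_add_rdistrib cinner_add_left, simp_all add: cinner_mult scaleR_conv_of_real[where 'a = complex] sum_distrib_left mult.assoc)
    have "coeff_mat \<eta> k = (\<Sum>n\<le>k. r n *\<^sub>R coeff_mat (\<eta> - \<epsilon>) (k - n))"
      unfolding r_def by (rule coeff_mat_decompose)
    then show ?thesis unfolding Q_def by (simp add: lin)
  qed
  have "Re (cinner (coeff_mat \<eta> k *v x) x) \<le> 1 / \<delta> * Re (cinner (coeff_mat \<eta> (Suc k) *v x) x)" for k x
  proof -
    have "\<delta> * Re (cinner (coeff_mat \<eta> k *v x) x) = (\<Sum>n\<le>k. \<delta> * r n * Q (k - n) x)"
      by (simp add: A sum_distrib_left mult.assoc)
    also have "\<dots> \<le> (\<Sum>n\<le>k. r (Suc n) * Q (Suc k - Suc n) x)"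
      by (intro sum_mono) (simp add: mult_right_mono rS Q0)
    also have "\<dots> \<le> r 0 * Q (Suc k - 0) x + \<dots>" using r0[of 0] Q0 by simp
    also have "\<dots> = (\<Sum>n\<le>Suc k. r n * Q (Suc k - n) x)" by (simp only: sum.atMost_Suc_shift)
    finally have "\<delta> * Re (cinner (coeff_mat \<eta> k *v x) x) \<le> Re (cinner (coeff_mat \<eta> (Suc k) *v x) x)"
      by (simp only: A)
    then show ?thesis using \<delta> by (simp add: field_simps)
  qed
  then show ?thesis using \<delta> by (intro exI[of _ "1 / \<delta>"]) auto
qed

end

section \<open>Semidefinite forms and the group action\<close>

text \<open>
  The form is nonnegative at \<open>x - s c y\<close> for all real \<open>s\<close>, where \<open>c\<close> is the mixed term.
\<close>

lemma semidefinite_Cauchy_Schwarz: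
  fixes A :: "complex^'n^'n"
  assumes herm: "ctranspose A = A" and nonneg: "\<And>x. 0 \<le> Re (cinner (A *v x) x)"
  shows "(norm (cinner (A *v x) y))\<^sup>2 \<le> Re (cinner (A *v x) x) * Re (cinner (A *v y) y)"
proof -
  define a where "a = Re (cinner (A *v x) x)"
  define b where "b = Re (cinner (A *v y) y)"
  define c where "c = cinner (A *v x) y"
  have yx: "cinner (A *v y) x = cnj c"
    unfolding c_def cnj_cinner by (subst cinner_ctranspose) (simp add: herm)
  have ab: "a \<ge> 0" "b \<ge> 0" using nonneg by (auto simp: a_def b_def)
  have key: "0 \<le> a - 2 * s * (norm c)\<^sup>2 + s\<^sup>2 * (norm c)\<^sup>2 * b" for s :: real
  proof -
    define t where "t = of_real s * c"
    define N where "N = (norm c)\<^sup>2"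
    have N: "c * cnj c = of_real N" by (simp only: N_def complex_norm_square)
    have t: "cnj t * c = of_real s * (c * cnj c)" "t * cnj c = of_real s * (c * cnj c)"
      "t * cnj t = of_real s * of_real s * (c * cnj c)" by (simp_all add: t_def)
    have "cinner (A *v (x - t *s y)) (x - t *s y)
        = cinner (A *v x) x - cnj t * c - t * cnj c + t * cnj t * cinner (A *v y) y"
      by (simp add: matrix_vector_mult_diff_distrib vector_scalar_commute cinner_diff_left cinner_diff_right
          cinner_scale_left cinner_scale_right yx c_def[symmetric] algebra_simps)
    then have "cinner (A *v (x - t *s y)) (x - t *s y)
        = cinner (A *v x) x - of_real (2 * s * N) + of_real (s\<^sup>2 * N) * cinner (A *v y) y"
      unfolding t N by (simp add: power2_eq_square)
    then show ?thesis using nonneg[of "x - t *s y"] by (simp add: a_def b_def flip: N_def)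
  qed
  have "(norm c)\<^sup>2 \<le> a * b"
  proof (cases "b = 0")
    case True
    have "(norm c)\<^sup>2 = 0"
    proof (rule ccontr)
      assume nz: "(norm c)\<^sup>2 \<noteq> 0"
      have "0 \<le> a - 2 * ((a + 1) / (2 * (norm c)\<^sup>2)) * (norm c)\<^sup>2" using key[of "(a + 1) / (2 * (norm c)\<^sup>2)"] True by simp
      also have "\<dots> = -1" using nz by (simp add: field_simps)
      finally show False by simp
    qed
    then show ?thesis using ab by simp
  next
    case False
    then have "b > 0" using ab by simp
    then show ?thesis using key[of "1 / b"] by (simp add: field_simps power2_eq_square)
  qed
  then show ?thesis by (simp add: a_def b_def c_def)
qed

lemma arith_geo_mean_norm:
  assumes "(norm c)\<^sup>2 \<le> a * b" "0 \<le> a" "0 \<le> b"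
  shows "norm c \<le> (a + b) / 2"
proof (rule power2_le_imp_le)
  have "0 \<le> (a - b)\<^sup>2" by simp
  then have "a * b \<le> ((a + b) / 2)\<^sup>2" by (simp add: power2_eq_square field_simps)
  then show "(norm c)\<^sup>2 \<le> ((a + b) / 2)\<^sup>2" using assms(1) by simp
qed (use assms in simp)

lemma (in section_space) ip_self_eq_0:
  assumes f: "f \<in> S" and 0: "Re (ip f f) = 0"
  shows "f = (\<lambda>z. 0)"
proof (rule ccontr)
  assume "f \<noteq> (\<lambda>z. 0)"
  then have "0 < Re (ip f f)" by (rule ip_pos[OF f])
  then show False using 0 by simp
qed

lemma (in section_space) ip_norm_triangle:
  assumes f: "f \<in> S" and g: "g \<in> S"
  shows "ip_norm ip (\<lambda>z. f z + g z) \<le> ip_norm ip f + ip_norm ip g"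
proof (rule power2_le_imp_le)
  have fg: "(\<lambda>z. f z + g z) \<in> S" by (rule add[OF f g])
  have nn: "ip_norm ip f \<ge> 0" "ip_norm ip g \<ge> 0" by (simp_all add: ip_norm_def ip_nonneg f g)
  have "(norm (ip f g))\<^sup>2 \<le> (ip_norm ip f * ip_norm ip g)\<^sup>2"
    using Cauchy_Schwarz[OF f g] by (simp add: power_mult_distrib ip_norm_power2 f g)
  then have "norm (ip f g) \<le> ip_norm ip f * ip_norm ip g"
    by (rule power2_le_imp_le) (use nn in simp)
  then have "Re (ip f g) \<le> ip_norm ip f * ip_norm ip g" using complex_Re_le_cmod order_trans by blast
  moreover have "Re (ip (\<lambda>z. f z + g z) (\<lambda>z. f z + g z)) = Re (ip f f) + Re (ip g g) + 2 * Re (ip f g)"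
    using ip_add[OF f g fg] ip_add_right[OF f g f] ip_add_right[OF f g g] ip_cnj[OF f g] by simp
  ultimately show "(ip_norm ip (\<lambda>z. f z + g z))\<^sup>2 \<le> (ip_norm ip f + ip_norm ip g)\<^sup>2"
    using ip_norm_power2[OF fg] ip_norm_power2[OF f] ip_norm_power2[OF g] by (simp add: power2_sum)
  show "0 \<le> ip_norm ip f + ip_norm ip g" using nn by simp
qed

lemma holomorphic_sections_linear:
  fixes f g :: "complex \<Rightarrow> complex^'n"
  assumes f: "f \<in> holomorphic_sections"
  shows "g \<in> holomorphic_sections \<Longrightarrow> (\<lambda>z. f z + g z) \<in> holomorphic_sections"
    and "(\<lambda>z. a *s f z) \<in> holomorphic_sections"
proof -
  have out: "h z = 0" if "h \<in> holomorphic_sections" "z \<notin> unit_disc" for h :: "complex \<Rightarrow> complex^'n" and z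
  proof -
    have "on_disc h = h" using that by (simp add: holomorphic_sections_def)
    from fun_cong[OF this, of z] show ?thesis by (simp only: on_disc_out[OF that(2)])
  qed
  show "(\<lambda>z. f z + g z) \<in> holomorphic_sections" if g: "g \<in> holomorphic_sections"
  proof -
    have "on_disc (\<lambda>z. f z + g z) = (\<lambda>z. f z + g z)"
      using out[OF f] out[OF g] by (auto simp: on_disc_def fun_eq_iff)
    then show ?thesis using f g by (auto simp: holomorphic_sections_def intro!: holomorphic_intros)
  qed
  have "on_disc (\<lambda>z. a *s f z) = (\<lambda>z. a *s f z)"
    using out[OF f] by (auto simp: on_disc_def fun_eq_iff)
  then show "(\<lambda>z. a *s f z) \<in> holomorphic_sections"
    using f by (auto simp: holomorphic_sections_def intro!: holomorphic_intros)
qed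

lemma cover_inverse_cover_inverse:
  assumes g: "g \<in> SU11_cover"
  shows "cover_inverse (cover_inverse g) = g"
  by (simp add: cover_inverse_def prod_eq_iff vec_eq_iff forall_2)

lemma holomorphic_log_denom:
  assumes g: "g \<in> SU11_cover"
  shows "log_denom g holomorphic_on unit_disc"
proof -
  have "1 + fst g $ 2 $ 1 / fst g $ 2 $ 2 * z \<notin> \<real>\<^sub>\<le>\<^sub>0" if "z \<in> unit_disc" for z
    using exp_log_denom(3)[OF g that] by (auto simp: complex_nonpos_Reals_iff)
  then show ?thesis unfolding log_denom_def[abs_def] by (intro holomorphic_intros) auto
qed

lemma holomorphic_moebius:
  assumes g: "g \<in> SU11_cover"
  shows "moebius (fst g) holomorphic_on unit_disc"
  unfolding moebius_def[abs_def] by (intro holomorphic_intros exp_log_denom(2)[OF g])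

lemma holomorphic_multiplier:
  assumes g: "g \<in> SU11_cover"
  shows "(\<lambda>z. multiplier \<beta> \<eta> Y g z $ i $ l) holomorphic_on unit_disc"
  unfolding multiplier_def deriv_power_def Let_def vec_lambda_beta
  using holomorphic_log_denom[OF g] by (cases "\<beta> l \<le> \<beta> i") (auto intro!: holomorphic_intros)

section \<open>The Hilbert space of a positive kernel\<close>

text \<open>
  In this situation \<open>kern \<eta>\<close> is the reproducing kernel of a Hilbert space, which is constructed here as a
  weighted space of sequences of Taylor coefficients.
\<close>

locale positive_kernel = graded_matrix \<beta> Y for \<beta> :: "'n::finite \<Rightarrow> nat" and Y +
  fixes \<eta> :: real
  assumes coeff_mat_pos: "y \<in> level k \<Longrightarrow> y \<noteq> 0 \<Longrightarrow> 0 < Re (cinner (coeff_mat \<eta> k *v y) y)"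
    and coeff_mat_Suc_dominates: "\<exists>C\<ge>0. \<forall>k x. Re (cinner (coeff_mat \<eta> k *v x) x) \<le> C * Re (cinner (coeff_mat \<eta> (Suc k) *v x) x)"
begin

text \<open>
  The extension by the identity beyond level \<open>k\<close> makes the coefficient matrix invertible.
\<close>

definition ext_mat :: "nat \<Rightarrow> complex^'n^'n" where
  "ext_mat k = coeff_mat \<eta> k + (\<chi> i l. if i = l \<and> k < \<beta> i then 1 else 0)"

lemma ext_mat_mult: "(ext_mat k *v x) $ i = (coeff_mat \<eta> k *v x) $ i + (if k < \<beta> i then x $ i else 0)"
proof -
  have "(\<Sum>l\<in>UNIV. (if i = l \<and> k < \<beta> i then 1 else 0) * x $ l) = (\<Sum>l\<in>UNIV. if l = i then (if k < \<beta> i then x $ i else 0) else 0)"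
    by (intro sum.cong) auto
  then have "((\<chi> i l. if i = l \<and> k < \<beta> i then 1 else 0) *v x) $ i = (if k < \<beta> i then x $ i else 0)"
    unfolding matrix_vector_mult_def vec_lambda_beta by simp
  then show ?thesis by (simp only: ext_mat_def matrix_vector_mult_add_rdistrib vector_add_component)
qed

lemma ext_mat_level: "x \<in> level k \<Longrightarrow> ext_mat k *v x = coeff_mat \<eta> k *v x"
  by (auto simp: vec_eq_iff ext_mat_mult level_def)

lemma ext_mat_hermitian: "ctranspose (ext_mat k) = ext_mat k"
proof -
  have "cnj (coeff_mat \<eta> k $ l $ i) = coeff_mat \<eta> k $ i $ l" for i l
    using coeff_mat_hermitian[of \<eta> k] by (metis ctranspose_nth)
  then show ?thesis by (auto simp: vec_eq_iff ext_mat_def)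
qed

lemma coeff_nonneg: "0 \<le> Re (cinner (coeff_mat \<eta> k *v x) x)"
  by (rule coeff_mat_nonneg[OF coeff_mat_pos])

lemma ext_mat_pos:
  assumes x: "x \<noteq> 0"
  shows "0 < Re (cinner (ext_mat k *v x) x)"
proof -
  have "cinner (ext_mat k *v x) x = cinner (coeff_mat \<eta> k *v x) x + (\<Sum>i\<in>UNIV. if k < \<beta> i then x $ i * cnj (x $ i) else 0)"
    unfolding cinner_def sum.distrib[symmetric] by (intro sum.cong refl) (simp add: ext_mat_mult algebra_simps)
  also have "(\<Sum>i\<in>UNIV. if k < \<beta> i then x $ i * cnj (x $ i) else 0) = of_real (\<Sum>i\<in>UNIV. if k < \<beta> i then (norm (x $ i))\<^sup>2 else 0)"
    unfolding of_real_sum by (intro sum.cong refl) (simp add: complex_norm_square del: of_real_power)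
  finally have e: "Re (cinner (ext_mat k *v x) x) = Re (cinner (coeff_mat \<eta> k *v x) x)
      + (\<Sum>i\<in>UNIV. if k < \<beta> i then (norm (x $ i))\<^sup>2 else 0)" by simp
  have nn: "0 \<le> (\<Sum>i\<in>UNIV. if k < \<beta> i then (norm (x $ i))\<^sup>2 else 0)" by (intro sum_nonneg) auto
  show ?thesis
  proof (cases "x \<in> level k")
    case True
    then show ?thesis using coeff_mat_pos[OF True x] nn e by simp
  next
    case False
    then obtain i where i: "k < \<beta> i" "x $ i \<noteq> 0" by (auto simp: level_def)
    then have "0 < (\<Sum>i\<in>UNIV. if k < \<beta> i then (norm (x $ i))\<^sup>2 else 0)"
      by (intro sum_pos2[of _ i]) auto
    then show ?thesis using coeff_nonneg[of k x] e by simp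
  qed
qed

definition gram :: "nat \<Rightarrow> complex^'n^'n" where
  "gram k = matrix_inv (ext_mat k)"

lemma gram_inverse: "ext_mat k ** gram k = mat 1" "gram k ** ext_mat k = mat 1"
proof -
  have "inj ((*v) (ext_mat k))"
  proof (rule injI)
    fix x y assume "ext_mat k *v x = ext_mat k *v y"
    then have "ext_mat k *v (x - y) = 0" by (simp add: matrix_vector_mult_diff_distrib)
    then show "x = y" using ext_mat_pos[of "x - y" k] by force
  qed
  then obtain B where B: "B ** ext_mat k = mat 1" using matrix_left_invertible_injective by blast
  then have B': "ext_mat k ** B = mat 1" using matrix_left_right_inverse by blast
  then have "gram k = B" unfolding gram_def by (rule matrix_inv_eqI)
  then show "ext_mat k ** gram k = mat 1" "gram k ** ext_mat k = mat 1" using B B' by auto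
qed

lemma gram_hermitian: "ctranspose (gram k) = gram k"
proof -
  have "ctranspose (gram k) ** ext_mat k = mat 1"
    using arg_cong[OF gram_inverse(1)[of k], of ctranspose] by (simp add: ctranspose_matrix_mul ext_mat_hermitian)
  then have "(ctranspose (gram k) ** ext_mat k) ** gram k = mat 1 ** gram k" by (simp only:)
  then have "ctranspose (gram k) ** (ext_mat k ** gram k) = gram k" by (simp only: matrix_mul_assoc matrix_mul_lid)
  then show ?thesis by (simp only: gram_inverse(1) matrix_mul_rid)
qed

lemma ext_mat_gram: "ext_mat k *v (gram k *v x) = x"
  by (simp add: matrix_vector_mul_assoc gram_inverse)

lemma gram_level: "x \<in> level k \<Longrightarrow> gram k *v x \<in> level k"
proof -
  assume x: "x \<in> level k"
  have "(gram k *v x) $ i = 0" if "k < \<beta> i" for i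
  proof -
    have "(ext_mat k *v (gram k *v x)) $ i = (gram k *v x) $ i"
      using coeff_mat_in_level[of \<eta> k "gram k *v x"] that by (simp add: ext_mat_mult level_def)
    then show ?thesis using x that by (simp add: ext_mat_gram level_def)
  qed
  then show "gram k *v x \<in> level k" by (simp add: level_def)
qed

lemma coeff_mat_gram: "x \<in> level k \<Longrightarrow> coeff_mat \<eta> k *v (gram k *v x) = x"
  using ext_mat_level[OF gram_level, of x k] ext_mat_gram[of k x] by simp

lemma gram_coeff_mat: "y \<in> level k \<Longrightarrow> gram k *v (coeff_mat \<eta> k *v y) = y"
  by (simp add: ext_mat_level[symmetric] matrix_vector_mul_assoc gram_inverse)

text \<open>
  The squared norm of a section with Taylor coefficients \<open>x\<close> of weight \<open>k\<close> and no others.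
\<close>

definition level_sqnorm :: "nat \<Rightarrow> complex^'n \<Rightarrow> real" where
  "level_sqnorm k x = Re (cinner (gram k *v x) x)"

lemma level_sqnorm_pos: "x \<noteq> 0 \<Longrightarrow> 0 < level_sqnorm k x"
proof -
  assume "x \<noteq> 0"
  then have "gram k *v x \<noteq> 0" using ext_mat_gram[of k x] by force
  then have "0 < Re (cinner (ext_mat k *v (gram k *v x)) (gram k *v x))" by (rule ext_mat_pos)
  also have "cinner (ext_mat k *v (gram k *v x)) (gram k *v x) = cnj (cinner (gram k *v x) x)"
    by (simp add: ext_mat_gram cnj_cinner)
  finally show "0 < level_sqnorm k x" by (simp add: level_sqnorm_def)
qed

lemma level_sqnorm_nonneg: "0 \<le> level_sqnorm k x"
  using level_sqnorm_pos[of x k] by (cases "x = 0") (auto simp: level_sqnorm_def)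

lemma cinner_gram_swap: "cinner (gram k *v y) x = cnj (cinner (gram k *v x) y)"
  unfolding cnj_cinner by (subst cinner_ctranspose) (simp add: gram_hermitian)

lemma norm_cinner_gram: "norm (cinner (gram k *v x) y) \<le> (level_sqnorm k x + level_sqnorm k y) / 2"
  unfolding level_sqnorm_def
  by (intro arith_geo_mean_norm semidefinite_Cauchy_Schwarz gram_hermitian) (auto simp: level_sqnorm_nonneg simp flip: level_sqnorm_def)

lemma level_sqnorm_add: "level_sqnorm k (x + y) = level_sqnorm k x + level_sqnorm k y + 2 * Re (cinner (gram k *v x) y)"
  using cinner_gram_swap[of k y x]
  by (simp add: level_sqnorm_def matrix_vector_right_distrib cinner_add_left cinner_add_right)

lemma level_sqnorm_add_le: "level_sqnorm k (x + y) \<le> 2 * level_sqnorm k x + 2 * level_sqnorm k y"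
proof -
  have "Re (cinner (gram k *v x) y) \<le> (level_sqnorm k x + level_sqnorm k y) / 2"
    using norm_cinner_gram complex_Re_le_cmod order_trans by blast
  then show ?thesis by (simp add: level_sqnorm_add)
qed

lemma level_sqnorm_scale: "level_sqnorm k (a *s x) = (norm a)\<^sup>2 * level_sqnorm k x"
proof -
  have "cinner (gram k *v (a *s x)) (a *s x) = (a * cnj a) * cinner (gram k *v x) x"
    by (simp add: vector_scalar_commute cinner_scale_left cinner_scale_right mult_ac)
  also have "a * cnj a = of_real ((norm a)\<^sup>2)" by (simp only: complex_norm_square)
  finally show ?thesis unfolding level_sqnorm_def by simp
qed

lemma level_sqnorm_coeff_mat:
  assumes "x \<in> level k"
  shows "level_sqnorm k x = Re (cinner (coeff_mat \<eta> k *v (gram k *v x)) (gram k *v x))"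
proof -
  have "cinner (coeff_mat \<eta> k *v (gram k *v x)) (gram k *v x) = cnj (cinner (gram k *v x) x)"
    using assms by (simp add: coeff_mat_gram cnj_cinner)
  then show ?thesis by (simp add: level_sqnorm_def)
qed

text \<open>
  The inequality for the coefficient matrices is reversed for their inverses.
\<close>

lemma level_sqnorm_Suc_le: "\<exists>C\<ge>0. \<forall>k. \<forall>x\<in>level k. level_sqnorm (Suc k) x \<le> C * level_sqnorm k x"
proof -
  obtain C where C: "C \<ge> 0" "\<And>k x. Re (cinner (coeff_mat \<eta> k *v x) x) \<le> C * Re (cinner (coeff_mat \<eta> (Suc k) *v x) x)"
    using coeff_mat_Suc_dominates by blast
  have "level_sqnorm (Suc k) x \<le> C * level_sqnorm k x" if x: "x \<in> level k" for k x
  proof -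
    have x': "x \<in> level (Suc k)" using level_mono[OF x] by simp
    define y where "y = gram k *v x"
    define y' where "y' = gram (Suc k) *v x"
    have "(level_sqnorm (Suc k) x)\<^sup>2 \<le> (norm (cinner y' x))\<^sup>2"
      using abs_Re_le_cmod[of "cinner y' x"] by (simp add: level_sqnorm_def y'_def abs_le_square_iff[symmetric])
    also have "norm (cinner y' x) = norm (cinner (coeff_mat \<eta> k *v y) y')"
      using complex_mod_cnj[of "cinner y' x"] by (simp add: y_def coeff_mat_gram[OF x] cnj_cinner)
    also have "(norm (cinner (coeff_mat \<eta> k *v y) y'))\<^sup>2
        \<le> Re (cinner (coeff_mat \<eta> k *v y) y) * Re (cinner (coeff_mat \<eta> k *v y') y')"
      by (rule semidefinite_Cauchy_Schwarz[OF coeff_mat_hermitian coeff_nonneg])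
    also have "\<dots> \<le> level_sqnorm k x * (C * level_sqnorm (Suc k) x)"
      unfolding level_sqnorm_coeff_mat[OF x] level_sqnorm_coeff_mat[OF x'] y_def y'_def
      by (intro mult_left_mono C(2) coeff_nonneg)
    finally have "level_sqnorm (Suc k) x * level_sqnorm (Suc k) x \<le> (C * level_sqnorm k x) * level_sqnorm (Suc k) x"
      by (simp add: power2_eq_square mult_ac)
    then show ?thesis
      using level_sqnorm_nonneg[of "Suc k" x] C(1) level_sqnorm_nonneg[of k x] by (cases "level_sqnorm (Suc k) x = 0") (auto dest: mult_right_le_imp_le)
  qed
  then show ?thesis using C(1) by blast
qed

definition coeff_space :: "(complex \<Rightarrow> complex^'n) set" where
  "coeff_space = {f \<in> holomorphic_sections. summable (\<lambda>k. level_sqnorm k (taylor_vec f k))}"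

text \<open>
  The value \<open>0\<close> outside the space makes the distance derived from it nonnegative and symmetric for all
  arguments, as the locale \<^locale>\<open>Metric_space\<close> requires.
\<close>

definition coeff_ip :: "(complex \<Rightarrow> complex^'n) \<Rightarrow> (complex \<Rightarrow> complex^'n) \<Rightarrow> complex" where
  "coeff_ip f g = (if f \<in> coeff_space \<and> g \<in> coeff_space then \<Sum>k. cinner (gram k *v taylor_vec f k) (taylor_vec g k) else 0)"

lemma coeff_spaceD: "f \<in> coeff_space \<Longrightarrow> f \<in> holomorphic_sections" "f \<in> coeff_space \<Longrightarrow> summable (\<lambda>k. level_sqnorm k (taylor_vec f k))"
  by (auto simp: coeff_space_def)

lemma summable_coeff_ip:
  assumes "f \<in> coeff_space" "g \<in> coeff_space"
  shows "summable (\<lambda>k. cinner (gram k *v taylor_vec f k) (taylor_vec g k))"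
proof (rule summable_comparison_test)
  show "summable (\<lambda>k. (level_sqnorm k (taylor_vec f k) + level_sqnorm k (taylor_vec g k)) / 2)"
    by (intro summable_divide summable_add coeff_spaceD assms)
  show "\<exists>N. \<forall>k\<ge>N. norm (cinner (gram k *v taylor_vec f k) (taylor_vec g k)) \<le> (level_sqnorm k (taylor_vec f k) + level_sqnorm k (taylor_vec g k)) / 2"
    using norm_cinner_gram by blast
qed

lemma taylor_vec_linear:
  assumes f: "f \<in> holomorphic_sections"
  shows "g \<in> holomorphic_sections \<Longrightarrow> taylor_vec (\<lambda>z. f z + g z) k = taylor_vec f k + taylor_vec g k"
    and "taylor_vec (\<lambda>z. a *s f z) k = a *s taylor_vec f k"
proof -
  show "taylor_vec (\<lambda>z. f z + g z) k = taylor_vec f k + taylor_vec g k" if g: "g \<in> holomorphic_sections"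
  proof (rule fun_cong[OF taylor_vec_eqI[where x = "\<lambda>k. taylor_vec f k + taylor_vec g k"]])
    fix z :: complex and i assume z: "z \<in> unit_disc"
    have "epow k z (taylor_vec f k + taylor_vec g k) $ i = epow k z (taylor_vec f k) $ i + epow k z (taylor_vec g k) $ i" for k
      by (simp add: epow_def algebra_simps)
    then show "(\<lambda>k. epow k z (taylor_vec f k + taylor_vec g k) $ i) sums (f z + g z) $ i"
      using sums_add[OF taylor_vec_sums[OF f z, of i] taylor_vec_sums[OF g z, of i]] by simp
  qed (intro level_subspace taylor_vec_in_level)
  show "taylor_vec (\<lambda>z. a *s f z) k = a *s taylor_vec f k"
  proof (rule fun_cong[OF taylor_vec_eqI[where x = "\<lambda>k. a *s taylor_vec f k"]])
    fix z :: complex and i assume z: "z \<in> unit_disc"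
    have "epow k z (a *s taylor_vec f k) $ i = a * epow k z (taylor_vec f k) $ i" for k
      by (simp add: epow_def algebra_simps)
    then show "(\<lambda>k. epow k z (a *s taylor_vec f k) $ i) sums (a *s f z) $ i"
      using sums_mult[OF taylor_vec_sums[OF f z, of i], of a] by simp
  qed (intro level_subspace taylor_vec_in_level)
qed

text \<open>
  The terms of the series at \<open>z\<close> are inner products with the coefficients of the kernel section at \<open>z\<close>, and so
  the series is dominated by the mean of two convergent series of squared norms.
\<close>

lemma section_of_coefficients:
  assumes x: "\<And>k. x k \<in> level k" and s: "summable (\<lambda>k. level_sqnorm k (x k))"
  shows "\<exists>f\<in>coeff_space. taylor_vec f = x"
proof -
  have conv: "summable (\<lambda>k. epow k z (x k) $ i)" if z: "z \<in> unit_disc" for z i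
  proof (rule summable_comparison_test)
    let ?e = "\<lambda>k. epow k (cnj z) (axis i 1)"
    have "summable (\<lambda>k. Re (cinner (coeff_mat \<eta> k *v ?e k) (?e k)))"
      using sums_summable[OF cinner_kern_sums[OF z z, of \<eta> "axis i 1" "axis i 1"]] by (rule summable_Re)
    then show "summable (\<lambda>k. (level_sqnorm k (x k) + Re (cinner (coeff_mat \<eta> k *v ?e k) (?e k))) / 2)"
      by (intro summable_divide summable_add s)
    have "norm (epow k z (x k) $ i) \<le> (level_sqnorm k (x k) + Re (cinner (coeff_mat \<eta> k *v ?e k) (?e k))) / 2" for k
    proof -
      have "epow k z (x k) $ i = cinner (coeff_mat \<eta> k *v (gram k *v x k)) (?e k)"
        unfolding coeff_mat_gram[OF x] by (simp add: cinner_axis flip: cinner_epow)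
      moreover have "norm (cinner (coeff_mat \<eta> k *v (gram k *v x k)) (?e k))
          \<le> (Re (cinner (coeff_mat \<eta> k *v (gram k *v x k)) (gram k *v x k)) + Re (cinner (coeff_mat \<eta> k *v ?e k) (?e k))) / 2"
        by (intro arith_geo_mean_norm semidefinite_Cauchy_Schwarz coeff_mat_hermitian coeff_nonneg)
      ultimately show ?thesis by (simp only: level_sqnorm_coeff_mat[OF x])
    qed
    then show "\<exists>N. \<forall>k\<ge>N. norm (epow k z (x k) $ i) \<le> (level_sqnorm k (x k) + Re (cinner (coeff_mat \<eta> k *v ?e k) (?e k))) / 2"
      by blast
  qed
  define f where "f = on_disc (\<lambda>z. \<chi> i. \<Sum>k. epow k z (x k) $ i)"
  have f: "(\<lambda>k. epow k z (x k) $ i) sums f z $ i" if "z \<in> unit_disc" for z i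
    using summable_sums[OF conv[OF that]] that by (simp add: f_def)
  have "on_disc f = f" by (auto simp: f_def on_disc_def fun_eq_iff)
  then have "f \<in> holomorphic_sections"
    using holomorphic_on_epow_series[OF f] by (simp add: holomorphic_sections_def)
  moreover have "taylor_vec f = x" by (rule taylor_vec_eqI[OF f x])
  ultimately show ?thesis using s by (intro bexI[of _ f]) (auto simp: coeff_space_def)
qed

lemma Re_coeff_ip_self: "f \<in> coeff_space \<Longrightarrow> Re (coeff_ip f f) = (\<Sum>k. level_sqnorm k (taylor_vec f k))"
  using summable_coeff_ip[of f f] by (simp add: coeff_ip_def level_sqnorm_def Re_suminf)

lemma coeff_space_add: "f \<in> coeff_space \<Longrightarrow> g \<in> coeff_space \<Longrightarrow> (\<lambda>z. f z + g z) \<in> coeff_space"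
proof -
  assume f: "f \<in> coeff_space" and g: "g \<in> coeff_space"
  have "summable (\<lambda>k. level_sqnorm k (taylor_vec f k + taylor_vec g k))"
  proof (rule summable_comparison_test)
    show "summable (\<lambda>k. 2 * level_sqnorm k (taylor_vec f k) + 2 * level_sqnorm k (taylor_vec g k))"
      by (intro summable_add summable_mult coeff_spaceD f g)
    show "\<exists>N. \<forall>k\<ge>N. norm (level_sqnorm k (taylor_vec f k + taylor_vec g k)) \<le> 2 * level_sqnorm k (taylor_vec f k) + 2 * level_sqnorm k (taylor_vec g k)"
      using level_sqnorm_add_le level_sqnorm_nonneg by auto
  qed
  then show "(\<lambda>z. f z + g z) \<in> coeff_space"
    using coeff_spaceD(1)[OF f] coeff_spaceD(1)[OF g] by (simp add: coeff_space_def holomorphic_sections_linear taylor_vec_linear)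
qed

lemma coeff_space_scale: "f \<in> coeff_space \<Longrightarrow> (\<lambda>z. a *s f z) \<in> coeff_space"
proof -
  assume f: "f \<in> coeff_space"
  have "taylor_vec (\<lambda>z. a *s f z) k = a *s taylor_vec f k" for k
    by (rule taylor_vec_linear(2)[OF coeff_spaceD(1)[OF f]])
  moreover have "summable (\<lambda>k. (norm a)\<^sup>2 * level_sqnorm k (taylor_vec f k))"
    by (rule summable_mult[OF coeff_spaceD(2)[OF f]])
  moreover have "(\<lambda>z. a *s f z) \<in> holomorphic_sections"
    by (rule holomorphic_sections_linear(2)[OF coeff_spaceD(1)[OF f]])
  ultimately show "(\<lambda>z. a *s f z) \<in> coeff_space" by (simp add: coeff_space_def level_sqnorm_scale)
qed

lemma coeff_space_zero: "(\<lambda>z. 0) \<in> coeff_space"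
proof -
  have "(\<lambda>z. 0) \<in> holomorphic_sections" by (simp add: holomorphic_sections_def on_disc_def)
  moreover have "taylor_vec (\<lambda>z. 0) = (\<lambda>k. 0)"
    by (rule taylor_vec_eqI) (auto simp: epow_def level_def cong: if_cong)
  ultimately show ?thesis by (simp add: coeff_space_def level_sqnorm_def)
qed

sublocale coeff_space: section_space coeff_space coeff_ip
proof
  show "coeff_space \<subseteq> holomorphic_sections" by (auto simp: coeff_space_def)
  show "(\<lambda>z. 0) \<in> coeff_space" by (rule coeff_space_zero)
  show "(\<lambda>z. f z + g z) \<in> coeff_space" if "f \<in> coeff_space" "g \<in> coeff_space" for f g using that by (rule coeff_space_add)
  show "(\<lambda>z. a *s f z) \<in> coeff_space" if "f \<in> coeff_space" for f a using that by (rule coeff_space_scale)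
  show "coeff_ip (\<lambda>z. f z + g z) h = coeff_ip f h + coeff_ip g h" if "f \<in> coeff_space" "g \<in> coeff_space" "h \<in> coeff_space" for f g h
    using that suminf_add[OF summable_coeff_ip[OF that(1,3)] summable_coeff_ip[OF that(2,3)]] coeff_space_add[OF that(1,2)]
      taylor_vec_linear(1)[OF coeff_spaceD(1)[OF that(1)] coeff_spaceD(1)[OF that(2)]]
    by (simp add: coeff_ip_def matrix_vector_right_distrib cinner_add_left)
  show "coeff_ip (\<lambda>z. a *s f z) g = a * coeff_ip f g" if "f \<in> coeff_space" "g \<in> coeff_space" for f g a
    using that suminf_mult[OF summable_coeff_ip[OF that], of a] coeff_space_scale[OF that(1), of a]
      taylor_vec_linear(2)[OF coeff_spaceD(1)[OF that(1)], of a]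
    by (simp add: coeff_ip_def vector_scalar_commute cinner_scale_left)
  show "coeff_ip g f = cnj (coeff_ip f g)" if "f \<in> coeff_space" "g \<in> coeff_space" for f g
  proof -
    have "(\<lambda>k. cnj (cinner (gram k *v taylor_vec f k) (taylor_vec g k))) sums cnj (coeff_ip f g)"
      using summable_sums[OF summable_coeff_ip[OF that]] that by (simp add: sums_cnj coeff_ip_def)
    then have "(\<lambda>k. cinner (gram k *v taylor_vec g k) (taylor_vec f k)) sums cnj (coeff_ip f g)"
      by (subst cinner_gram_swap)
    then show ?thesis using that by (simp add: coeff_ip_def sums_iff)
  qed
  show "0 < Re (coeff_ip f f)" if f: "f \<in> coeff_space" and nz: "f \<noteq> (\<lambda>z. 0)" for f
  proof -
    have "\<exists>k. taylor_vec f k \<noteq> 0"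
    proof (rule ccontr)
      assume "\<not> (\<exists>k. taylor_vec f k \<noteq> 0)"
      then have z: "epow k z (taylor_vec f k) $ i = 0" for k z i by (simp add: epow_def)
      have "f z $ i = 0" if "z \<in> unit_disc" for z i
        using taylor_vec_sums[OF coeff_spaceD(1)[OF f] that, of i] unfolding z by (simp add: sums_iff)
      then have "on_disc f = (\<lambda>z. 0)" by (auto simp: on_disc_def fun_eq_iff vec_eq_iff)
      then show False using nz coeff_spaceD(1)[OF f] by (simp add: holomorphic_sections_def)
    qed
    then obtain k where "taylor_vec f k \<noteq> 0" by blast
    then have "0 < (\<Sum>k. level_sqnorm k (taylor_vec f k))"
      by (intro suminf_pos2[where i = k] coeff_spaceD f level_sqnorm_nonneg level_sqnorm_pos)
    then show ?thesis by (simp add: Re_coeff_ip_self f)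
  qed
qed

lemma kern_section:
  assumes w: "w \<in> unit_disc"
  shows "on_disc (\<lambda>z. kern \<eta> z w *v \<xi>) \<in> coeff_space"
    and "taylor_vec (on_disc (\<lambda>z. kern \<eta> z w *v \<xi>)) k = coeff_mat \<eta> k *v epow k (cnj w) \<xi>"
proof -
  let ?x = "\<lambda>k. coeff_mat \<eta> k *v epow k (cnj w) \<xi>"
  let ?f = "on_disc (\<lambda>z. kern \<eta> z w *v \<xi>)"
  have e: "epow k (cnj w) \<xi> \<in> level k" for k by (simp add: epow_def level_def)
  have s: "(\<lambda>k. epow k z (?x k) $ i) sums ?f z $ i" if z: "z \<in> unit_disc" for z i
    using cinner_kern_sums[OF z w, of \<eta> \<xi> "axis i 1"] z by (simp add: cinner_axis flip: cinner_epow)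
  have t: "taylor_vec ?f = ?x" by (rule taylor_vec_eqI[OF s coeff_mat_in_level])
  then show "taylor_vec ?f k = ?x k" by simp
  have "on_disc ?f = ?f" by (auto simp: on_disc_def fun_eq_iff)
  then have "?f \<in> holomorphic_sections"
    using holomorphic_on_epow_series[OF s] by (simp add: holomorphic_sections_def)
  moreover have "summable (\<lambda>k. level_sqnorm k (?x k))"
  proof -
    have "level_sqnorm k (?x k) = Re (cinner (coeff_mat \<eta> k *v epow k (cnj w) \<xi>) (epow k (cnj w) \<xi>))" for k
      unfolding level_sqnorm_coeff_mat[OF coeff_mat_in_level] gram_coeff_mat[OF e] ..
    then show ?thesis
      using sums_summable[OF cinner_kern_sums[OF w w, of \<eta> \<xi> \<xi>]] by (simp add: summable_Re)
  qed
  ultimately show "?f \<in> coeff_space" by (simp add: coeff_space_def t)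
qed

lemma reproducing_kernel_coeff_space: "reproducing_kernel coeff_space coeff_ip (kern \<eta>)"
  unfolding reproducing_kernel_def
proof (intro ballI allI conjI)
  fix w \<xi> assume w: "w \<in> unit_disc"
  show k: "on_disc (\<lambda>z. kern \<eta> z w *v \<xi>) \<in> coeff_space" by (rule kern_section[OF w])
  fix f assume f: "f \<in> coeff_space"
  have "cinner (gram k *v taylor_vec f k) (coeff_mat \<eta> k *v epow k (cnj w) \<xi>)
      = cinner (taylor_vec f k) (epow k (cnj w) \<xi>)" for k
    using cinner_ctranspose[of "coeff_mat \<eta> k" "gram k *v taylor_vec f k" "epow k (cnj w) \<xi>"]
    by (simp add: coeff_mat_hermitian coeff_mat_gram taylor_vec_in_level)
  then show "coeff_ip f (on_disc (\<lambda>z. kern \<eta> z w *v \<xi>)) = cinner (f w) \<xi>"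
    using f k cinner_taylor_vec_sums[OF coeff_spaceD(1)[OF f] w, of \<xi>]
    by (simp add: coeff_ip_def kern_section(2)[OF w] sums_iff)
qed

sublocale coeff_space: kernel_space coeff_space coeff_ip "kern \<eta>"
  by unfold_locales (rule reproducing_kernel_coeff_space)

lemma ip_norm_nonneg: "0 \<le> ip_norm coeff_ip f"
proof (cases "f \<in> coeff_space")
  case True
  then show ?thesis using coeff_space.ip_nonneg by (simp add: ip_norm_def)
qed (simp add: ip_norm_def coeff_ip_def)

lemma Metric_space_coeff_space: "Metric_space coeff_space (\<lambda>f g. ip_norm coeff_ip (\<lambda>z. f z - g z))"
proof
  fix f g h :: "complex \<Rightarrow> complex^'n"
  show "0 \<le> ip_norm coeff_ip (\<lambda>z. f z - g z)" by (rule ip_norm_nonneg)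
  have neg: "(\<lambda>z. f z - g z) = (\<lambda>z. (-1) *s (g z - f z))" for f g :: "complex \<Rightarrow> complex^'n"
    by (simp add: fun_eq_iff vec_eq_iff)
  show "ip_norm coeff_ip (\<lambda>z. f z - g z) = ip_norm coeff_ip (\<lambda>z. g z - f z)"
  proof (cases "(\<lambda>z. g z - f z) \<in> coeff_space")
    case True
    then have "coeff_ip (\<lambda>z. f z - g z) (\<lambda>z. f z - g z) = coeff_ip (\<lambda>z. g z - f z) (\<lambda>z. g z - f z)"
      unfolding neg[of f g] using coeff_space.ip_scale[OF True coeff_space_scale[OF True, of "-1"], of "-1"] coeff_space.ip_scale_right[OF True True, of "-1"]
      by simp
    then show ?thesis by (simp add: ip_norm_def)
  next
    case False
    moreover have "(\<lambda>z. g z - f z) \<in> coeff_space" if "(\<lambda>z. f z - g z) \<in> coeff_space"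
      unfolding neg[of g f] by (rule coeff_space_scale[OF that])
    ultimately have "(\<lambda>z. f z - g z) \<notin> coeff_space" by blast
    then show ?thesis using False by (simp add: ip_norm_def coeff_ip_def)
  qed
  show "ip_norm coeff_ip (\<lambda>z. f z - g z) = 0 \<longleftrightarrow> f = g" if "f \<in> coeff_space" "g \<in> coeff_space"
  proof
    assume "ip_norm coeff_ip (\<lambda>z. f z - g z) = 0"
    then have "Re (coeff_ip (\<lambda>z. f z - g z) (\<lambda>z. f z - g z)) = 0" by (simp add: ip_norm_def)
    then have "(\<lambda>z. f z - g z) = (\<lambda>z. 0)" by (rule coeff_space.ip_self_eq_0[OF coeff_space.diff[OF that]])
    then show "f = g" by (simp add: fun_eq_iff)
  next
    assume "f = g"
    then show "ip_norm coeff_ip (\<lambda>z. f z - g z) = 0" using coeff_space.ip_zero[OF coeff_space_zero] by (simp add: ip_norm_def)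
  qed
  show "ip_norm coeff_ip (\<lambda>z. f z - h z) \<le> ip_norm coeff_ip (\<lambda>z. f z - g z) + ip_norm coeff_ip (\<lambda>z. g z - h z)"
    if "f \<in> coeff_space" "g \<in> coeff_space" "h \<in> coeff_space"
    using coeff_space.ip_norm_triangle[OF coeff_space.diff[OF that(1,2)] coeff_space.diff[OF that(2,3)]] by simp
qed

lemma taylor_vec_diff:
  assumes "f \<in> coeff_space" "g \<in> coeff_space"
  shows "taylor_vec (\<lambda>z. f z - g z) k = taylor_vec f k - taylor_vec g k"
proof -
  have g: "(\<lambda>z. (-1) *s g z) \<in> holomorphic_sections" by (intro holomorphic_sections_linear coeff_spaceD assms)
  have "(\<lambda>z. f z - g z) = (\<lambda>z. f z + (-1) *s g z)" by (simp add: fun_eq_iff vec_eq_iff)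
  then show ?thesis
    using taylor_vec_linear(1)[OF coeff_spaceD(1)[OF assms(1)] g, of k] taylor_vec_linear(2)[OF coeff_spaceD(1)[OF assms(2)], of "-1" k]
    by (simp add: vec_eq_iff)
qed

lemma level_sqnorm_lower_bound: "\<exists>c>0. \<forall>x. c * (norm x)\<^sup>2 \<le> level_sqnorm k x"
proof -
  have "\<exists>c>0. \<forall>x\<in>level (Max (range \<beta>)). c * (norm x)\<^sup>2 \<le> Re (cinner (gram k *v x) x)"
    by (rule positive_lower_bound) (use level_sqnorm_pos in \<open>simp add: level_sqnorm_def\<close>)
  then show ?thesis by (simp add: level_UNIV level_sqnorm_def)
qed

lemma continuous_q: "(X \<longlongrightarrow> x) F \<Longrightarrow> ((\<lambda>n. level_sqnorm k (X n)) \<longlongrightarrow> level_sqnorm k x) F"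
  unfolding level_sqnorm_def cinner_mult by (intro tendsto_intros)

text \<open>
  The coefficients of each weight converge, as \<open>level_sqnorm\<close> is a norm on a finite-dimensional space. The
  Cauchy condition for partial sums passes to the limit of the coefficients, and shows both that the limit
  belongs to the space and that the sequence converges to it.
\<close>

lemma mcomplete_coeff_space: "Metric_space.mcomplete coeff_space (\<lambda>f g. ip_norm coeff_ip (\<lambda>z. f z - g z))"
proof -
  let ?d = "\<lambda>f g. ip_norm coeff_ip (\<lambda>z. f z - g z)"
  interpret M: Metric_space coeff_space ?d by (rule Metric_space_coeff_space)
  show ?thesis unfolding M.mcomplete_def
  proof (intro allI impI)
    fix \<sigma> assume "M.MCauchy \<sigma>"
    then have mem: "\<And>n. \<sigma> n \<in> coeff_space" and cauchy: "\<And>e. e > 0 \<Longrightarrow> \<exists>N. \<forall>n n'. N \<le> n \<longrightarrow> N \<le> n' \<longrightarrow> ?d (\<sigma> n) (\<sigma> n') < e"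
      unfolding M.MCauchy_def by auto
    define x where "x n k = taylor_vec (\<sigma> n) k" for n k
    have d2: "(?d f g)\<^sup>2 = (\<Sum>k. level_sqnorm k (taylor_vec f k - taylor_vec g k))" if "f \<in> coeff_space" "g \<in> coeff_space" for f g
      using that coeff_space.diff[OF that] by (simp add: coeff_space.ip_norm_power2 Re_coeff_ip_self taylor_vec_diff)
    have summ: "summable (\<lambda>k. level_sqnorm k (taylor_vec f k - taylor_vec g k))" if "f \<in> coeff_space" "g \<in> coeff_space" for f g
      using coeff_spaceD(2)[OF coeff_space.diff[OF that]] that by (simp add: taylor_vec_diff)
    have partial: "(\<Sum>k<K. level_sqnorm k (x n k - x n' k)) \<le> (?d (\<sigma> n) (\<sigma> n'))\<^sup>2" for K n n'
      unfolding d2[OF mem mem] x_def by (intro sum_le_suminf summ mem) (auto simp: level_sqnorm_nonneg)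
    have "Cauchy (\<lambda>n. x n k)" for k
    proof -
      obtain c where c: "c > 0" "\<And>v. c * (norm v)\<^sup>2 \<le> level_sqnorm k v" using level_sqnorm_lower_bound[of k] by blast
      show ?thesis
      proof (rule CauchyI)
        fix e :: real assume e: "0 < e"
        obtain N where N: "\<forall>n n'. N \<le> n \<longrightarrow> N \<le> n' \<longrightarrow> ?d (\<sigma> n) (\<sigma> n') < sqrt c * e"
          using cauchy[of "sqrt c * e"] c(1) e by auto
        have "norm (x n k - x n' k) < e" if "N \<le> n" "N \<le> n'" for n n'
        proof -
          have "c * (norm (x n k - x n' k))\<^sup>2 \<le> level_sqnorm k (x n k - x n' k)" by (rule c(2))
          also have "\<dots> \<le> (\<Sum>j<Suc k. level_sqnorm j (x n j - x n' j))" by (simp add: sum_nonneg level_sqnorm_nonneg)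
          also have "\<dots> \<le> (?d (\<sigma> n) (\<sigma> n'))\<^sup>2" by (rule partial)
          also have "\<dots> < (sqrt c * e)\<^sup>2"
            using N that by (intro power_strict_mono ip_norm_nonneg) auto
          also have "\<dots> = c * e\<^sup>2" using c(1) by (simp add: power_mult_distrib)
          finally have "(norm (x n k - x n' k))\<^sup>2 < e\<^sup>2" using c(1) by simp
          then show ?thesis using e by (rule power2_less_imp_less[OF _ less_imp_le])
        qed
        then show "\<exists>M. \<forall>m\<ge>M. \<forall>n\<ge>M. norm (x m k - x n k) < e" by blast
      qed
    qed
    then have "\<exists>L. (\<lambda>n. x n k) \<longlonglongrightarrow> L" for k using Cauchy_convergent convergent_def by blast
    then obtain X where X: "\<And>k. (\<lambda>n. x n k) \<longlonglongrightarrow> X k" by metis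
    have Xlev: "X k \<in> level k" for k
      using closed_sequentially[OF closed_level, of "\<lambda>n. x n k" k] X taylor_vec_in_level by (simp add: x_def)
    have lim: "(\<Sum>k<K. level_sqnorm k (x n k - X k)) \<le> e\<^sup>2"
      if N: "\<forall>n n'. N \<le> n \<longrightarrow> N \<le> n' \<longrightarrow> ?d (\<sigma> n) (\<sigma> n') < e" "N \<le> n" for K n N e
    proof (rule LIMSEQ_le_const2)
      show "(\<lambda>n'. \<Sum>k<K. level_sqnorm k (x n k - x n' k)) \<longlonglongrightarrow> (\<Sum>k<K. level_sqnorm k (x n k - X k))"
        by (intro tendsto_sum continuous_q tendsto_diff tendsto_const X)
      have "(\<Sum>k<K. level_sqnorm k (x n k - x n' k)) \<le> e\<^sup>2" if "n' \<ge> N" for n'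
      proof -
        have "(?d (\<sigma> n) (\<sigma> n'))\<^sup>2 \<le> e\<^sup>2"
          using N that by (intro power_mono ip_norm_nonneg) (auto intro: less_imp_le)
        then show ?thesis using partial[of n n' K] by linarith
      qed
      then show "\<exists>N. \<forall>n'\<ge>N. (\<Sum>k<K. level_sqnorm k (x n k - x n' k)) \<le> e\<^sup>2" by blast
    qed
    have summ_diff: "summable (\<lambda>k. level_sqnorm k (x n k - X k))" "(\<Sum>k. level_sqnorm k (x n k - X k)) \<le> e\<^sup>2"
      if N: "\<forall>n n'. N \<le> n \<longrightarrow> N \<le> n' \<longrightarrow> ?d (\<sigma> n) (\<sigma> n') < e" "N \<le> n" for n N e
    proof -
      show s: "summable (\<lambda>k. level_sqnorm k (x n k - X k))"
        by (rule summableI_nonneg_bounded[OF level_sqnorm_nonneg lim[OF N]])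
      show "(\<Sum>k. level_sqnorm k (x n k - X k)) \<le> e\<^sup>2" by (rule suminf_le_const[OF s lim[OF N]])
    qed
    obtain N1 where N1: "\<forall>n n'. N1 \<le> n \<longrightarrow> N1 \<le> n' \<longrightarrow> ?d (\<sigma> n) (\<sigma> n') < 1" using cauchy[of 1] by auto
    have "summable (\<lambda>k. level_sqnorm k (X k))"
    proof (rule summable_comparison_test)
      show "summable (\<lambda>k. 2 * level_sqnorm k (x N1 k) + 2 * level_sqnorm k (x N1 k - X k))"
        by (intro summable_add summable_mult summ_diff(1)[OF N1]) (use coeff_spaceD(2)[OF mem] in \<open>auto simp: x_def\<close>)
      have "level_sqnorm k (X k) \<le> 2 * level_sqnorm k (x N1 k) + 2 * level_sqnorm k (x N1 k - X k)" for k
        using level_sqnorm_add_le[of k "x N1 k" "(-1) *s (x N1 k - X k)"] level_sqnorm_scale[of k "-1" "x N1 k - X k"]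
        by (simp add: vector_smult_lneg)
      then show "\<exists>N. \<forall>k\<ge>N. norm (level_sqnorm k (X k)) \<le> 2 * level_sqnorm k (x N1 k) + 2 * level_sqnorm k (x N1 k - X k)"
        using level_sqnorm_nonneg by auto
    qed
    then obtain f where f: "f \<in> coeff_space" "taylor_vec f = X" using section_of_coefficients[OF Xlev] by blast
    have "\<exists>N. \<forall>n\<ge>N. \<sigma> n \<in> coeff_space \<and> ?d (\<sigma> n) f < e" if e: "e > 0" for e
    proof -
      obtain N where N: "\<forall>n n'. N \<le> n \<longrightarrow> N \<le> n' \<longrightarrow> ?d (\<sigma> n) (\<sigma> n') < e / 2" using cauchy[of "e / 2"] e by auto
      have "?d (\<sigma> n) f < e" if "n \<ge> N" for n
      proof -
        have "(?d (\<sigma> n) f)\<^sup>2 \<le> (e / 2)\<^sup>2"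
          unfolding d2[OF mem f(1)] f(2) using summ_diff(2)[OF N that] by (simp add: x_def)
        then have "?d (\<sigma> n) f \<le> e / 2" by (rule power2_le_imp_le) (use e in simp)
        then show ?thesis using e by simp
      qed
      then show ?thesis using mem by blast
    qed
    then show "\<exists>f. limitin M.mtopology \<sigma> f sequentially"
      unfolding M.limit_metric_sequentially using f(1) by blast
  qed
qed

lemma hilbert_space_coeff_space: "hilbert_space_of_sections coeff_space coeff_ip"
  unfolding hilbert_space_of_sections_def
  by (intro conjI ballI allI impI coeff_space.hol coeff_space.zero coeff_space.add coeff_space.scale coeff_space.ip_add coeff_space.ip_scale coeff_space.ip_cnj coeff_space.ip_pos mcomplete_coeff_space)

lemma evaluations_continuous_coeff_space: "evaluations_continuous coeff_space coeff_ip"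
  unfolding evaluations_continuous_def
proof
  fix z :: complex assume z: "z \<in> unit_disc"
  let ?k = "\<lambda>i. coeff_space.kernel_section z (axis i 1)"
  have "norm (f z) \<le> (\<Sum>i\<in>UNIV. ip_norm coeff_ip (?k i)) * ip_norm coeff_ip f" if f: "f \<in> coeff_space" for f
  proof -
    have "norm (f z $ i) \<le> ip_norm coeff_ip (?k i) * ip_norm coeff_ip f" for i
    proof (rule power2_le_imp_le)
      have "(norm (coeff_ip f (?k i)))\<^sup>2 \<le> Re (coeff_ip f f) * Re (coeff_ip (?k i) (?k i))"
        by (rule coeff_space.Cauchy_Schwarz[OF f coeff_space.kernel_section_mem[OF z]])
      then show "(norm (f z $ i))\<^sup>2 \<le> (ip_norm coeff_ip (?k i) * ip_norm coeff_ip f)\<^sup>2"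
        by (simp add: coeff_space.ip_kernel_section[OF z f] cinner_axis power_mult_distrib
            coeff_space.ip_norm_power2[OF f] coeff_space.ip_norm_power2[OF coeff_space.kernel_section_mem[OF z]] mult.commute)
    qed (simp add: ip_norm_nonneg)
    then have "(\<Sum>i\<in>UNIV. norm (f z $ i)) \<le> (\<Sum>i\<in>UNIV. ip_norm coeff_ip (?k i) * ip_norm coeff_ip f)"
      by (intro sum_mono)
    moreover have "norm (f z) \<le> (\<Sum>i\<in>UNIV. norm (f z $ i))"
      by (simp add: norm_vec_def L2_set_le_sum)
    ultimately show ?thesis by (simp add: sum_distrib_right)
  qed
  then show "\<exists>C. \<forall>f\<in>coeff_space. norm (f z) \<le> C * ip_norm coeff_ip f" by blast
qed

lemma shift_invariant_coeff_space: "shift_invariant coeff_space"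
  unfolding shift_invariant_def
proof
  fix f assume f: "f \<in> coeff_space"
  let ?F = "\<lambda>z. z *s f z"
  obtain C where C: "C \<ge> 0" "\<And>k x. x \<in> level k \<Longrightarrow> level_sqnorm (Suc k) x \<le> C * level_sqnorm k x" using level_sqnorm_Suc_le by blast
  have "on_disc ?F = ?F" using coeff_space.vanish[OF f] by (auto simp: on_disc_def fun_eq_iff)
  then have "?F \<in> holomorphic_sections"
    using coeff_spaceD(1)[OF f] by (auto simp: holomorphic_sections_def intro!: holomorphic_intros)
  moreover have "summable (\<lambda>k. level_sqnorm (Suc k) (taylor_vec ?F (Suc k)))"
  proof (rule summable_comparison_test)
    show "summable (\<lambda>k. C * level_sqnorm k (taylor_vec f k))" by (intro summable_mult coeff_spaceD f)
    show "\<exists>N. \<forall>k\<ge>N. norm (level_sqnorm (Suc k) (taylor_vec ?F (Suc k))) \<le> C * level_sqnorm k (taylor_vec f k)"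
      using C(2)[OF taylor_vec_in_level] level_sqnorm_nonneg by (auto simp: taylor_vec_shift coeff_spaceD(1)[OF f])
  qed
  then have "summable (\<lambda>k. level_sqnorm k (taylor_vec ?F k))" by (subst (asm) summable_Suc_iff)
  ultimately show "?F \<in> coeff_space" by (simp add: coeff_space_def)
qed

definition act :: "(complex^2^2) \<times> complex \<Rightarrow> (complex \<Rightarrow> complex^'n) \<Rightarrow> complex \<Rightarrow> complex^'n" where
  "act g f = on_disc (\<lambda>z. multiplier \<beta> \<eta> Y g z *v f (moebius (fst g) z))"

text \<open>
  The bound \<^const>\<open>kernel_bounded\<close> is transported from \<open>f\<close> to its translate by the invariance of the kernel.
  Applied to the vectors \<open>gram k *v x\<^sub>k\<close>, where \<open>x\<^sub>k\<close> are the coefficients of the translate, \<open>kernel_bounded_taylor\<close>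
  bounds the square of a partial sum of \<open>\<Sum>k. level_sqnorm k x\<^sub>k\<close> by \<open>C\<close> times that partial sum.
\<close>

lemma act_contraction:
  assumes g: "g \<in> SU11_cover" and f: "f \<in> coeff_space"
  shows "act g f \<in> coeff_space" and "Re (coeff_ip (act g f) (act g f)) \<le> Re (coeff_ip f f)"
proof -
  let ?F = "act g f"
  let ?C = "Re (coeff_ip f f)"
  have hol: "?F \<in> holomorphic_sections"
  proof -
    have fh: "(\<lambda>z. f z $ l) holomorphic_on unit_disc" for l
      using coeff_spaceD(1)[OF f] by (simp add: holomorphic_sections_def)
    have "((\<lambda>z. f z $ l) \<circ> moebius (fst g)) holomorphic_on unit_disc" for l
      by (rule holomorphic_on_compose_gen[OF holomorphic_moebius[OF g] fh]) (use moebius_in_disc[OF g] in blast)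
    then have "(\<lambda>z. \<Sum>l\<in>UNIV. multiplier \<beta> \<eta> Y g z $ i $ l * f (moebius (fst g) z) $ l) holomorphic_on unit_disc" for i
      by (intro holomorphic_intros holomorphic_multiplier[OF g]) (simp add: o_def)
    then have "(\<lambda>z. ?F z $ i) holomorphic_on unit_disc" for i
      by (rule holomorphic_transform) (simp add: act_def matrix_vector_mult_def)
    moreover have "on_disc ?F = ?F" by (auto simp: act_def on_disc_def fun_eq_iff)
    ultimately show ?thesis by (simp add: holomorphic_sections_def)
  qed
  have bd: "kernel_bounded \<eta> ?F ?C"
    unfolding kernel_bounded_def
  proof (intro allI impI)
    fix M :: nat and w \<xi> assume w: "\<forall>a<M. w a \<in> unit_disc"
    let ?J = "\<lambda>a. multiplier \<beta> \<eta> Y g (w a)"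
    have 1: "(\<Sum>a<M. cinner (?F (w a)) (\<xi> a)) = (\<Sum>a<M. cinner (f (moebius (fst g) (w a))) (ctranspose (?J a) *v \<xi> a))"
      using w by (intro sum.cong refl) (simp add: act_def cinner_ctranspose)
    have 2: "(\<Sum>a<M. \<Sum>b<M. cinner (kern \<eta> (moebius (fst g) (w b)) (moebius (fst g) (w a)) *v (ctranspose (?J a) *v \<xi> a)) (ctranspose (?J b) *v \<xi> b))
        = (\<Sum>a<M. \<Sum>b<M. cinner (kern \<eta> (w b) (w a) *v \<xi> a) (\<xi> b))"
    proof (intro sum.cong refl)
      fix a b assume ab: "a \<in> {..<M}" "b \<in> {..<M}"
      have "kern \<eta> (w b) (w a) *v \<xi> a = ?J b *v (kern \<eta> (moebius (fst g) (w b)) (moebius (fst g) (w a)) *v (ctranspose (?J a) *v \<xi> a))"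
        using kern_invariant[OF g, of "w b" "w a" \<eta>] w ab by (simp add: matrix_vector_mul_assoc matrix_mul_assoc)
      then show "cinner (kern \<eta> (moebius (fst g) (w b)) (moebius (fst g) (w a)) *v (ctranspose (?J a) *v \<xi> a)) (ctranspose (?J b) *v \<xi> b)
         = cinner (kern \<eta> (w b) (w a) *v \<xi> a) (\<xi> b)"
        by (simp only: cinner_ctranspose[of "?J b"])
    qed
    have "(norm (\<Sum>a<M. cinner (f (moebius (fst g) (w a))) (ctranspose (?J a) *v \<xi> a)))\<^sup>2
       \<le> ?C * Re (\<Sum>a<M. \<Sum>b<M. cinner (kern \<eta> (moebius (fst g) (w b)) (moebius (fst g) (w a)) *v (ctranspose (?J a) *v \<xi> a)) (ctranspose (?J b) *v \<xi> b))"
      by (rule coeff_space.evaluation_bound[OF f]) (use w moebius_in_disc[OF g] in blast)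
    then show "(norm (\<Sum>a<M. cinner (?F (w a)) (\<xi> a)))\<^sup>2 \<le> ?C * Re (\<Sum>a<M. \<Sum>b<M. cinner (kern \<eta> (w b) (w a) *v \<xi> a) (\<xi> b))"
      unfolding 1 2 .
  qed
  have partial: "(\<Sum>k<n. level_sqnorm k (taylor_vec ?F k)) \<le> ?C" for n
  proof -
    let ?s = "\<Sum>k<n. level_sqnorm k (taylor_vec ?F k)"
    have c: "cinner (taylor_vec ?F k) (gram k *v taylor_vec ?F k) = of_real (level_sqnorm k (taylor_vec ?F k))" for k
    proof -
      have "cnj (cinner (taylor_vec ?F k) (gram k *v taylor_vec ?F k)) = cinner (taylor_vec ?F k) (gram k *v taylor_vec ?F k)"
        using cinner_gram_swap[of k "taylor_vec ?F k" "taylor_vec ?F k"] by (simp only: cnj_cinner complex_cnj_cnj)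
      then show ?thesis unfolding level_sqnorm_def cnj_cinner[of "taylor_vec ?F k", symmetric] by (simp add: complex_eq_iff)
    qed
    have "(norm (\<Sum>k<n. cinner (taylor_vec ?F k) (gram k *v taylor_vec ?F k)))\<^sup>2
        \<le> ?C * Re (\<Sum>k<n. cinner (coeff_mat \<eta> k *v (gram k *v taylor_vec ?F k)) (gram k *v taylor_vec ?F k))"
      by (intro kernel_bounded_taylor[OF hol bd] gram_level taylor_vec_in_level)
    then have "?s\<^sup>2 \<le> ?C * ?s"
      by (simp add: coeff_mat_gram taylor_vec_in_level c flip: of_real_sum)
    then show ?thesis
      using coeff_space.ip_nonneg[OF f] sum_nonneg[of "{..<n}" "\<lambda>k. level_sqnorm k (taylor_vec ?F k)"] level_sqnorm_nonneg
      by (cases "?s = 0") (auto simp: power2_eq_square dest: mult_right_le_imp_le)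
  qed
  have s: "summable (\<lambda>k. level_sqnorm k (taylor_vec ?F k))"
    by (rule summableI_nonneg_bounded[OF level_sqnorm_nonneg partial])
  then show F: "?F \<in> coeff_space" using hol by (simp add: coeff_space_def)
  show "Re (coeff_ip ?F ?F) \<le> ?C" unfolding Re_coeff_ip_self[OF F] by (rule suminf_le_const[OF s partial])
qed

text \<open>
  Both \<open>g\<close> and its inverse act by contractions.
\<close>

lemma acts_isometrically_coeff_space: "acts_isometrically \<beta> \<eta> Y coeff_space coeff_ip"
  unfolding acts_isometrically_def Let_def
proof (intro ballI conjI)
  fix g f assume g: "g \<in> SU11_cover" and f: "f \<in> coeff_space"
  note h = cover_inverse_in[OF g]
  have F: "act g f \<in> coeff_space" by (rule act_contraction[OF g f])
  then show "on_disc (\<lambda>z. multiplier \<beta> \<eta> Y g z *v f (moebius (fst g) z)) \<in> coeff_space" by (simp add: act_def)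
  have act_act: "act (cover_inverse g) (act g f) = f"
    using multiplier_action_inverse[OF h, of f \<eta>] coeff_space.vanish[OF f]
    unfolding act_def cover_inverse_cover_inverse[OF g] by blast
  have "Re (coeff_ip f f) \<le> Re (coeff_ip (act g f) (act g f))"
    using act_contraction(2)[OF h F] unfolding act_act .
  then have "Re (coeff_ip (act g f) (act g f)) = Re (coeff_ip f f)" using act_contraction(2)[OF g f] by simp
  then show "ip_norm coeff_ip (on_disc (\<lambda>z. multiplier \<beta> \<eta> Y g z *v f (moebius (fst g) z))) = ip_norm coeff_ip f"
    by (simp add: ip_norm_def act_def)
qed

text \<open>
  The inverse of \<open>kern \<eta> z z\<close>, in the form \<open>L\<^sup>* L\<close>.
\<close>

definition hermitian_structure :: "complex \<Rightarrow> complex^'n^'n" where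
  "hermitian_structure z = ctranspose (expY (- cnj z) ** dpow \<eta> (Ln (1 - z * cnj z))) ** (expY (- cnj z) ** dpow \<eta> (Ln (1 - z * cnj z)))"

lemma kern_hermitian_structure:
  assumes z: "z \<in> unit_disc"
  shows "kern \<eta> z z ** hermitian_structure z = mat 1"
proof -
  define s where "s = Ln (1 - z * cnj z)"
  have "1 - z * cnj z = of_real (1 - (norm z)\<^sup>2)" by (simp only: of_real_diff complex_norm_square of_real_1)
  moreover have "(norm z)\<^sup>2 < 1" using z by (simp add: abs_square_less_1)
  ultimately have "s = of_real (ln (1 - (norm z)\<^sup>2))" unfolding s_def by (simp only:) (rule Ln_of_real, simp)
  then have cs: "cnj s = s" by simp
  have "kern \<eta> z z ** hermitian_structure z = dpow \<eta> (- s) ** expY (cnj z) ** expYs z ** (dpow \<eta> (- s) ** dpow \<eta> s) ** expYs (- z) ** expY (- cnj z) ** dpow \<eta> s"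
    unfolding kern_def hermitian_structure_def s_def[symmetric] by (simp add: ctranspose_matrix_mul ctranspose_expY cs matrix_mul_assoc)
  also have "\<dots> = dpow \<eta> (- s) ** expY (cnj z) ** (expYs z ** expYs (- z)) ** expY (- cnj z) ** dpow \<eta> s"
    unfolding dpow_add by (simp add: matrix_mul_assoc)
  also have "\<dots> = dpow \<eta> (- s) ** (expY (cnj z) ** expY (- cnj z)) ** dpow \<eta> s"
    unfolding expYs_add by (simp add: matrix_mul_assoc)
  also have "\<dots> = mat 1" unfolding expY_add by (simp add: dpow_add)
  finally show ?thesis .
qed

lemma hermitian_structure_eq: "z \<in> unit_disc \<Longrightarrow> hermitian_structure z = matrix_inv (kern \<eta> z z)"
  using matrix_inv_eqI[OF kern_hermitian_structure] by simp

lemma hermitian_structure_positive_definite: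
  assumes z: "z \<in> unit_disc"
  shows "positive_definite (hermitian_structure z)"
proof -
  define L where "L = expY (- cnj z) ** dpow \<eta> (Ln (1 - z * cnj z))"
  have h: "hermitian_structure z = ctranspose L ** L" by (simp add: hermitian_structure_def L_def)
  have "0 < Re (cinner (hermitian_structure z *v x) x)" if x: "x \<noteq> 0" for x
  proof -
    have "L *v x \<noteq> 0"
    proof
      assume "L *v x = 0"
      then have "hermitian_structure z *v x = 0" by (simp add: h flip: matrix_vector_mul_assoc)
      moreover have "kern \<eta> z z *v (hermitian_structure z *v x) = x" using kern_hermitian_structure[OF z] by (simp add: matrix_vector_mul_assoc)
      ultimately show False using x by simp
    qed
    moreover have "cinner (hermitian_structure z *v x) x = cinner (L *v x) (L *v x)"
      using cinner_ctranspose[of "ctranspose L" "L *v x" x] by (simp add: h matrix_vector_mul_assoc)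
    ultimately show ?thesis by (simp add: cinner_self)
  qed
  then show ?thesis by (simp add: positive_definite_def h ctranspose_matrix_mul)
qed

lemma invariant_hermitian_structure: "invariant_hermitian \<beta> \<eta> Y (mat 1) hermitian_structure"
  unfolding invariant_hermitian_def
proof (intro conjI ballI)
  show "hermitian_structure 0 = mat 1" by (simp add: hermitian_structure_def)
  fix z assume z: "z \<in> unit_disc"
  then show "positive_definite (hermitian_structure z)" by (rule hermitian_structure_positive_definite)
next
  fix g z assume g: "g \<in> SU11_cover" and z: "z \<in> unit_disc"
  define J where "J = multiplier \<beta> \<eta> Y g z"
  define J' where "J' = multiplier \<beta> \<eta> Y (cover_inverse g) (moebius (fst g) z)"
  let ?k = "kern \<eta> (moebius (fst g) z) (moebius (fst g) z)"
  have JJ': "J ** J' = mat 1" unfolding J_def J'_def by (rule multiplier_inverse[OF g z])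
  then have J'J: "J' ** J = mat 1" using matrix_left_right_inverse by blast
  have inv: "J ** ?k ** ctranspose J = kern \<eta> z z" unfolding J_def by (rule kern_invariant[OF g z z])
  have "?k ** (ctranspose J ** hermitian_structure z ** J) = (J' ** J) ** ?k ** ctranspose J ** hermitian_structure z ** J"
    unfolding J'J by (simp add: matrix_mul_assoc)
  also have "\<dots> = J' ** (J ** ?k ** ctranspose J) ** hermitian_structure z ** J" by (simp only: matrix_mul_assoc)
  also have "\<dots> = J' ** (kern \<eta> z z ** hermitian_structure z) ** J" unfolding inv by (simp only: matrix_mul_assoc)
  also have "\<dots> = mat 1" unfolding kern_hermitian_structure[OF z] using J'J by simp
  finally have "matrix_inv ?k = ctranspose J ** hermitian_structure z ** J" by (rule matrix_inv_eqI)
  then show "hermitian_structure (moebius (fst g) z) = ctranspose (multiplier \<beta> \<eta> Y g z) ** hermitian_structure z ** multiplier \<beta> \<eta> Y g z"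
    using hermitian_structure_eq[OF moebius_in_disc[OF g z]] by (simp add: J_def)
qed

lemma evaluations_surjective_coeff_space: "evaluations_surjective coeff_space"
  unfolding evaluations_surjective_def
proof (intro ballI equalityI subsetI)
  fix z v assume z: "z \<in> unit_disc"
  have "on_disc (\<lambda>u. kern \<eta> u z *v (hermitian_structure z *v v)) z = v"
    using z kern_hermitian_structure[OF z] by (simp add: matrix_vector_mul_assoc)
  then show "v \<in> (\<lambda>f. f z) ` coeff_space" using kern_section(1)[OF z] by (metis imageI)
qed simp

theorem comes_from_kernel_coeff_space: "comes_from_kernel_of \<beta> \<eta> Y (mat 1) coeff_space" "shift_invariant coeff_space"
  unfolding comes_from_kernel_of_def
  using invariant_hermitian_structure hilbert_space_coeff_space evaluations_continuous_coeff_space evaluations_surjective_coeff_space acts_isometrically_coeff_space reproducing_kernel_coeff_space hermitian_structure_eq shift_invariant_coeff_space by blast+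

end

section \<open>The characterization\<close>

theorem theorem3p3:
  fixes \<eta> :: real and m :: nat and \<beta> :: "'n::finite \<Rightarrow> nat" and Y :: "complex^'n^'n"
  assumes "range \<beta> = {0..m}" and "subdiagonal \<beta> Y"
  shows "(\<exists>S. comes_from_kernel_of \<beta> \<eta> Y (mat 1) S \<and> shift_invariant S) \<longleftrightarrow>
           0 < \<eta> \<and> (\<forall>j\<in>{1..m}. block_condition \<beta> \<eta> Y j)"
proof -
  interpret graded_matrix \<beta> Y by unfold_locales fact
  show ?thesis
  proof
    assume "\<exists>S. comes_from_kernel_of \<beta> \<eta> Y (mat 1) S \<and> shift_invariant S"
    then show "0 < \<eta> \<and> (\<forall>j\<in>{1..m}. block_condition \<beta> \<eta> Y j)"
      using kernel_imp_conditions[OF assms(1)] by blast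
  next
    assume R: "0 < \<eta> \<and> (\<forall>j\<in>{1..m}. block_condition \<beta> \<eta> Y j)"
    then have N: "positive_definite (block_mat \<eta>)"
      using block_conditions_iff[OF assms(1)] by (intro block_mat_positive_definite) blast
    interpret positive_kernel \<beta> Y \<eta>
      by unfold_locales (use R N coeff_mat_positive coeff_mat_dominated in blast)+
    show "\<exists>S. comes_from_kernel_of \<beta> \<eta> Y (mat 1) S \<and> shift_invariant S"
      using comes_from_kernel_coeff_space by blast
  qed
qed

end
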